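(* Let $0<p<1$ and $m,r\in\mathbb{N}$ with $r<m$. There is a constant $C$, independent of $f$ and $n$, such that the following holds. Let $f$ be a function on $[0,1]$ such that $f^{(r-1)}\in AC[0,1]$ and $$\sum_{\nu=1}^\infty\nu^{-p}\mathcal{E}_{m-r,\nu}(f^{(r)})_p^p<\infty .$$ Then for any $n\in\mathbb{N}$, $$\mathcal{E}_{m,n}(f)_p\le\frac{C}{n^r}\left(\mathcal{E}_{m-r,n}(f^{(r)})_p+n^{1-\frac1p}\left(\sum_{\nu=n+1}^\infty\nu^{-p}\mathcal{E}_{m-r,\nu}(f^{(r)})_p^p\right)^{\frac1p}\right).$$
   Context: $\|f\|_p=\left(\int_0^1|f(x)|^p\,dx\right)^{1/p}$. $AC[0,1]$ is the set of absolutely continuous functions on $[0,1]$; when $f^{(r-1)}\in AC[0,1]$, $f^{(r)}$ denotes the (a.e. defined, integrable) derivative of $f^{(r-1)}$. For $m,n\in\mathbb{N}$, $\mathcal{S}_{m,n}$ is the set of all splines of degree $m-1$ with knots $t_j=j/n$, $j=0,\dots,n$: $S\in\mathcal{S}_{m,n}$ if $S\in C^{m-2}[0,1]$ and $S$ coincides with an algebraic polynomial of degree (at most) $m-1$ on each interval $(t_{j-1},t_j)$, $j=1,\dots,n$ (for $m=1$ no continuity is required). $\mathcal{E}_{m,n}(f)_p=\inf_{S\in\mathcal{S}_{m,n}}\|f-S\|_p$. *)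

theory Defs
  imports "HOL-Analysis.Analysis" "HOL-Computational_Algebra.Polynomial"
begin

text \<open>
  A function on \<open>[0,1]\<close> is a total function \<open>real \<Rightarrow> real\<close>, of which only the values on
  \<open>{0..1}\<close> are used.
\<close>

text \<open>
  The \<open>k\<close>-th derivative on \<open>[0,1]\<close>, one-sided at the end points. At a point where the derivative
  does not exist the value is unspecified; \<open>differentiable01\<close> says that it exists everywhere.
\<close>

primrec deriv01 :: "nat \<Rightarrow> (real \<Rightarrow> real) \<Rightarrow> real \<Rightarrow> real" where
  "deriv01 0 f = f"
| "deriv01 (Suc k) f = (\<lambda>x. vector_derivative (deriv01 k f) (at x within {0..1}))"

definition differentiable01 :: "nat \<Rightarrow> (real \<Rightarrow> real) \<Rightarrow> bool" where
  "differentiable01 k f \<longleftrightarrow> (\<forall>j<k. deriv01 j f differentiable_on {0..1})"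

definition C01 :: "nat \<Rightarrow> (real \<Rightarrow> real) set" where
  "C01 k = {f. differentiable01 k f \<and> continuous_on {0..1} (deriv01 k f)}"

text \<open>
  Finite families of non-overlapping compact intervals are expressed by \<open>division_of\<close>: the
  members of \<open>\<D>\<close> are the intervals \<open>{Inf K..Sup K}\<close>, and their interiors are pairwise disjoint.
\<close>

definition AC01 :: "(real \<Rightarrow> real) set" where
  "AC01 = {f. \<forall>\<epsilon>>0. \<exists>\<delta>>0. \<forall>\<D>.
      \<D> division_of \<Union>\<D> \<and> \<Union>\<D> \<subseteq> {0..1} \<and> (\<Sum>K\<in>\<D>. Sup K - Inf K) < \<delta> \<longrightarrow>
      (\<Sum>K\<in>\<D>. \<bar>f (Sup K) - f (Inf K)\<bar>) < \<epsilon>}"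

text \<open>
  Lebesgue rather than Borel measure, because a derivative that exists only almost everywhere is in
  general only Lebesgue measurable. The integral is the true one only if \<open>\<bar>f\<bar> powr p\<close> is integrable
  on \<open>[0,1]\<close> (otherwise it is \<open>0\<close>); this holds for \<open>0 < p \<le> 1\<close> and \<open>f\<close> integrable, so in particular
  for absolutely continuous functions, their derivatives, and their differences with splines.
\<close>

definition Lp_norm :: "real \<Rightarrow> (real \<Rightarrow> real) \<Rightarrow> real" where
  "Lp_norm p f = (LINT x:{0..1}|lebesgue. \<bar>f x\<bar> powr p) powr (1 / p)"

text \<open>Splines of degree \<open>m - 1\<close> with knots \<open>j / n\<close>, for \<open>m \<ge> 1\<close> and \<open>n \<ge> 1\<close>.\<close>

definition splines :: "nat \<Rightarrow> nat \<Rightarrow> (real \<Rightarrow> real) set" where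
  "splines m n = {S. (m \<ge> 2 \<longrightarrow> S \<in> C01 (m - 2)) \<and>
      (\<forall>j\<in>{1..n}. \<exists>P::real poly. degree P \<le> m - 1 \<and>
         (\<forall>x\<in>{(real j - 1) / real n <..< real j / real n}. S x = poly P x))}"

definition spline_err :: "nat \<Rightarrow> nat \<Rightarrow> real \<Rightarrow> (real \<Rightarrow> real) \<Rightarrow> real" where
  "spline_err m n p f = (INF S\<in>splines m n. Lp_norm p (\<lambda>x. f x - S x))"

end

theory Submission
  imports Defs
begin

text \<open>
  Put \<open>g = f\<^sup>(\<^sup>r\<^sup>)\<close>. The absolutely continuous function \<open>f\<^sup>(\<^sup>r\<^sup>-\<^sup>1\<^sup>)\<close> is the integral of \<open>g\<close>
  (\<open>AC01_fundamental_theorem\<close>), so Taylor's formula writes \<open>f\<close> as a polynomial plus the iterated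
  integral \<open>I g\<close>, with \<open>I g x = (\<integral>\<^sub>0\<^sup>1 g t (x - t)\<^sub>+\<^sup>r\<^sup>-\<^sup>1 dt) / (r - 1)!\<close>. Take a nearly best spline
  \<open>s\<close> of order \<open>m - r\<close> for \<open>g\<close>, and put \<open>h = g - s\<close>. The iterated integral of \<open>s\<close> is a spline of order
  \<open>m\<close>, so only \<open>I h\<close> has to be approximated. For each fixed \<open>t\<close> the truncated power
  \<open>(x - t)\<^sub>+\<^sup>r\<^sup>-\<^sup>1\<close> agrees, outside \<open>m\<close> cells next to \<open>t\<close>, with a combination of the spline truncated
  powers \<open>(x - j/n)\<^sub>+\<^sup>m\<^sup>-\<^sup>1\<close>, because the shifted powers \<open>(x - j/n)\<^sup>m\<^sup>-\<^sup>1\<close> span all polynomials of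
  degree below \<open>m\<close>. Integrating these combinations against \<open>h\<close> gives a spline whose distance
  from \<open>I h\<close> on a cell is at most \<open>C n\<^sup>1\<^sup>-\<^sup>r\<close> times the \<open>L\<^sub>1\<close> norm of \<open>h\<close> over neighbouring cells
  (\<open>iterated_integral_spline_approx\<close>).

  What remains is to bound the sum over the cells of the \<open>p\<close>-th powers of the local \<open>L\<^sub>1\<close> norms of
  \<open>h\<close> by errors measured in \<open>L\<^sub>p\<close> (\<open>sum_local_L1_powr_le\<close>). On polynomials the \<open>L\<^sub>1\<close> norm over an
  interval of length \<open>\<delta>\<close> is at most \<open>C \<delta>\<^sup>1\<^sup>-\<^sup>1\<^sup>/\<^sup>p\<close> times the \<open>L\<^sub>p\<close> norm (\<open>poly_nikolskii\<close>). So \<open>h\<close> is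
  telescoped through piecewise polynomials on grids that are refined dyadically, and the inequality
  \<open>(\<Sum>x\<^sub>i)\<^sup>p \<le> \<Sum>x\<^sub>i\<^sup>p\<close> adds the levels up.

  The obstacle is that \<open>\<E>\<^sub>\<nu>\<close> is not monotone in \<open>\<nu>\<close>: spline spaces for different \<open>\<nu>\<close> are nested only when
  one \<open>\<nu>\<close> divides the other, so the sum over all \<open>\<nu>\<close> does not obviously control the dyadic \<open>\<nu>\<close>, while
  the common refinement of two unrelated grids has arbitrarily short cells, on which Nikolskii's
  inequality is useless. The remedy is to give up smoothness of the intermediate approximants. On each
  cell of the grid with \<open>32 H\<close> cells, at least \<open>H / 2\<close> of the \<open>\<nu>\<close> with \<open>2 H < \<nu> \<le> 4 H\<close> have no knot
  inside the cell (\<open>card_knot_free_ge\<close>), so the best of the corresponding splines is a polynomial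
  there and its error is at most twice the sum of all the errors in the block divided by \<open>H\<close>
  (\<open>average_approximant\<close>).
\<close>

section \<open>Lagrange interpolation and Nikolskii's inequality\<close>

definition lagrange_basis :: "(nat \<Rightarrow> real) \<Rightarrow> nat \<Rightarrow> nat \<Rightarrow> real poly" where
  "lagrange_basis x d i = (\<Prod>l\<in>{..d}-{i}. smult (1 / (x i - x l)) [:- x l, 1:])"

lemma degree_lagrange_basis: "i \<le> d \<Longrightarrow> degree (lagrange_basis x d i) \<le> d"
proof -
  assume i: "i \<le> d"
  have "degree (lagrange_basis x d i) \<le> (\<Sum>l\<in>{..d}-{i}. degree (smult (1 / (x i - x l)) [:- x l, 1:]))"
    unfolding lagrange_basis_def by (rule order_trans[OF degree_prod_sum_le]) auto
  also have "\<dots> \<le> (\<Sum>l\<in>{..d}-{i}. 1)"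
    by (intro sum_mono) (auto intro: order_trans[OF degree_smult_le])
  also have "\<dots> = d" using i by simp
  finally show ?thesis .
qed

lemma poly_lagrange_basis:
  "poly (lagrange_basis x d i) y = (\<Prod>l\<in>{..d}-{i}. (y - x l) / (x i - x l))"
  by (simp add: lagrange_basis_def poly_prod diff_divide_distrib)

lemma lagrange_interpolation:
  assumes inj: "inj_on x {..d}" and deg: "degree P \<le> d"
  shows "P = (\<Sum>i\<le>d. smult (poly P (x i)) (lagrange_basis x d i))"
proof (rule poly_eqI_degree[where A = "x ` {..d}"])
  show "degree P < card (x ` {..d})" using deg by (simp add: card_image[OF inj])
  have "degree (\<Sum>i\<le>d. smult (poly P (x i)) (lagrange_basis x d i)) \<le> d"
    by (intro degree_sum_le) (auto intro: order_trans[OF degree_smult_le] degree_lagrange_basis)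
  then show "degree (\<Sum>i\<le>d. smult (poly P (x i)) (lagrange_basis x d i)) < card (x ` {..d})"
    by (simp add: card_image[OF inj])
  fix y assume "y \<in> x ` {..d}"
  then obtain j where j: "j \<le> d" "y = x j" by auto
  have at: "poly (lagrange_basis x d i) (x j) = (if i = j then 1 else 0)" if "i \<le> d" for i
  proof (cases "i = j")
    case True
    have "(\<Prod>l\<in>{..d}-{j}. (x j - x l) / (x j - x l)) = (\<Prod>l\<in>{..d}-{j}. 1)"
      by (rule prod.cong) (use inj j in \<open>auto simp: inj_on_def\<close>)
    with True show ?thesis by (simp add: poly_lagrange_basis)
  next
    case False
    then show ?thesis using j unfolding poly_lagrange_basis
      by (simp, intro bexI[of _ j]) auto
  qed
  show "poly P y = poly (\<Sum>i\<le>d. smult (poly P (x i)) (lagrange_basis x d i)) y"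
  proof -
    have "poly (\<Sum>i\<le>d. smult (poly P (x i)) (lagrange_basis x d i)) y
      = (\<Sum>i\<le>d. poly P (x i) * (if i = j then 1 else 0))"
      by (simp add: poly_sum j(2) at)
    also have "\<dots> = (\<Sum>i\<le>d. if i = j then poly P y else 0)" by (rule sum.cong) (simp_all add: j)
    also have "\<dots> = poly P y" using j by simp
    finally show ?thesis by simp
  qed
qed

lemma higher_pderiv_power_linear:
  fixes y :: real
  assumes "e \<le> M"
  shows "(pderiv ^^ e) ([:y, -1:] ^ M) = smult ((-1) ^ e * (fact M / fact (M - e))) ([:y, -1:] ^ (M - e))"
  using assms
proof (induction e)
  case (Suc e)
  then have e: "e \<le> M" "M - e = Suc (M - Suc e)" by auto
  have f: "(fact (M - e) :: real) = real (M - e) * fact (M - Suc e)"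
    by (subst e(2)) (simp add: e(2))
  have pos: "real (M - e) > 0" using Suc.prems by simp
  have coeff: "(-1) ^ e * (fact M / fact (M - e)) * (- real (M - e)) = (-1) ^ Suc e * (fact M / fact (M - Suc e))"
    unfolding f using pos by (simp del: of_nat_diff)
  have pd: "pderiv ([:y, -1:] ^ (M - e)) = smult (- real (M - e)) ([:y, -1:] ^ (M - Suc e))"
    by (subst e(2), subst pderiv_power_Suc) (simp add: e(2) pderiv_pCons)
  show ?case
    by (simp only: funpow.simps o_apply Suc.IH[OF e(1)] pderiv_smult pd smult_smult coeff)
qed simp

text \<open>
  The polynomial \<open>(y - s)\<^sup>M\<close> in \<open>s\<close> is interpolated at the nodes \<open>0, \<dots>, M\<close> without error, which
  writes it as \<open>\<Sum>\<^sub>l (y - l)\<^sup>M L\<^sub>l(s)\<close>. Differentiating \<open>M - d\<close> times in \<open>s\<close> lowers the exponent on the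
  left from \<open>M\<close> to \<open>d\<close> and leaves the powers \<open>(y - l)\<^sup>M\<close> alone.
\<close>

lemma shifted_powers_span:
  fixes M d :: nat
  assumes "d \<le> M"
  obtains c :: "nat \<Rightarrow> real poly" where
    "\<And>s y. (\<Sum>l\<le>M. poly (c l) s * (y - real l) ^ M) = (y - s) ^ d"
proof -
  define e where "e = M - d"
  define L where "L = lagrange_basis real M"
  define a where "a = (-1) ^ e * (fact M / fact d :: real)"
  have a: "a \<noteq> 0" by (simp add: a_def)
  have e: "e \<le> M" "M - e = d" using assms by (auto simp: e_def)
  have main: "(\<Sum>l\<le>M. (y - real l) ^ M * poly ((pderiv ^^ e) (L l)) s) = a * (y - s) ^ d" for s y :: real
  proof -
    have "degree ([:y, -1:] ^ M) \<le> M" 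
      using degree_power_le[of "[:y, -1:]" M] by simp
    from lagrange_interpolation[OF _ this, of real]
    have "[:y, -1:] ^ M = (\<Sum>l\<le>M. smult ((y - real l) ^ M) (L l))"
      by (simp add: L_def inj_on_def)
    then have "(pderiv ^^ e) ([:y, -1:] ^ M) = (\<Sum>l\<le>M. smult ((y - real l) ^ M) ((pderiv ^^ e) (L l)))"
      by (simp add: higher_pderiv_sum higher_pderiv_smult)
    then have "poly (smult a ([:y, -1:] ^ d)) s = poly (\<Sum>l\<le>M. smult ((y - real l) ^ M) ((pderiv ^^ e) (L l))) s"
      using e by (simp add: higher_pderiv_power_linear a_def)
    then show ?thesis by (simp add: poly_sum)
  qed
  show thesis
  proof (rule that[of "\<lambda>l. smult (1 / a) ((pderiv ^^ e) (L l))"])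
    fix s y :: real
    have "(\<Sum>l\<le>M. poly (smult (1 / a) ((pderiv ^^ e) (L l))) s * (y - real l) ^ M)
      = 1 / a * (\<Sum>l\<le>M. (y - real l) ^ M * poly ((pderiv ^^ e) (L l)) s)"
      by (simp add: sum_distrib_left mult_ac)
    also have "\<dots> = (y - s) ^ d" using a by (simp add: main)
    finally show "(\<Sum>l\<le>M. poly (smult (1 / a) ((pderiv ^^ e) (L l))) s * (y - real l) ^ M) = (y - s) ^ d" .
  qed
qed

text \<open>
  For \<open>p < 1\<close> there is no triangle inequality to lean on, so the polynomial is recovered from values:
  in each of \<open>d + 1\<close> subintervals pick the point where \<open>\<bar>P\<bar>\<close> is smallest. There \<open>\<bar>P\<bar>\<^sup>p\<close> is at most its
  mean over the subinterval, and as the points are well separated, interpolation bounds \<open>\<bar>P\<bar>\<close>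
  everywhere by these values.
\<close>

lemma poly_nikolskii:
  fixes p :: real
  assumes "0 < p"
  obtains A where "A > 0" "\<And>P a b. degree P \<le> d \<Longrightarrow> a < b \<Longrightarrow>
    (integral {a..b} (\<lambda>x. \<bar>poly P x\<bar>)) powr p \<le> A * (b - a) powr (p - 1) * integral {a..b} (\<lambda>x. \<bar>poly P x\<bar> powr p)"
proof -
  define B where "B = (real d + 1) * (2 * real d + 2) ^ d"
  define A where "A = B powr p * (2 * real d + 2)"
  have B: "B > 0" by (simp add: B_def)
  have A: "A > 0" using B by (simp add: A_def)
  have "(integral {a..b} (\<lambda>x. \<bar>poly P x\<bar>)) powr p \<le> A * (b - a) powr (p - 1) * integral {a..b} (\<lambda>x. \<bar>poly P x\<bar> powr p)"
    if deg: "degree P \<le> d" and ab: "a < b" for P a b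
  proof -
    \<comment> \<open>The nodes lie in every other one of \<open>2 d + 2\<close> subintervals of length \<open>h\<close>, hence are \<open>h\<close> apart.\<close>
    define h where "h = (b - a) / (2 * real d + 2)"
    have h: "h > 0" using ab by (simp add: h_def)
    have hb: "a + (2 * real d + 2) * h = b" by (simp add: h_def)
    define Q where "Q = integral {a..b} (\<lambda>x. \<bar>poly P x\<bar> powr p)"
    have cont: "continuous_on S (\<lambda>x. \<bar>poly P x\<bar> powr p)" for S
      using assms by (intro continuous_on_powr' continuous_intros) auto
    have intg: "(\<lambda>x. \<bar>poly P x\<bar> powr p) integrable_on {u..v}" for u v
      using cont by (rule integrable_continuous_real)
    have Q0: "Q \<ge> 0" unfolding Q_def by (intro integral_nonneg intg) auto
    have ex: "\<exists>x. x \<in> {a + 2 * real i * h .. a + (2 * real i + 1) * h} \<and> \<bar>poly P x\<bar> \<le> (Q / h) powr (1 / p)"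
      if i: "i \<le> d" for i
    proof -
      let ?u = "a + 2 * real i * h" and ?v = "a + (2 * real i + 1) * h"
      have uv: "?v - ?u = h" by (simp add: algebra_simps)
      have "?u \<le> ?v" using uv h by linarith
      then obtain x where x: "x \<in> {?u..?v}" "\<And>y. y \<in> {?u..?v} \<Longrightarrow> \<bar>poly P x\<bar> powr p \<le> \<bar>poly P y\<bar> powr p"
        using continuous_attains_inf[OF _ _ cont, of "{?u..?v}"] by auto
      have "(2 * real i + 1) * h \<le> (2 * real d + 2) * h" using i h by (intro mult_right_mono) auto
      moreover have "0 \<le> 2 * real i * h" using h by simp
      ultimately have sub: "{?u..?v} \<subseteq> {a..b}" using hb by auto
      have "h * \<bar>poly P x\<bar> powr p = integral {?u..?v} (\<lambda>_. \<bar>poly P x\<bar> powr p)"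
        using \<open>?u \<le> ?v\<close> uv by simp
      also have "\<dots> \<le> integral {?u..?v} (\<lambda>x. \<bar>poly P x\<bar> powr p)"
        by (intro integral_le intg x) auto
      also have "\<dots> \<le> Q" unfolding Q_def by (intro integral_subset_le intg sub) auto
      finally have "\<bar>poly P x\<bar> powr p \<le> Q / h" using h by (simp add: field_simps)
      then have "(\<bar>poly P x\<bar> powr p) powr (1 / p) \<le> (Q / h) powr (1 / p)"
        using assms by (intro powr_mono2) auto
      then show ?thesis using x(1) assms by (auto simp: powr_powr)
    qed
    then obtain x where x: "\<And>i. i \<le> d \<Longrightarrow> x i \<in> {a + 2 * real i * h .. a + (2 * real i + 1) * h}"
      "\<And>i. i \<le> d \<Longrightarrow> \<bar>poly P (x i)\<bar> \<le> (Q / h) powr (1 / p)" by metis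
    have sep_less: "x j - x i \<ge> h" if "i < j" "j \<le> d" for i j
    proof -
      have "a + 2 * real j * h \<le> x j" "x i \<le> a + (2 * real i + 1) * h" using x(1)[of i] x(1)[of j] that by auto
      moreover have "(2 * real i + 2) * h \<le> 2 * real j * h" using that h by (intro mult_right_mono) auto
      ultimately show ?thesis by (simp add: algebra_simps)
    qed
    have sep: "\<bar>x i - x j\<bar> \<ge> h" if "i \<noteq> j" "i \<le> d" "j \<le> d" for i j
      using sep_less[of i j] sep_less[of j i] that by (cases i j rule: linorder_cases) auto
    have inj: "inj_on x {..d}"
      using sep h by (fastforce simp: inj_on_def)
    have xin: "x i \<in> {a..b}" if "i \<le> d" for i
    proof -
      have "(2 * real i + 1) * h \<le> (2 * real d + 2) * h" using that h by (intro mult_right_mono) auto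
      moreover have "0 \<le> 2 * real i * h" using h by simp
      ultimately show ?thesis using x(1)[OF that] hb by (simp only: atLeastAtMost_iff) linarith
    qed
    have bound: "\<bar>poly P y\<bar> \<le> B * (Q / h) powr (1 / p)" if y: "y \<in> {a..b}" for y
    proof -
      have "poly P y = (\<Sum>i\<le>d. poly P (x i) * poly (lagrange_basis x d i) y)"
        by (subst lagrange_interpolation[OF inj deg]) (simp add: poly_sum)
      also have "\<bar>\<dots>\<bar> \<le> (\<Sum>i\<le>d. \<bar>poly P (x i) * poly (lagrange_basis x d i) y\<bar>)" by (rule sum_abs)
      also have "\<dots> \<le> (\<Sum>i\<le>d. (Q / h) powr (1 / p) * (2 * real d + 2) ^ d)"
      proof (rule sum_mono)
        fix i assume i: "i \<in> {..d}"
        have "\<bar>poly (lagrange_basis x d i) y\<bar> = (\<Prod>l\<in>{..d}-{i}. \<bar>y - x l\<bar> / \<bar>x i - x l\<bar>)"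
          by (simp add: poly_lagrange_basis abs_prod)
        also have "\<dots> \<le> (\<Prod>l\<in>{..d}-{i}. 2 * real d + 2)"
        proof (rule prod_mono, safe)
          fix l assume l: "l \<le> d" "l \<noteq> i"
          have "\<bar>y - x l\<bar> \<le> b - a" using y xin[OF l(1)] by auto
          moreover have "h \<le> \<bar>x i - x l\<bar>" using sep l i by auto
          ultimately have "\<bar>y - x l\<bar> / \<bar>x i - x l\<bar> \<le> (b - a) / h" using h by (intro frac_le) auto
          also have "\<dots> = 2 * real d + 2" using ab by (simp add: h_def)
          finally show "\<bar>y - x l\<bar> / \<bar>x i - x l\<bar> \<le> 2 * real d + 2" .
        qed auto
        also have "\<dots> = (2 * real d + 2) ^ d" using i by simp
        finally show "\<bar>poly P (x i) * poly (lagrange_basis x d i) y\<bar> \<le> (Q / h) powr (1 / p) * (2 * real d + 2) ^ d"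
          using x(2)[of i] i by (simp add: abs_mult mult_mono)
      qed
      also have "\<dots> = B * (Q / h) powr (1 / p)" by (simp add: B_def algebra_simps)
      finally show ?thesis .
    qed
    have "integral {a..b} (\<lambda>x. \<bar>poly P x\<bar>) \<le> integral {a..b} (\<lambda>x. B * (Q / h) powr (1 / p))"
      using bound by (intro integral_le integrable_continuous_real continuous_intros) auto
    also have "\<dots> = (b - a) * (B * (Q / h) powr (1 / p))" using ab by simp
    finally have le: "integral {a..b} (\<lambda>x. \<bar>poly P x\<bar>) \<le> (b - a) * (B * (Q / h) powr (1 / p))" .
    have "(integral {a..b} (\<lambda>x. \<bar>poly P x\<bar>)) powr p \<le> ((b - a) * (B * (Q / h) powr (1 / p))) powr p"
      using assms by (intro powr_mono2 le integral_nonneg integrable_continuous_real continuous_intros) auto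
    also have "\<dots> = (b - a) powr p * (B powr p * (Q / h))"
      using ab B Q0 h assms by (simp add: powr_mult powr_powr)
    also have "\<dots> = A * (b - a) powr (p - 1) * Q"
      using ab by (simp add: A_def h_def powr_diff field_simps)
    finally show ?thesis by (simp add: Q_def)
  qed
  then show thesis using that A by blast
qed

section \<open>Knots of uniform grids and small cells\<close>

text \<open>
  If \<open>x\<close> itself is within \<open>1/8\<close> of \<open>0\<close>, the multiples of \<open>x\<close> leave this neighbourhood in steps shorter
  than \<open>1/8\<close>, and they do so within \<open>H\<close> steps; the other half of the range is symmetric.
\<close>

lemma exists_multiplier_far_from_int:
  fixes x :: real
  assumes H: "1 \<le> H" and x: "1 / (8 * real H) \<le> x" "x \<le> 1 - 1 / (8 * real H)"
  obtains q where "1 \<le> q" "q \<le> H" "\<And>z::int. \<bar>real q * x - z\<bar> \<ge> 1 / 8"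
proof -
  have half: "\<exists>q. 1 \<le> q \<and> q \<le> H \<and> (\<forall>z::int. \<bar>real q * y - z\<bar> \<ge> 1 / 8)"
    if y: "1 / (8 * real H) \<le> y" "y \<le> 1 / 2" for y
  proof -
    have y0: "0 < y" using H by (auto intro!: less_le_trans[OF _ y(1)])
    define q where "q = nat \<lceil>1 / (8 * y)\<rceil>"
    have c: "\<lceil>1 / (8 * y)\<rceil> \<ge> 1" using y0 by (simp add: one_le_ceiling)
    then have q: "real q \<ge> 1 / (8 * y)" "real q < 1 / (8 * y) + 1" unfolding q_def by linarith+
    have "1 / (8 * y) \<le> real H" using y y0 H by (simp add: field_simps)
    then have qH: "q \<le> H" unfolding q_def by (simp add: ceiling_le_iff nat_le_iff)
    have lo: "1 / 8 \<le> real q * y" using q(1) y0 by (simp add: field_simps)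
    have hi: "real q * y \<le> 5 / 8"
    proof -
      have "(1 / (8 * y) + 1) * y = 1 / 8 + y" using y0 by (simp add: distrib_right)
      with mult_strict_right_mono[OF q(2) y0] y show ?thesis by linarith
    qed
    have "\<bar>real q * y - z\<bar> \<ge> 1 / 8" for z :: int
    proof (cases "z \<le> 0")
      case True
      then have "real_of_int z \<le> 0" by simp
      with lo show ?thesis by linarith
    next
      case False
      then have "real_of_int z \<ge> 1" by simp
      with hi show ?thesis by linarith
    qed
    moreover have "1 \<le> q" using c unfolding q_def by linarith
    ultimately show ?thesis using qH by blast
  qed
  show thesis
  proof (cases "x \<le> 1 / 2")
    case True
    with half[OF x(1)] that show ?thesis by blast
  next
    case False
    then obtain q where q: "1 \<le> q" "q \<le> H" "\<And>z::int. \<bar>real q * (1 - x) - z\<bar> \<ge> 1 / 8"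
      using half[of "1 - x"] x by (auto simp: not_le)
    have "\<bar>real q * x - z\<bar> \<ge> 1 / 8" for z :: int
    proof -
      have "real q * (1 - x) - of_int (int q - z) = - (real q * x - z)" by (simp add: algebra_simps)
      with q(3)[of "int q - z"] show ?thesis by (simp only: abs_minus_cancel)
    qed
    with q that show ?thesis by blast
  qed
qed

definition knot_free :: "nat \<Rightarrow> real \<Rightarrow> real \<Rightarrow> bool" where
  "knot_free \<nu> a b \<longleftrightarrow> (\<forall>l::int. of_int l / real \<nu> \<notin> {a<..<b})"

text \<open>
  Let \<open>x\<close> be the centre of the cell. A knot \<open>l/\<nu>\<close> inside the cell forces \<open>\<nu> x\<close> to be within \<open>1/16\<close> of an
  integer. If both \<open>\<nu>\<close> and \<open>\<nu> + q\<close> have such a knot, then \<open>q x\<close> is within \<open>1/8\<close> of an integer, and \<open>q\<close> can be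
  chosen so that this is false. Hence one of \<open>\<nu>\<close>, \<open>\<nu> + q\<close> is always good. Such a \<open>q\<close> can only be missing when \<open>x\<close> is
  very close to \<open>0\<close> or \<open>1\<close>, and then the cell lies outside the range of all inner knots.
\<close>

lemma card_knot_free_ge:
  assumes H: "1 \<le> H" and j: "j < 32 * H"
  shows "H \<le> 2 * card {\<nu>\<in>{2*H<..4*H}. knot_free \<nu> (real j / real (32*H)) (real (Suc j) / real (32*H))}"
proof -
  define a b where "a = real j / real (32*H)" and "b = real (Suc j) / real (32*H)"
  define x where "x = (a + b) / 2"
  define G where "G = {\<nu>\<in>{2*H<..4*H}. knot_free \<nu> a b}"
  have H0: "real H > 0" using H by simp
  have ab: "b - a = 1 / (32 * real H)" using H0 by (simp add: a_def b_def field_simps)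
  have a0: "0 \<le> a" by (simp add: a_def)
  have "real (Suc j) \<le> real (32 * H)" using j by (intro of_nat_mono) simp
  then have b1: "b \<le> 1" using H0 by (simp add: b_def field_simps)
  have near: "\<exists>l::int. \<bar>real \<nu> * x - l\<bar> < 1 / 16" if "\<not> knot_free \<nu> a b" "\<nu> \<in> {2*H<..4*H}" for \<nu>
  proof -
    from that obtain l :: int where l: "of_int l / real \<nu> \<in> {a<..<b}" by (auto simp: knot_free_def)
    have nu: "0 < real \<nu>" "real \<nu> \<le> 4 * real H" using that(2) by auto
    have "\<bar>x - l / real \<nu>\<bar> < 1 / (64 * real H)" 
    proof -
      have e: "1 / (64 * real H) = (b - a) / 2" unfolding ab by simp
      have "\<bar>(a + b) / 2 - z\<bar> < (b - a) / 2" if "a < z" "z < b" for z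
        using that by (simp add: abs_less_iff field_simps)
      with l show ?thesis unfolding e x_def by simp
    qed
    then have "real \<nu> * \<bar>x - l / real \<nu>\<bar> < real \<nu> * (1 / (64 * real H))" using nu by (intro mult_strict_left_mono) auto
    also have "\<dots> \<le> 1 / 16" using nu H0 by (simp add: field_simps)
    also have "real \<nu> * \<bar>x - l / real \<nu>\<bar> = \<bar>real \<nu> * x - l\<bar>"
      using nu by (simp add: abs_mult_pos' right_diff_distrib)
    finally show ?thesis by (rule exI)
  qed
  have fin: "finite G" by (simp add: G_def)
  have "H \<le> 2 * card G"
  proof (cases "1 / (8 * real H) \<le> x \<and> x \<le> 1 - 1 / (8 * real H)")
    case True
    then obtain q where q: "1 \<le> q" "q \<le> H" "\<And>z::int. \<bar>real q * x - z\<bar> \<ge> 1 / 8"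
      using exists_multiplier_far_from_int[OF H] by metis
    \<comment> \<open>As \<open>q \<le> H\<close>, both \<open>\<nu>\<close> and \<open>\<nu> + q\<close> stay in the block.\<close>
    have "{2*H<..3*H} \<subseteq> G \<union> {\<nu>. \<nu> + q \<in> G}"
    proof (rule subsetI, rule ccontr)
      fix \<nu> assume nu: "\<nu> \<in> {2*H<..3*H}" and "\<nu> \<notin> G \<union> {\<nu>. \<nu> + q \<in> G}"
      with q have "\<not> knot_free \<nu> a b" "\<not> knot_free (\<nu> + q) a b" by (auto simp: G_def)
      moreover have "\<nu> \<in> {2*H<..4*H}" "\<nu> + q \<in> {2*H<..4*H}" using nu q by auto
      ultimately obtain l l' :: int where "\<bar>real \<nu> * x - l\<bar> < 1 / 16" "\<bar>real (\<nu> + q) * x - l'\<bar> < 1 / 16"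
        using near by blast
      moreover have "real (\<nu> + q) * x = real \<nu> * x + real q * x" by (simp add: distrib_right)
      ultimately have "\<bar>real q * x - of_int (l' - l)\<bar> < 1 / 8" unfolding of_int_diff by linarith
      with q(3)[of "l' - l"] show False by linarith
    qed
    moreover have "finite {\<nu>. \<nu> + q \<in> G}"
      using finite_vimageI[OF fin, of "\<lambda>\<nu>. \<nu> + q"] by (simp add: vimage_def)
    ultimately have "card {2*H<..3*H} \<le> card G + card {\<nu>. \<nu> + q \<in> G}"
      using fin by (meson card_Un_le card_mono finite_UnI order_trans)
    also have "card {\<nu>. \<nu> + q \<in> G} \<le> card G"
      by (rule card_inj_on_le[of "\<lambda>\<nu>. \<nu> + q"]) (auto simp: fin)
    finally show ?thesis by simp
  next
    case False
    \<comment> \<open>Inner knots have distance at least \<open>1/\<nu> \<ge> 1/(4 H)\<close> from \<open>0\<close> and \<open>1\<close>, but the cell is closer than that.\<close>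
    have "knot_free \<nu> a b" if nu: "\<nu> \<in> {2*H<..4*H}" for \<nu>
    proof (rule ccontr)
      assume "\<not> knot_free \<nu> a b"
      then obtain l :: int where l: "a < of_int l / real \<nu>" "of_int l / real \<nu> < b" by (auto simp: knot_free_def)
      have nu: "0 < real \<nu>" "real \<nu> \<le> 4 * real H" using nu by auto
      have "0 < real_of_int l" using l(1) a0 nu(1) by (rule_tac ccontr) (use divide_nonpos_pos[of "real_of_int l" "real \<nu>"] in \<open>auto simp: not_less\<close>)
      then have l1: "1 \<le> real_of_int l" by simp
      have "real_of_int l < real \<nu>" using l(2) b1 nu(1) less_le_trans[OF l(2) b1] by (simp add: divide_less_eq)
      then have "l < int \<nu>" by linarith
      then have l2: "real_of_int l \<le> real \<nu> - 1" by linarith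
      have inv: "1 / (4 * real H) \<le> 1 / real \<nu>" using nu by (simp add: field_simps)
      have lo: "1 / real \<nu> \<le> l / real \<nu>" using l1 nu by (intro divide_right_mono) auto
      have "l / real \<nu> \<le> (real \<nu> - 1) / real \<nu>" using l2 nu by (intro divide_right_mono) auto
      also have "\<dots> = 1 - 1 / real \<nu>" using nu by (simp add: field_simps)
      finally have hi: "l / real \<nu> \<le> 1 - 1 / real \<nu>" .
      define u where "u = 1 / real H"
      have "1 / (4 * real H) = u / 4" "1 / (32 * real H) = u / 32" "1 / (8 * real H) = u / 8" "u > 0"
        using H0 by (auto simp: u_def)
      note u = this
      have contr: False if "\<not> (u / 8 \<le> (a + b) / 2 \<and> (a + b) / 2 \<le> 1 - u / 8)" "v \<le> w" "w \<le> 1 - v"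
        "a < w" "w < b" "u / 4 \<le> v" "b - a = u / 32" for v w
        using that u(4) by argo
      show False
        by (rule contr[of "1 / real \<nu>" "l / real \<nu>"]) (use False lo hi l inv ab u x_def in simp_all)
    qed
    then have "G = {2*H<..4*H}" by (auto simp: G_def)
    then show ?thesis by simp
  qed
  then show ?thesis by (simp add: G_def a_def b_def)
qed

section \<open>Piecewise polynomials on uniform grids\<close>

lemma powr_add_le_add_powr:
  fixes x y p :: real
  assumes "0 < p" "p \<le> 1" "0 \<le> x" "0 \<le> y"
  shows "(x + y) powr p \<le> x powr p + y powr p"
proof (cases "x + y = 0")
  case False
  then have pos: "x + y > 0" using assms by linarith
  have *: "z \<le> z powr p" if "0 \<le> z" "z \<le> 1" for z :: real
    using powr_mono'[of p 1 z] that assms by (cases "z = 0") auto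
  have "1 = x / (x + y) + y / (x + y)" using pos by (simp add: add_divide_distrib[symmetric])
  also have "\<dots> \<le> (x / (x + y)) powr p + (y / (x + y)) powr p"
    using assms pos by (intro add_mono *) auto
  also have "\<dots> = (x powr p + y powr p) / (x + y) powr p"
    using assms pos by (simp add: powr_divide add_divide_distrib)
  finally show ?thesis using pos by (simp add: le_divide_eq)
qed (use assms in auto)

lemma powr_sum_le_sum_powr:
  fixes p :: real
  assumes "0 < p" "p \<le> 1" "\<And>i. i \<in> A \<Longrightarrow> 0 \<le> x i"
  shows "(\<Sum>i\<in>A. x i) powr p \<le> (\<Sum>i\<in>A. x i powr p)"
  using assms(3)
proof (induction A rule: infinite_finite_induct)
  case (insert i A)
  then have "(x i + sum x A) powr p \<le> x i powr p + (sum x A) powr p"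
    using assms by (intro powr_add_le_add_powr sum_nonneg) auto
  moreover have "(sum x A) powr p \<le> (\<Sum>i\<in>A. x i powr p)" using insert by auto
  ultimately show ?case using insert(1,2) by simp
qed auto

lemma absolutely_integrable_abs_powr:
  fixes f :: "real \<Rightarrow> real"
  assumes "0 < p" "p \<le> 1" and f: "f absolutely_integrable_on {a..b}"
  shows "(\<lambda>x. \<bar>f x\<bar> powr p) absolutely_integrable_on {a..b}"
proof -
  have meas: "f \<in> borel_measurable (lebesgue_on {a..b})"
    using f by (simp add: absolutely_integrable_measurable_real)
  have int: "(\<lambda>x. 1 + \<bar>f x\<bar>) absolutely_integrable_on {a..b}"
  proof (rule set_integral_add)
    show "(\<lambda>x. 1 :: real) absolutely_integrable_on {a..b}" by (intro absolutely_integrable_continuous_real) auto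
    show "(\<lambda>x. \<bar>f x\<bar>) absolutely_integrable_on {a..b}" using set_integrable_norm[OF f] by simp
  qed
  show ?thesis
  proof (rule measurable_bounded_by_integrable_imp_absolutely_integrable)
    show "(\<lambda>x. \<bar>f x\<bar> powr p) \<in> borel_measurable (lebesgue_on {a..b})" using meas by measurable
    show "(\<lambda>x. 1 + \<bar>f x\<bar>) integrable_on {a..b}" using int by (rule set_lebesgue_integral_eq_integral)
    fix x
    show "norm (\<bar>f x\<bar> powr p) \<le> 1 + \<bar>f x\<bar>"
    proof (cases "\<bar>f x\<bar> \<le> 1")
      case True
      then have "\<bar>f x\<bar> powr p \<le> 1 powr p" using assms by (intro powr_mono2) auto
      then show ?thesis by simp
    next
      case False
      then have "\<bar>f x\<bar> powr p \<le> \<bar>f x\<bar> powr 1" using assms by (intro powr_mono) auto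
      then show ?thesis by simp
    qed
  qed auto
qed

lemma integral_nonneg_pointwise:
  fixes f :: "real \<Rightarrow> real"
  assumes "\<And>x. x \<in> S \<Longrightarrow> 0 \<le> f x"
  shows "0 \<le> integral S f"
  by (cases "f integrable_on S")
    (auto simp: assms not_integrable_integral intro: Henstock_Kurzweil_Integration.integral_nonneg)

definition cell :: "nat \<Rightarrow> nat \<Rightarrow> real set" where
  "cell n j = {real j / real n .. real (Suc j) / real n}"

abbreviation open_cell :: "nat \<Rightarrow> nat \<Rightarrow> real set" where
  "open_cell n j \<equiv> {real j / real n<..<real (Suc j) / real n}"

definition piecewise_poly :: "nat \<Rightarrow> nat \<Rightarrow> (real \<Rightarrow> real) \<Rightarrow> bool" where
  "piecewise_poly d n u \<longleftrightarrow>
    (\<forall>j<n. \<exists>P. degree P \<le> d \<and> (\<forall>x\<in>open_cell n j. u x = poly P x))"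

lemma cell_subset: "j < n \<Longrightarrow> cell n j \<subseteq> {0..1}"
proof -
  assume "j < n"
  then have "real (Suc j) \<le> real n" "0 < real n" by (auto simp: Suc_le_eq simp del: of_nat_Suc)
  then have "real (Suc j) / real n \<le> 1" by (subst divide_le_eq_1) auto
  then show ?thesis by (auto simp: cell_def intro: order_trans[OF divide_nonneg_nonneg])
qed

lemma integral_sum_intervals:
  fixes f :: "real \<Rightarrow> real" and a :: "nat \<Rightarrow> real"
  assumes "f integrable_on {a 0..a N}" and "\<And>i. i < N \<Longrightarrow> a i \<le> a (Suc i)"
  shows "integral {a 0..a N} f = (\<Sum>i<N. integral {a i..a (Suc i)} f)"
  using assms
proof (induction N)
  case (Suc N)
  note Suc_prems = Suc.prems(2)
  have "a 0 \<le> a i" if "i \<le> N" for i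
    using that
  proof (induction i)
    case (Suc i)
    then have "a 0 \<le> a i" by simp
    also have "a i \<le> a (Suc i)" by (rule Suc_prems) (use Suc.prems in simp)
    finally show ?case .
  qed simp
  then have le: "a 0 \<le> a N" "a N \<le> a (Suc N)" using Suc.prems(2) by auto
  then have "f integrable_on {a 0..a N}"
    by (intro integrable_on_subinterval[OF Suc.prems(1)]) auto
  then have "integral {a 0..a N} f = (\<Sum>i<N. integral {a i..a (Suc i)} f)"
    by (intro Suc.IH) (auto intro: Suc.prems(2))
  with Henstock_Kurzweil_Integration.integral_combine[OF le Suc.prems(1)] show ?case by simp
qed simp

lemma integral_cells:
  fixes f :: "real \<Rightarrow> real"
  assumes "0 < n" "f integrable_on {0..1}"
  shows "integral {0..1} f = (\<Sum>j<n. integral (cell n j) f)"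
  using integral_sum_intervals[of f "\<lambda>j. real j / real n" n] assms
  by (simp add: cell_def divide_right_mono)

lemma integral_subcells:
  fixes f :: "real \<Rightarrow> real"
  assumes "0 < n" "0 < c" "f integrable_on cell n j"
  shows "integral (cell n j) f = (\<Sum>i<c. integral (cell (c * n) (c * j + i)) f)"
proof -
  define a where "a i = real (c * j + i) / real (c * n)" for i
  have a: "{a 0..a c} = cell n j" using assms by (auto simp: a_def cell_def field_simps)
  have "integral {a 0..a c} f = (\<Sum>i<c. integral {a i..a (Suc i)} f)"
    by (rule integral_sum_intervals) (use assms a in \<open>auto simp: a_def divide_right_mono\<close>)
  then show ?thesis unfolding a by (simp add: a_def cell_def)
qed

lemma piecewise_poly_refine:
  assumes "piecewise_poly d n u" "0 < n" "0 < c"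
  shows "piecewise_poly d (c * n) u"
  unfolding piecewise_poly_def
proof safe
  fix j assume j: "j < c * n"
  then have "j div c < n" using assms by (simp add: div_less_iff_less_mult mult.commute)
  then obtain P where P: "degree P \<le> d" "\<And>x. x \<in> open_cell n (j div c) \<Longrightarrow> u x = poly P x"
    using assms(1) by (auto simp: piecewise_poly_def)
  have "c * (j div c) \<le> j" "Suc j \<le> c * Suc (j div c)"
    using assms(3) by (auto simp: Suc_le_eq dividend_less_times_div)
  then have "real c * real (j div c) \<le> real j" "real (Suc j) \<le> real c * real (Suc (j div c))"
    unfolding of_nat_mult[symmetric] of_nat_le_iff by auto
  then have "real (j div c) / real n \<le> real j / real (c * n)" "real (Suc j) / real (c * n) \<le> real (Suc (j div c)) / real n"
    using assms by (simp_all add: field_simps del: of_nat_Suc)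
  then have "open_cell (c * n) j \<subseteq> open_cell n (j div c)"
    by auto
  with P show "\<exists>P. degree P \<le> d \<and> (\<forall>x\<in>open_cell (c * n) j. u x = poly P x)"
    by blast
qed

lemma piecewise_poly_add_scaled:
  assumes "piecewise_poly d n u" "piecewise_poly d n v"
  shows "piecewise_poly d n (\<lambda>x. u x + c * v x)"
  unfolding piecewise_poly_def
proof safe
  fix j assume j: "j < n"
  let ?I = "open_cell n j"
  from assms j obtain P Q where "degree P \<le> d" "\<And>x. x \<in> ?I \<Longrightarrow> u x = poly P x"
    "degree Q \<le> d" "\<And>x. x \<in> ?I \<Longrightarrow> v x = poly Q x"
    unfolding piecewise_poly_def by metis
  then show "\<exists>P. degree P \<le> d \<and> (\<forall>x\<in>?I. u x + c * v x = poly P x)"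
    by (intro exI[of _ "P + smult c Q"]) (auto intro!: degree_add_le order_trans[OF degree_smult_le])
qed

lemma integral_cong_Ioo:
  fixes f g :: "real \<Rightarrow> real"
  assumes "\<And>x. x \<in> {a<..<b} \<Longrightarrow> f x = g x"
  shows "integral {a..b} f = integral {a..b} g"
  unfolding integral_open_interval_real by (rule integral_cong) (use assms in auto)

lemma absolutely_integrable_cong_Ioo:
  fixes f g :: "real \<Rightarrow> real"
  assumes "\<And>x. x \<in> {a<..<b} \<Longrightarrow> f x = g x" "g absolutely_integrable_on {a..b}"
  shows "f absolutely_integrable_on {a..b}"
  using absolutely_integrable_spike[OF assms(2), of "{a, b}" f] assms(1)
  by (auto simp: less_le)

lemma piecewise_poly_integrable:
  assumes "piecewise_poly d n u" "0 < n"
  shows "u absolutely_integrable_on {0..1}"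
proof -
  have "u absolutely_integrable_on cell n j" if j: "j < n" for j
  proof -
    obtain P where "\<And>x. x \<in> open_cell n j \<Longrightarrow> u x = poly P x"
      using assms(1) j unfolding piecewise_poly_def by metis
    then show ?thesis unfolding cell_def
      by (rule absolutely_integrable_cong_Ioo) 
        (auto intro!: absolutely_integrable_continuous_real continuous_intros)
  qed
  then have "u absolutely_integrable_on (\<Union>j\<in>{..<n}. cell n j)"
    by (intro set_integrable_UN) (auto simp: cell_def)
  moreover have "{0..1} \<subseteq> (\<Union>j\<in>{..<n}. cell n j)"
  proof
    fix x :: real assume x: "x \<in> {0..1}"
    show "x \<in> (\<Union>j\<in>{..<n}. cell n j)"
    proof (cases "x = 1")
      case True
      have "x \<in> cell n (n - 1)" using assms(2) True by (simp add: cell_def)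
      then show ?thesis using assms(2) by (intro UN_I[of "n - 1"]) auto
    next
      case False
      define j where "j = nat \<lfloor>x * real n\<rfloor>"
      have x0: "0 \<le> x * real n" "x * real n < real n" using x False assms(2) by auto
      then have "real j \<le> x * real n" "x * real n < real (Suc j)" "real j < real n" unfolding j_def by linarith+
      then have "x \<in> cell n j" "j < n" using assms(2) by (auto simp: cell_def field_simps)
      then show ?thesis by auto
    qed
  qed
  ultimately show ?thesis by (rule absolutely_integrable_on_subinterval)
qed

text \<open>
  Nikolskii's inequality on every subcell, summed up with the subadditivity of \<open>x\<^sup>p\<close>. The factor
  depends on the fine grid only, so a coarse cell costs nothing.
\<close>

lemma piecewise_poly_nikolskii:
  assumes "0 < p" "p \<le> 1"
  obtains A where "A > 0" "\<And>c n j u. \<lbrakk>piecewise_poly d (c * n) u; 0 < c; 0 < n; j < n\<rbrakk> \<Longrightarrow>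
    (integral (cell n j) (\<lambda>x. \<bar>u x\<bar>)) powr p
      \<le> A * real (c * n) powr (1 - p) * integral (cell n j) (\<lambda>x. \<bar>u x\<bar> powr p)"
proof -
  obtain A where A: "A > 0" and nik: "\<And>P a b. degree P \<le> d \<Longrightarrow> a < b \<Longrightarrow>
    (integral {a..b} (\<lambda>x. \<bar>poly P x\<bar>)) powr p \<le> A * (b - a) powr (p - 1) * integral {a..b} (\<lambda>x. \<bar>poly P x\<bar> powr p)"
    using poly_nikolskii[OF assms(1)] by metis
  show thesis
  proof (rule that[OF A])
    fix c n j u assume u: "piecewise_poly d (c * n) u" and c: "0 < c" "0 < n" "j < n"
    let ?N = "c * n"
    have uint: "u absolutely_integrable_on {0..1}" by (rule piecewise_poly_integrable[OF u]) (use c in auto)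
    have u1: "(\<lambda>x. \<bar>u x\<bar>) absolutely_integrable_on {0..1}" using set_integrable_norm[OF uint] by simp
    have up: "(\<lambda>x. \<bar>u x\<bar> powr p) absolutely_integrable_on {0..1}" by (rule absolutely_integrable_abs_powr[OF assms uint])
    have sub: "h integrable_on cell N i" if "h absolutely_integrable_on {0..1}" "i < N" for h :: "real \<Rightarrow> real" and i N
      using integrable_on_subinterval[OF set_lebesgue_integral_eq_integral(1)[OF that(1)]] cell_subset[OF that(2)]
      unfolding cell_def by blast
    have "(integral (cell n j) (\<lambda>x. \<bar>u x\<bar>)) powr p = (\<Sum>i<c. integral (cell ?N (c * j + i)) (\<lambda>x. \<bar>u x\<bar>)) powr p"
      using c by (simp add: integral_subcells[OF _ _ sub[OF u1]])
    also have "\<dots> \<le> (\<Sum>i<c. (integral (cell ?N (c * j + i)) (\<lambda>x. \<bar>u x\<bar>)) powr p)"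
      by (intro powr_sum_le_sum_powr integral_nonneg_pointwise) (auto simp: assms)
    also have "\<dots> \<le> (\<Sum>i<c. A * real ?N powr (1 - p) * integral (cell ?N (c * j + i)) (\<lambda>x. \<bar>u x\<bar> powr p))"
    proof (rule sum_mono)
      fix i assume "i \<in> {..<c}"
      then have "c * j + i < c * j + c" by simp
      also have "\<dots> = c * Suc j" by simp
      also have "\<dots> \<le> ?N" using c by (intro mult_le_mono) auto
      finally have i: "c * j + i < ?N" .
      let ?a = "real (c * j + i) / real ?N" and ?b = "real (Suc (c * j + i)) / real ?N"
      obtain P where P: "degree P \<le> d" "\<And>x. x \<in> {?a<..<?b} \<Longrightarrow> u x = poly P x"
        using u i unfolding piecewise_poly_def by blast
      have ab: "?b - ?a = 1 / real ?N" by (simp add: diff_divide_distrib[symmetric])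
      have N0: "real ?N > 0" using c by simp
      have "?a < ?b" using N0 by (simp add: divide_strict_right_mono)
      from nik[OF P(1) this]
      have "(integral {?a..?b} (\<lambda>x. \<bar>u x\<bar>)) powr p \<le> A * (1 / real ?N) powr (p - 1) * integral {?a..?b} (\<lambda>x. \<bar>u x\<bar> powr p)"
        using integral_cong_Ioo[of ?a ?b "\<lambda>x. \<bar>u x\<bar>" "\<lambda>x. \<bar>poly P x\<bar>"]
          integral_cong_Ioo[of ?a ?b "\<lambda>x. \<bar>u x\<bar> powr p" "\<lambda>x. \<bar>poly P x\<bar> powr p"] P(2) ab by simp
      also have "(1 / real ?N) powr (p - 1) = real ?N powr (1 - p)"
        using N0 by (simp add: powr_divide powr_diff field_simps powr_minus)
      finally show "(integral (cell ?N (c * j + i)) (\<lambda>x. \<bar>u x\<bar>)) powr p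
        \<le> A * real ?N powr (1 - p) * integral (cell ?N (c * j + i)) (\<lambda>x. \<bar>u x\<bar> powr p)"
        by (simp add: cell_def)
    qed
    also have "\<dots> = A * real ?N powr (1 - p) * (\<Sum>i<c. integral (cell ?N (c * j + i)) (\<lambda>x. \<bar>u x\<bar> powr p))"
      by (simp add: sum_distrib_left)
    also have "(\<Sum>i<c. integral (cell ?N (c * j + i)) (\<lambda>x. \<bar>u x\<bar> powr p)) = integral (cell n j) (\<lambda>x. \<bar>u x\<bar> powr p)"
      using c by (simp add: integral_subcells[OF _ _ sub[OF up]])
    finally show "(integral (cell n j) (\<lambda>x. \<bar>u x\<bar>)) powr p
      \<le> A * real ?N powr (1 - p) * integral (cell n j) (\<lambda>x. \<bar>u x\<bar> powr p)" .
  qed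
qed

section \<open>Local mean approximation by telescoping\<close>

text \<open>The \<open>p\<close>-th power of the \<open>L\<^sub>p\<close> distance on \<open>[0,1]\<close>; for \<open>p \<le> 1\<close> it is this power that obeys the triangle inequality.\<close>

abbreviation pow_dist :: "real \<Rightarrow> (real \<Rightarrow> real) \<Rightarrow> (real \<Rightarrow> real) \<Rightarrow> real" where
  "pow_dist p f u \<equiv> integral {0..1} (\<lambda>x. \<bar>f x - u x\<bar> powr p)"

lemma knot_free_subset:
  assumes "knot_free \<nu> a b" "0 \<le> a" "a < b" "b \<le> 1" "0 < \<nu>"
  obtains i where "i < \<nu>" "{a<..<b} \<subseteq> {real i / real \<nu><..<real (Suc i) / real \<nu>}"
proof -
  define i where "i = nat \<lfloor>a * real \<nu>\<rfloor>"
  have nu: "real \<nu> > 0" using assms by simp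
  have "0 \<le> a * real \<nu>" using assms by simp
  moreover have "a * real \<nu> < real \<nu>" using assms nu by simp
  ultimately have i: "real i \<le> a * real \<nu>" "a * real \<nu> < real (Suc i)" "real i < real \<nu>"
    unfolding i_def by linarith+
  have lo: "real i / real \<nu> \<le> a" using i(1) nu by (simp add: divide_le_eq)
  have "a < of_int (int (Suc i)) / real \<nu>" using i(2) nu by (simp add: less_divide_eq)
  then have "\<not> of_int (int (Suc i)) / real \<nu> < b"
    using assms(1) unfolding knot_free_def by (metis greaterThanLessThan_iff)
  with lo have "{a<..<b} \<subseteq> {real i / real \<nu><..<real (Suc i) / real \<nu>}" by auto
  with i(3) that show thesis by simp
qed

text \<open>
  On each cell choose the best one among the given functions without a knot in the cell. Its error there is at
  most the average over these functions, of which there are at least \<open>H / 2\<close>. The chosen function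
  changes from cell to cell, so smoothness is lost, but the result is piecewise polynomial on a uniform
  grid.
\<close>

lemma average_approximant:
  fixes g :: "real \<Rightarrow> real"
  assumes p: "0 < p" "p \<le> 1" and g: "g absolutely_integrable_on {0..1}" and H: "1 \<le> H"
    and s: "\<And>\<nu>. \<nu> \<in> {2*H<..4*H} \<Longrightarrow> piecewise_poly d \<nu> (s \<nu>)"
  obtains q where "piecewise_poly d (32 * H) q"
    "pow_dist p g q
      \<le> 2 / real H * (\<Sum>\<nu>\<in>{2*H<..4*H}. pow_dist p g (s \<nu>))"
proof -
  define N where "N = 32 * H"
  define e where "e j u = integral (cell N j) (\<lambda>x. \<bar>g x - u x\<bar> powr p)" for j and u :: "real \<Rightarrow> real"
  let ?B = "{2*H<..4*H}"
  have N: "0 < N" using H by (simp add: N_def)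
  have e0: "0 \<le> e j u" for j u unfolding e_def by (rule integral_nonneg_pointwise) simp
  have "\<exists>\<nu>\<in>?B. knot_free \<nu> (real j / real N) (real (Suc j) / real N) \<and> e j (s \<nu>) \<le> 2 / real H * (\<Sum>\<nu>\<in>?B. e j (s \<nu>))"
    if j: "j < N" for j
  proof -
    define G where "G = {\<nu>\<in>?B. knot_free \<nu> (real j / real N) (real (Suc j) / real N)}"
    have card: "H \<le> 2 * card G" using card_knot_free_ge[OF H j[unfolded N_def]] by (simp add: G_def N_def)
    have "0 < card G" using card H by linarith
    then have G: "finite G" "G \<noteq> {}" by (simp_all add: card_gt_0_iff)
    define \<nu> where "\<nu> = arg_min_on (\<lambda>\<nu>. e j (s \<nu>)) G"
    have nu: "\<nu> \<in> G" "\<And>\<mu>. \<mu> \<in> G \<Longrightarrow> e j (s \<nu>) \<le> e j (s \<mu>)"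
      unfolding \<nu>_def by (rule arg_min_if_finite(1)[OF G]) (rule arg_min_least[OF G])
    have "real H * e j (s \<nu>) \<le> 2 * real (card G) * e j (s \<nu>)"
      using card by (intro mult_right_mono e0) linarith
    also have "\<dots> = 2 * (\<Sum>\<mu>\<in>G. e j (s \<nu>))" by simp
    also have "\<dots> \<le> 2 * (\<Sum>\<mu>\<in>G. e j (s \<mu>))" using nu by (intro mult_left_mono sum_mono) auto
    also have "\<dots> \<le> 2 * (\<Sum>\<mu>\<in>?B. e j (s \<mu>))" by (intro mult_left_mono sum_mono2) (auto simp: G_def e0)
    finally have "e j (s \<nu>) \<le> 2 / real H * (\<Sum>\<nu>\<in>?B. e j (s \<nu>))" using H by (simp add: field_simps)
    with nu(1) show ?thesis by (auto simp: G_def)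
  qed
  then obtain \<nu> where nu: "\<And>j. j < N \<Longrightarrow> \<nu> j \<in> ?B"
    "\<And>j. j < N \<Longrightarrow> knot_free (\<nu> j) (real j / real N) (real (Suc j) / real N)"
    "\<And>j. j < N \<Longrightarrow> e j (s (\<nu> j)) \<le> 2 / real H * (\<Sum>\<nu>\<in>?B. e j (s \<nu>))"
    by metis
  define q where "q x = s (\<nu> (nat \<lfloor>x * real N\<rfloor>)) x" for x
  have q: "q x = s (\<nu> j) x" if "x \<in> open_cell N j" for x j
  proof -
    have "real j < x * real N" "x * real N < real (Suc j)"
      using that N by (auto simp: divide_less_eq less_divide_eq)
    then have "nat \<lfloor>x * real N\<rfloor> = j" by linarith
    then show ?thesis by (simp add: q_def)
  qed
  have pw: "piecewise_poly d N q"
    unfolding piecewise_poly_def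
  proof safe
    fix j assume j: "j < N"
    let ?I = "open_cell N j"
    have "cell N j \<subseteq> {0..1}" by (rule cell_subset[OF j])
    moreover have lt: "real j / real N < real (Suc j) / real N" using N by (simp add: divide_strict_right_mono)
    ultimately have "0 \<le> real j / real N" "real (Suc j) / real N \<le> 1" by (auto simp: cell_def)
    moreover have "0 < \<nu> j" using nu(1)[OF j] by auto
    ultimately obtain i where i: "i < \<nu> j" "?I \<subseteq> open_cell (\<nu> j) i"
      using knot_free_subset[OF nu(2)[OF j] _ lt] by metis
    with s[OF nu(1)[OF j]] obtain P where "degree P \<le> d" "\<And>x. x \<in> ?I \<Longrightarrow> s (\<nu> j) x = poly P x"
      unfolding piecewise_poly_def by (meson subsetD)
    with q show "\<exists>P. degree P \<le> d \<and> (\<forall>x\<in>?I. q x = poly P x)" by auto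
  qed
  have int: "(\<lambda>x. \<bar>g x - u x\<bar> powr p) integrable_on {0..1}" if "u absolutely_integrable_on {0..1}" for u
    by (intro set_lebesgue_integral_eq_integral absolutely_integrable_abs_powr p set_integral_diff g that)
  have sint: "s \<nu> absolutely_integrable_on {0..1}" if "\<nu> \<in> ?B" for \<nu>
    using piecewise_poly_integrable[OF s[OF that]] that by auto
  have "pow_dist p g q = (\<Sum>j<N. e j q)"
    unfolding e_def by (intro integral_cells N int piecewise_poly_integrable[OF pw])
  also have "\<dots> = (\<Sum>j<N. e j (s (\<nu> j)))"
    unfolding e_def cell_def by (intro sum.cong refl integral_cong_Ioo) (simp add: q)
  also have "\<dots> \<le> (\<Sum>j<N. 2 / real H * (\<Sum>\<nu>\<in>?B. e j (s \<nu>)))"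
    by (intro sum_mono nu) auto
  also have "\<dots> = 2 / real H * (\<Sum>\<nu>\<in>?B. \<Sum>j<N. e j (s \<nu>))"
    by (simp only: sum_distrib_left[symmetric] sum.swap[of _ ?B])
  also have "(\<Sum>\<nu>\<in>?B. \<Sum>j<N. e j (s \<nu>)) = (\<Sum>\<nu>\<in>?B. pow_dist p g (s \<nu>))"
    unfolding e_def by (intro sum.cong refl integral_cells[symmetric] N int sint)
  finally show thesis using that pw by (simp add: N_def)
qed

text \<open>
  Subadditivity of \<open>x\<^sup>p\<close> for infinite sums; in particular the summability of \<open>D\<close> itself comes from the
  bound on the \<open>p\<close>-th powers.
\<close>

lemma suminf_powr_le:
  fixes D :: "nat \<Rightarrow> real"
  assumes p: "0 < p" "p \<le> 1" and D: "\<And>i. 0 \<le> D i" and W: "\<And>K. (\<Sum>i<K. D i powr p) \<le> W"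
  shows "summable (\<lambda>i. D i powr p)" "summable D" "(suminf D) powr p \<le> (\<Sum>i. D i powr p)"
proof -
  show sp: "summable (\<lambda>i. D i powr p)" by (rule summableI_nonneg_bounded[OF _ W]) simp
  define S where "S = (\<Sum>i. D i powr p)"
  have S0: "0 \<le> S" unfolding S_def by (intro suminf_nonneg sp) simp
  have part: "(\<Sum>i<K. D i) \<le> S powr (1 / p)" for K
  proof -
    have "(\<Sum>i<K. D i) powr p \<le> (\<Sum>i<K. D i powr p)" by (intro powr_sum_le_sum_powr p D)
    also have "\<dots> \<le> S" unfolding S_def by (intro sum_le_suminf sp) auto
    finally have "((\<Sum>i<K. D i) powr p) powr (1 / p) \<le> S powr (1 / p)" using p by (intro powr_mono2) auto
    then show ?thesis using p D by (simp add: powr_powr sum_nonneg)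
  qed
  show s: "summable D" by (rule summableI_nonneg_bounded[OF D part])
  have "suminf D \<le> S powr (1 / p)" by (rule suminf_le_const[OF s part])
  then have "(suminf D) powr p \<le> (S powr (1 / p)) powr p" using p s D by (intro powr_mono2 suminf_nonneg) auto
  then show "(suminf D) powr p \<le> S" using p S0 by (simp add: powr_powr)
qed

lemma AE_summable_of_summable_integral:
  fixes f :: "nat \<Rightarrow> 'a \<Rightarrow> real"
  assumes int: "\<And>i. integrable M (f i)" and nn: "\<And>i x. 0 \<le> f i x" and s: "summable (\<lambda>i. integral\<^sup>L M (f i))"
  shows "AE x in M. summable (\<lambda>i. f i x)"
proof -
  have "(\<integral>\<^sup>+ x. (\<Sum>i. ennreal (f i x)) \<partial>M) = (\<Sum>i. \<integral>\<^sup>+ x. ennreal (f i x) \<partial>M)"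
    by (rule nn_integral_suminf) (use int in simp)
  also have "\<dots> = (\<Sum>i. ennreal (integral\<^sup>L M (f i)))"
    by (intro suminf_cong nn_integral_eq_integral int) (simp add: nn)
  also have "\<dots> = ennreal (\<Sum>i. integral\<^sup>L M (f i))"
    by (intro suminf_ennreal2 s) (simp add: nn)
  finally have "(\<integral>\<^sup>+ x. (\<Sum>i. ennreal (f i x)) \<partial>M) \<noteq> \<infinity>" by simp
  then have "AE x in M. (\<Sum>i. ennreal (f i x)) \<noteq> \<infinity>"
    by (intro nn_integral_noteq_infinite) (use int in simp_all)
  then show ?thesis
    by eventually_elim (use nn in \<open>auto intro: summable_suminf_not_top\<close>)
qed

text \<open>
  Summability of the \<open>p\<close>-th powers of the \<open>L\<^sub>p\<close> errors forces \<open>u i\<close> to converge to \<open>g\<close> almost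
  everywhere, so \<open>g - u 0\<close> telescopes pointwise; the bound in \<open>L\<^sub>1\<close> then follows by integrating the series.
\<close>

lemma integral_abs_diff_le_telescope:
  fixes g :: "real \<Rightarrow> real" and u :: "nat \<Rightarrow> real \<Rightarrow> real"
  assumes p: "0 < p" "p \<le> 1"
    and g: "g absolutely_integrable_on {a..b}" and u: "\<And>i. u i absolutely_integrable_on {a..b}"
    and sp: "summable (\<lambda>i. integral {a..b} (\<lambda>x. \<bar>g x - u i x\<bar> powr p))"
    and sd: "summable (\<lambda>i. integral {a..b} (\<lambda>x. \<bar>u (Suc i) x - u i x\<bar>))"
  shows "integral {a..b} (\<lambda>x. \<bar>g x - u 0 x\<bar>) \<le> (\<Sum>i. integral {a..b} (\<lambda>x. \<bar>u (Suc i) x - u i x\<bar>))"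
proof -
  define M where "M = lebesgue_on {a..b}"
  have M: "integrable M f \<longleftrightarrow> f absolutely_integrable_on {a..b}" for f :: "real \<Rightarrow> real"
    unfolding M_def set_integrable_def by (rule integrable_restrict_space) simp
  have eq: "integral\<^sup>L M f = integral {a..b} f" if "f absolutely_integrable_on {a..b}" for f :: "real \<Rightarrow> real"
    using that M[of f] unfolding M_def by (intro lebesgue_integral_eq_integral) auto
  have ip: "(\<lambda>x. \<bar>g x - u i x\<bar> powr p) absolutely_integrable_on {a..b}" for i
    by (intro absolutely_integrable_abs_powr p set_integral_diff g u)
  have id: "(\<lambda>x. \<bar>u (Suc i) x - u i x\<bar>) absolutely_integrable_on {a..b}" for i
    using set_integrable_norm[OF set_integral_diff(1)[OF u[of "Suc i"] u[of i]]] by simp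
  have ih: "(\<lambda>x. \<bar>g x - u 0 x\<bar>) absolutely_integrable_on {a..b}"
    using set_integrable_norm[OF set_integral_diff(1)[OF g u[of 0]]] by simp
  have sd': "summable (\<lambda>i. integral\<^sup>L M (\<lambda>x. \<bar>u (Suc i) x - u i x\<bar>))" using sd eq[OF id] by simp
  have AEp: "AE x in M. summable (\<lambda>i. \<bar>g x - u i x\<bar> powr p)"
    by (rule AE_summable_of_summable_integral) (use sp eq[OF ip] ip M in simp_all)
  have AEd: "AE x in M. summable (\<lambda>i. \<bar>u (Suc i) x - u i x\<bar>)"
    by (rule AE_summable_of_summable_integral) (use sd' id M in simp_all)
  have "AE x in M. \<bar>g x - u 0 x\<bar> \<le> (\<Sum>i. \<bar>u (Suc i) x - u i x\<bar>)"
    using AEp AEd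
  proof eventually_elim
    case (elim x)
    have "(\<lambda>i. (\<bar>g x - u i x\<bar> powr p) powr (1 / p)) \<longlonglongrightarrow> 0 powr (1 / p)"
      using p by (intro tendsto_powr' summable_LIMSEQ_zero[OF elim(1)] tendsto_const) auto
    then have "(\<lambda>i. \<bar>g x - u i x\<bar>) \<longlonglongrightarrow> 0" using p by (simp add: powr_powr)
    then have "(\<lambda>i. g x - u i x) \<longlonglongrightarrow> 0" by (rule tendsto_rabs_zero_cancel)
    then have "(\<lambda>i. g x - (g x - u i x)) \<longlonglongrightarrow> g x - 0" by (intro tendsto_intros)
    then have "(\<lambda>i. u i x) \<longlonglongrightarrow> g x" by simp
    from telescope_sums[OF this] have "(\<lambda>i. u (Suc i) x - u i x) sums (g x - u 0 x)" .
    then have "g x - u 0 x = (\<Sum>i. u (Suc i) x - u i x)" by (simp add: sums_iff)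
    with summable_rabs[OF elim(2)] show ?case by simp
  qed
  moreover have isum: "integrable M (\<lambda>x. \<Sum>i. \<bar>u (Suc i) x - u i x\<bar>)"
    by (rule integrable_suminf) (use AEd sd' id M in simp_all)
  ultimately have "integral\<^sup>L M (\<lambda>x. \<bar>g x - u 0 x\<bar>) \<le> integral\<^sup>L M (\<lambda>x. \<Sum>i. \<bar>u (Suc i) x - u i x\<bar>)"
    using ih M by (intro integral_mono_AE) auto
  also have "\<dots> = (\<Sum>i. integral\<^sup>L M (\<lambda>x. \<bar>u (Suc i) x - u i x\<bar>))"
    by (rule integral_suminf) (use AEd sd' id M in simp_all)
  finally show ?thesis using eq[OF ih] eq[OF id] by simp
qed

lemma dyadic_blocks_sum:
  fixes a :: "nat \<Rightarrow> real"
  assumes "1 \<le> n"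
  shows "(\<Sum>i<K. \<Sum>\<nu>\<in>{2 * (n * 2^i)<..4 * (n * 2^i)}. a \<nu>) = (\<Sum>\<nu>\<in>{2 * n<..2 * n * 2^K}. a \<nu>)"
proof (induction K)
  case (Suc K)
  have "{2 * n<..2 * n * 2^Suc K} = {2 * n<..2 * n * 2^K} \<union> {2 * (n * 2^K)<..4 * (n * 2^K)}"
    using assms by (subst ivl_disj_un_two(6)[symmetric, of "2 * n" "2 * n * 2^K"]) (auto simp: mult_ac)
  then show ?case by (simp add: Suc.IH, subst sum.union_disjoint) auto
qed simp

text \<open>
  The telescoping sequence starts at \<open>s n\<close> and continues with the averaged approximants of the
  blocks \<open>2 H < \<nu> \<le> 4 H\<close>, where \<open>H = n 2\<^sup>i\<close>. Consecutive members live on the grid with \<open>32 H\<close> cells,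
  so Nikolskii's inequality costs the factor \<open>H\<^sup>1\<^sup>-\<^sup>p\<close>, and this turns the mean error of a block into
  the part of the weighted sum that belongs to the block.
\<close>

theorem sum_local_L1_powr_le:
  fixes p :: real and d :: nat
  assumes p: "0 < p" "p < 1"
  obtains C where "C > 0" "\<And>g n s B. \<lbrakk>1 \<le> n; g absolutely_integrable_on {0..1};
      \<And>\<nu>. n \<le> \<nu> \<Longrightarrow> piecewise_poly d \<nu> (s \<nu>);
      \<And>N. (\<Sum>\<nu>\<in>{n<..N}. real \<nu> powr (- p) * pow_dist p g (s \<nu>)) \<le> B\<rbrakk> \<Longrightarrow>
    (\<Sum>j<n. (integral (cell n j) (\<lambda>x. \<bar>g x - s n x\<bar>)) powr p)
      \<le> C * (real n powr (1 - p) * pow_dist p g (s n) + B)"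
proof -
  have p1: "p \<le> 1" using p by simp
  obtain A where A: "A > 0" and nik: "\<And>c n j u. \<lbrakk>piecewise_poly d (c * n) u; 0 < c; 0 < n; j < n\<rbrakk> \<Longrightarrow>
    (integral (cell n j) (\<lambda>x. \<bar>u x\<bar>)) powr p
      \<le> A * real (c * n) powr (1 - p) * integral (cell n j) (\<lambda>x. \<bar>u x\<bar> powr p)"
    using piecewise_poly_nikolskii[OF p(1) p1] by metis
  show thesis
  proof (rule that[of "768 * A"])
    fix g :: "real \<Rightarrow> real" and n :: nat and s :: "nat \<Rightarrow> real \<Rightarrow> real" and B :: real
    assume n: "1 \<le> n" and g: "g absolutely_integrable_on {0..1}"
      and s: "\<And>\<nu>. n \<le> \<nu> \<Longrightarrow> piecewise_poly d \<nu> (s \<nu>)"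
      and B: "\<And>N. (\<Sum>\<nu>\<in>{n<..N}. real \<nu> powr (- p) * pow_dist p g (s \<nu>)) \<le> B"
    define a where "a \<nu> = pow_dist p g (s \<nu>)" for \<nu>
    have a0: "0 \<le> a \<nu>" for \<nu> unfolding a_def by (rule integral_nonneg_pointwise) simp
    define H where "H i = n * 2 ^ i" for i :: nat
    have H: "1 \<le> H i" "n \<le> H i" for i using n by (auto simp: H_def)
    define T where "T i = (\<Sum>\<nu>\<in>{2 * H i<..4 * H i}. real \<nu> powr (- p) * a \<nu>)" for i
    have T0: "0 \<le> T i" for i unfolding T_def by (intro sum_nonneg mult_nonneg_nonneg a0) auto
    have TB: "(\<Sum>i<K. T i) \<le> B" for K
    proof -
      have "(\<Sum>i<K. T i) = (\<Sum>\<nu>\<in>{2 * n<..2 * n * 2^K}. real \<nu> powr (- p) * a \<nu>)"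
        unfolding T_def H_def by (rule dyadic_blocks_sum[OF n])
      also have "\<dots> \<le> (\<Sum>\<nu>\<in>{n<..2 * n * 2^K}. real \<nu> powr (- p) * a \<nu>)"
        by (intro sum_mono2) (auto simp: a0)
      also have "\<dots> \<le> B" using B by (simp add: a_def)
      finally show ?thesis .
    qed
    have B0: "0 \<le> B" using TB[of 0] by simp
    have "\<exists>q. piecewise_poly d (32 * H i) q \<and>
      pow_dist p g q \<le> 2 / real (H i) * (\<Sum>\<nu>\<in>{2*H i<..4*H i}. a \<nu>)" for i
    proof -
      have *: "piecewise_poly d \<nu> (s \<nu>)" if "\<nu> \<in> {2*H i<..4*H i}" for \<nu>
        using that H(2)[of i] by (intro s) auto
      show ?thesis unfolding a_def
        by (rule average_approximant[OF p(1) p1 g H(1)[of i] *]) (assumption, intro exI conjI)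
    qed
    then obtain q where q: "\<And>i. piecewise_poly d (32 * H i) (q i)"
      "\<And>i. pow_dist p g (q i) \<le> 2 / real (H i) * (\<Sum>\<nu>\<in>{2*H i<..4*H i}. a \<nu>)"
      by metis
    define u where "u i = (case i of 0 \<Rightarrow> s n | Suc i \<Rightarrow> q i)" for i
    have u0: "u 0 = s n" and uS: "\<And>i. u (Suc i) = q i" by (auto simp: u_def)
    define b where "b i = pow_dist p g (u i)" for i
    have b0: "0 \<le> b i" for i unfolding b_def by (rule integral_nonneg_pointwise) simp
    have b_0: "b 0 = a n" by (simp add: b_def a_def u0)
    \<comment> \<open>The factor \<open>8\<close> is \<open>2 \<cdot> 4\<close>: the \<open>2\<close> comes from averaging, and \<open>\<nu>\<^sup>p \<le> (4 H)\<^sup>p \<le> 4 H\<^sup>p\<close> on the block.\<close>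
    have bS: "real (H i) powr (1 - p) * b (Suc i) \<le> 8 * T i" for i
    proof -
      have Hp: "0 < real (H i)" using H(1)[of i] by simp
      have "b (Suc i) \<le> 2 / real (H i) * (\<Sum>\<nu>\<in>{2*H i<..4*H i}. a \<nu>)"
        unfolding b_def uS by (rule q)
      also have "\<dots> \<le> 2 / real (H i) * (\<Sum>\<nu>\<in>{2*H i<..4*H i}. (4 * real (H i) powr p) * (real \<nu> powr (- p) * a \<nu>))"
      proof (intro mult_left_mono sum_mono)
        fix \<nu> assume nu: "\<nu> \<in> {2*H i<..4*H i}"
        have "real \<nu> powr p \<le> (4 * real (H i)) powr p" using nu p by (intro powr_mono2) auto
        also have "\<dots> = 4 powr p * real (H i) powr p" by (simp add: powr_mult)
        also have "\<dots> \<le> 4 powr 1 * real (H i) powr p" using p by (intro mult_right_mono powr_mono) auto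
        finally have "1 \<le> (4 * real (H i) powr p) * real \<nu> powr (- p)"
          using nu by (simp add: powr_minus field_simps)
        from mult_right_mono[OF this a0[of \<nu>]]
        show "a \<nu> \<le> (4 * real (H i) powr p) * (real \<nu> powr (- p) * a \<nu>)" by (simp add: mult_ac)
      qed (use Hp in auto)
      also have "\<dots> = 8 * (real (H i) powr p / real (H i)) * T i"
        by (simp only: T_def sum_distrib_left[symmetric]) simp
      finally have "b (Suc i) \<le> 8 * (real (H i) powr p / real (H i)) * T i" .
      from mult_left_mono[OF this, of "real (H i) powr (1 - p)"]
      have "real (H i) powr (1 - p) * b (Suc i) \<le> (real (H i) powr (1 - p) * real (H i) powr p / real (H i)) * (8 * T i)"
        by (simp add: mult_ac)
      also have "real (H i) powr (1 - p) * real (H i) powr p / real (H i) = 1"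
        using Hp by (simp flip: powr_add)
      finally show ?thesis by simp
    qed
    have pw: "piecewise_poly d (32 * H i) (u i)" "piecewise_poly d (32 * H i) (u (Suc i))" for i
    proof -
      show "piecewise_poly d (32 * H i) (u (Suc i))" by (simp add: uS q)
      show "piecewise_poly d (32 * H i) (u i)"
      proof (cases i)
        case 0
        then show ?thesis using piecewise_poly_refine[OF s[of n], of 32] n by (simp add: u0 H_def)
      next
        case (Suc j)
        have "32 * H i = 2 * (32 * H j)" by (simp add: Suc H_def)
        then show ?thesis using piecewise_poly_refine[OF q(1)[of j], of 2] H(1)[of j] by (simp add: Suc uS)
      qed
    qed
    have uint: "u i absolutely_integrable_on {0..1}" for i
      by (rule piecewise_poly_integrable[OF pw(1)[of i]]) (use H(1)[of i] in auto)
    define D where "D i x = u (Suc i) x - u i x" for i x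
    have Dpw: "piecewise_poly d (32 * H i) (D i)" for i unfolding D_def using piecewise_poly_add_scaled[OF pw(2,1), of i "-1"] by simp
    have Dint: "D i absolutely_integrable_on {0..1}" for i unfolding D_def by (intro set_integral_diff uint)
    have powint: "(\<lambda>x. \<bar>v x\<bar> powr p) integrable_on {0..1}" if "v absolutely_integrable_on {0..1}" for v :: "real \<Rightarrow> real"
      by (intro set_lebesgue_integral_eq_integral absolutely_integrable_abs_powr p p1 that)
    have gu: "(\<lambda>x. g x - u i x) absolutely_integrable_on {0..1}" for i by (intro set_integral_diff g uint)
    have Dp: "integral {0..1} (\<lambda>x. \<bar>D i x\<bar> powr p) \<le> b i + b (Suc i)" for i
    proof -
      have "integral {0..1} (\<lambda>x. \<bar>D i x\<bar> powr p)
        \<le> integral {0..1} (\<lambda>x. \<bar>g x - u i x\<bar> powr p + \<bar>g x - u (Suc i) x\<bar> powr p)"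
      proof (intro integral_le powint Dint integrable_add gu)
        fix x
        have "\<bar>D i x\<bar> powr p \<le> (\<bar>g x - u i x\<bar> + \<bar>g x - u (Suc i) x\<bar>) powr p"
          using p by (intro powr_mono2) (auto simp: D_def)
        also have "\<dots> \<le> \<bar>g x - u i x\<bar> powr p + \<bar>g x - u (Suc i) x\<bar> powr p"
          by (intro powr_add_le_add_powr p p1) auto
        finally show "\<bar>D i x\<bar> powr p \<le> \<bar>g x - u i x\<bar> powr p + \<bar>g x - u (Suc i) x\<bar> powr p" .
      qed
      also have "\<dots> = b i + b (Suc i)" unfolding b_def by (intro Henstock_Kurzweil_Integration.integral_add powint gu)
      finally show ?thesis .
    qed
    define E where "E i j = integral (cell n j) (\<lambda>x. \<bar>D i x\<bar>)" for i j
    have E0: "0 \<le> E i j" for i j unfolding E_def by (rule integral_nonneg_pointwise) simp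
    define W where "W = 768 * A * (real n powr (1 - p) * a n + B)"
    have sumE: "(\<Sum>j<n. E i j powr p) \<le> 32 * A * (real (H i) powr (1 - p) * (b i + b (Suc i)))" for i
    proof -
      have "(\<Sum>j<n. E i j powr p) \<le> (\<Sum>j<n. A * real (32 * H i) powr (1 - p) * integral (cell n j) (\<lambda>x. \<bar>D i x\<bar> powr p))"
      proof (rule sum_mono)
        fix j assume "j \<in> {..<n}"
        moreover have "32 * H i = (32 * 2 ^ i) * n" by (simp add: H_def)
        ultimately show "E i j powr p \<le> A * real (32 * H i) powr (1 - p) * integral (cell n j) (\<lambda>x. \<bar>D i x\<bar> powr p)"
          using nik[of "32 * 2 ^ i" n "D i" j] Dpw[of i] n unfolding E_def by (simp only:) auto
      qed
      also have "\<dots> = A * real (32 * H i) powr (1 - p) * integral {0..1} (\<lambda>x. \<bar>D i x\<bar> powr p)"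
        using n by (subst integral_cells[of n]) (auto simp: sum_distrib_left intro!: powint Dint)
      also have "\<dots> \<le> A * real (32 * H i) powr (1 - p) * (b i + b (Suc i))"
        using A by (intro mult_left_mono Dp) auto
      also have "real (32 * H i) powr (1 - p) = 32 powr (1 - p) * real (H i) powr (1 - p)"
        by (simp add: powr_mult)
      also have "A * (32 powr (1 - p) * real (H i) powr (1 - p)) * (b i + b (Suc i))
        \<le> A * (32 powr 1 * real (H i) powr (1 - p)) * (b i + b (Suc i))"
        using A p b0 by (intro mult_right_mono mult_left_mono powr_mono add_nonneg_nonneg) auto
      finally show ?thesis by (simp add: mult_ac)
    qed
    \<comment> \<open>Each \<open>b (Suc i)\<close> occurs with the factors \<open>H\<^sub>i\<^sup>1\<^sup>-\<^sup>p\<close> and \<open>H\<^sub>i\<^sub>+\<^sub>1\<^sup>1\<^sup>-\<^sup>p \<le> 2 H\<^sub>i\<^sup>1\<^sup>-\<^sup>p\<close>, in total at most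
      \<open>(1 + 2) \<cdot> 8 = 24\<close> times \<open>T i\<close>. With \<open>32\<^sup>1\<^sup>-\<^sup>p \<le> 32\<close> this gives \<open>768 = 32 \<cdot> 24\<close>.\<close>
    have total: "(\<Sum>i<K. \<Sum>j<n. E i j powr p) \<le> W" for K
    proof -
      have shift: "(\<Sum>i<K. real (H i) powr (1 - p) * b i)
        \<le> real n powr (1 - p) * a n + (\<Sum>i<K. real (H (Suc i)) powr (1 - p) * b (Suc i))"
      proof -
        have "(\<Sum>i<K. real (H i) powr (1 - p) * b i) \<le> (\<Sum>i<Suc K. real (H i) powr (1 - p) * b i)"
          by (simp add: b0)
        also have "\<dots> = real n powr (1 - p) * a n + (\<Sum>i<K. real (H (Suc i)) powr (1 - p) * b (Suc i))"
          by (subst sum.lessThan_Suc_shift) (simp add: H_def b_0)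
        finally show ?thesis .
      qed
      have dbl: "real (H (Suc i)) powr (1 - p) \<le> 2 * real (H i) powr (1 - p)" for i
      proof -
        have "real (H (Suc i)) powr (1 - p) = 2 powr (1 - p) * real (H i) powr (1 - p)"
          by (simp add: H_def powr_mult)
        also have "\<dots> \<le> 2 powr 1 * real (H i) powr (1 - p)" using p by (intro mult_right_mono powr_mono) auto
        finally show ?thesis by simp
      qed
      have "(\<Sum>i<K. \<Sum>j<n. E i j powr p) \<le> (\<Sum>i<K. 32 * A * (real (H i) powr (1 - p) * (b i + b (Suc i))))"
        by (intro sum_mono sumE)
      also have "\<dots> = 32 * A * ((\<Sum>i<K. real (H i) powr (1 - p) * b i) + (\<Sum>i<K. real (H i) powr (1 - p) * b (Suc i)))"
        by (simp only: sum_distrib_left[symmetric] distrib_left sum.distrib)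
      also have "\<dots> \<le> 32 * A * ((real n powr (1 - p) * a n + (\<Sum>i<K. 16 * T i)) + (\<Sum>i<K. 8 * T i))"
      proof (intro mult_left_mono add_mono order_trans[OF shift] order_refl sum_mono)
        fix i
        have "real (H (Suc i)) powr (1 - p) * b (Suc i) \<le> 2 * (real (H i) powr (1 - p) * b (Suc i))"
          using mult_right_mono[OF dbl b0[of "Suc i"]] by (simp add: mult_ac)
        with bS[of i] show "real (H (Suc i)) powr (1 - p) * b (Suc i) \<le> 16 * T i" by linarith
      qed (use A bS in auto)
      also have "\<dots> = 32 * A * (real n powr (1 - p) * a n + 24 * (\<Sum>i<K. T i))"
        by (simp add: sum_distrib_left[symmetric])
      also have "\<dots> \<le> 32 * A * (24 * (real n powr (1 - p) * a n) + 24 * B)"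
        using A TB[of K] a0[of n] by (intro mult_left_mono add_mono) auto
      finally show ?thesis by (simp add: W_def algebra_simps)
    qed
    have part: "(\<Sum>i<K. E i j powr p) \<le> W" if "j < n" for K j
    proof -
      have "(\<Sum>i<K. E i j powr p) \<le> (\<Sum>i<K. \<Sum>j<n. E i j powr p)"
        using that by (intro sum_mono member_le_sum) auto
      with total[of K] show ?thesis by simp
    qed
    have sb: "summable b"
    proof -
      have "b (Suc i) \<le> 8 * T i" for i
      proof -
        have "1 * b (Suc i) \<le> real (H i) powr (1 - p) * b (Suc i)"
          using H(1)[of i] p by (intro mult_right_mono b0 ge_one_powr_ge_zero) auto
        with bS[of i] show ?thesis by simp
      qed
      then have "(\<Sum>i<K. b (Suc i)) \<le> 8 * B" for K
        using sum_mono[of "{..<K}" "\<lambda>i. b (Suc i)" "\<lambda>i. 8 * T i"] TB[of K] by (simp add: sum_distrib_left[symmetric])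
      then have "summable (\<lambda>i. b (Suc i))" by (intro summableI_nonneg_bounded b0)
      then show ?thesis by (simp add: summable_Suc_iff)
    qed
    have cell_le: "(integral (cell n j) (\<lambda>x. \<bar>g x - s n x\<bar>)) powr p \<le> (\<Sum>i. E i j powr p)" if j: "j < n" for j
    proof -
      note E_sum = suminf_powr_le[OF p(1) p1, of "\<lambda>i. E i j" W, OF E0 part[OF j]]
      have sub: "cell n j \<subseteq> {0..1}" by (rule cell_subset[OF j])
      have "integral (cell n j) (\<lambda>x. \<bar>g x - u 0 x\<bar>) \<le> (\<Sum>i. E i j)"
        unfolding E_def D_def cell_def
      proof (rule integral_abs_diff_le_telescope[OF p(1) p1])
        show "g absolutely_integrable_on {real j / real n..real (Suc j) / real n}"
          "\<And>i. u i absolutely_integrable_on {real j / real n..real (Suc j) / real n}"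
          using absolutely_integrable_on_subinterval[OF g] absolutely_integrable_on_subinterval[OF uint] sub
          unfolding cell_def by blast+
        show "summable (\<lambda>i. integral {real j / real n..real (Suc j) / real n} (\<lambda>x. \<bar>u (Suc i) x - u i x\<bar>))"
          using E_sum(2) by (simp add: E_def D_def cell_def)
        show "summable (\<lambda>i. integral {real j / real n..real (Suc j) / real n} (\<lambda>x. \<bar>g x - u i x\<bar> powr p))"
        proof (rule summable_comparison_test'[OF sb])
          fix i
          have "integral {real j / real n..real (Suc j) / real n} (\<lambda>x. \<bar>g x - u i x\<bar> powr p) \<le> b i"
            unfolding b_def
            by (intro integral_subset_le powint gu integrable_on_subinterval[OF powint[OF gu]] sub[unfolded cell_def]) auto
          then show "norm (integral {real j / real n..real (Suc j) / real n} (\<lambda>x. \<bar>g x - u i x\<bar> powr p)) \<le> b i"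
            by (simp add: integral_nonneg_pointwise)
        qed
      qed
      then have "(integral (cell n j) (\<lambda>x. \<bar>g x - u 0 x\<bar>)) powr p \<le> (\<Sum>i. E i j) powr p"
        using p by (intro powr_mono2 integral_nonneg_pointwise) auto
      also have "\<dots> \<le> (\<Sum>i. E i j powr p)" by (rule E_sum(3))
      finally show ?thesis by (simp add: u0)
    qed
    have "(\<Sum>j<n. (integral (cell n j) (\<lambda>x. \<bar>g x - s n x\<bar>)) powr p) \<le> (\<Sum>j<n. \<Sum>i. E i j powr p)"
      by (intro sum_mono cell_le) auto
    also have "\<dots> = (\<Sum>i. \<Sum>j<n. E i j powr p)"
      by (rule suminf_sum[symmetric]) (use suminf_powr_le(1)[OF p(1) p1 E0 part] in auto)
    also have "\<dots> \<le> W"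
      by (intro suminf_le_const total summable_sum) (use suminf_powr_le(1)[OF p(1) p1 E0 part] in auto)
    finally show "(\<Sum>j<n. (integral (cell n j) (\<lambda>x. \<bar>g x - s n x\<bar>)) powr p)
      \<le> 768 * A * (real n powr (1 - p) * pow_dist p g (s n) + B)"
      by (simp add: W_def a_def)
  qed (use A in simp)
qed

section \<open>Chains of derivatives and spline spaces\<close>

text \<open>
  An explicit list of successive derivatives on \<open>[0,1]\<close>. Closure properties of \<open>C01\<close> are immediate for
  such lists, while \<open>deriv01\<close> would have to be computed by induction each time.
\<close>

definition deriv_chain :: "nat \<Rightarrow> (nat \<Rightarrow> real \<Rightarrow> real) \<Rightarrow> bool" where
  "deriv_chain k D \<longleftrightarrow> (\<forall>j<k. \<forall>x\<in>{0..1}. (D j has_vector_derivative D (Suc j) x) (at x within {0..1}))"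

lemma deriv_chain_deriv01:
  assumes "differentiable01 k f"
  shows "deriv_chain k (\<lambda>j. deriv01 j f)"
  using assms unfolding deriv_chain_def differentiable01_def
  by (auto simp: differentiable_on_def vector_derivative_works[symmetric])

lemma deriv01_eq_chain:
  assumes D: "deriv_chain k D" and f: "\<And>x. x \<in> {0..1} \<Longrightarrow> f x = D 0 x" and "j \<le> k" "x \<in> {0..1}"
  shows "deriv01 j f x = D j x"
  using assms(3,4)
proof (induction j arbitrary: x)
  case 0
  then show ?case by (simp add: f)
next
  case (Suc j)
  have "(D j has_vector_derivative D (Suc j) x) (at x within {0..1})"
    using D Suc.prems by (auto simp: deriv_chain_def)
  then have "(deriv01 j f has_vector_derivative D (Suc j) x) (at x within {0..1})"
    by (rule has_vector_derivative_transform[rotated 2]) (use Suc in auto)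
  then show ?case using Suc.prems by (simp add: vector_derivative_within_closed_interval)
qed

lemma C01_iff_chain:
  "f \<in> C01 k \<longleftrightarrow> (\<exists>D. deriv_chain k D \<and> (\<forall>x\<in>{0..1}. f x = D 0 x) \<and> continuous_on {0..1} (D k))"
proof
  assume "f \<in> C01 k"
  then show "\<exists>D. deriv_chain k D \<and> (\<forall>x\<in>{0..1}. f x = D 0 x) \<and> continuous_on {0..1} (D k)"
    by (intro exI[of _ "\<lambda>j. deriv01 j f"]) (auto simp: C01_def deriv_chain_deriv01)
next
  assume "\<exists>D. deriv_chain k D \<and> (\<forall>x\<in>{0..1}. f x = D 0 x) \<and> continuous_on {0..1} (D k)"
  then obtain D where D: "deriv_chain k D" "\<And>x. x \<in> {0..1} \<Longrightarrow> f x = D 0 x" "continuous_on {0..1} (D k)"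
    by blast
  note eq = deriv01_eq_chain[OF D(1,2)]
  have "deriv01 j f differentiable_on {0..1}" if "j < k" for j
    unfolding differentiable_on_def
  proof
    fix x :: real assume x: "x \<in> {0..1}"
    have "(D j has_vector_derivative D (Suc j) x) (at x within {0..1})"
      using D(1) that x by (auto simp: deriv_chain_def)
    then have "(deriv01 j f has_vector_derivative D (Suc j) x) (at x within {0..1})"
      by (rule has_vector_derivative_transform[rotated 2]) (use x eq that in auto)
    then show "deriv01 j f differentiable at x within {0..1}" by (rule differentiableI_vector)
  qed
  moreover have "continuous_on {0..1} (deriv01 k f)"
    using D(3) by (rule continuous_on_eq) (rule eq[symmetric], auto)
  ultimately show "f \<in> C01 k" by (simp add: C01_def differentiable01_def)
qed

lemma C01_continuous: "f \<in> C01 k \<Longrightarrow> continuous_on {0..1} f"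
proof -
  assume "f \<in> C01 k"
  then obtain D where D: "deriv_chain k D" "\<And>x. x \<in> {0..1} \<Longrightarrow> f x = D 0 x" "continuous_on {0..1} (D k)"
    unfolding C01_iff_chain by blast
  have "continuous_on {0..1} (D 0)"
  proof (cases "k = 0")
    case False
    then have "\<And>x. x \<in> {0..1} \<Longrightarrow> (D 0 has_vector_derivative D (Suc 0) x) (at x within {0..1})"
      using D(1) by (auto simp: deriv_chain_def)
    then show ?thesis by (rule continuous_on_vector_derivative)
  qed (use D in simp)
  then show ?thesis by (rule continuous_on_eq) (simp add: D)
qed

lemma splines_iff:
  "S \<in> splines m n \<longleftrightarrow> (m \<ge> 2 \<longrightarrow> S \<in> C01 (m - 2)) \<and> piecewise_poly (m - 1) n S"
proof -
  have "(\<forall>j\<in>{1..n}. Q j) \<longleftrightarrow> (\<forall>j<n. Q (Suc j))" for Q :: "nat \<Rightarrow> bool"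
    by (metis One_nat_def Suc_le_eq atLeastAtMost_iff diff_Suc_1 gr0_conv_Suc le_add1 plus_1_eq_Suc Suc_less_eq less_Suc_eq_le)
  then show ?thesis by (simp add: splines_def piecewise_poly_def)
qed

lemma splines_add_scaled:
  assumes "S \<in> splines m n" "T \<in> splines m n"
  shows "(\<lambda>x. S x + c * T x) \<in> splines m n"
proof -
  have "(\<lambda>x. S x + c * T x) \<in> C01 (m - 2)" if "S \<in> C01 (m - 2)" "T \<in> C01 (m - 2)"
  proof -
    from that obtain D E where D: "deriv_chain (m - 2) D" "\<forall>x\<in>{0..1}. S x = D 0 x" "continuous_on {0..1} (D (m - 2))"
      and E: "deriv_chain (m - 2) E" "\<forall>x\<in>{0..1}. T x = E 0 x" "continuous_on {0..1} (E (m - 2))"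
      unfolding C01_iff_chain by blast
    show ?thesis unfolding C01_iff_chain
    proof (intro exI[of _ "\<lambda>j x. D j x + c * E j x"] conjI)
      show "deriv_chain (m - 2) (\<lambda>j x. D j x + c * E j x)"
        using D(1) E(1) unfolding deriv_chain_def
        by (auto intro!: has_vector_derivative_add has_vector_derivative_mult_right)
    qed (use D E in \<open>auto intro!: continuous_intros\<close>)
  qed
  then show ?thesis using assms piecewise_poly_add_scaled by (auto simp: splines_iff)
qed

lemma poly_in_splines:
  assumes "degree P \<le> m - 1"
  shows "poly P \<in> splines m n"
proof -
  have "deriv_chain k (\<lambda>j. poly ((pderiv ^^ j) P))" for k
    unfolding deriv_chain_def
    by (auto simp flip: has_real_derivative_iff_has_vector_derivative intro!: DERIV_subset[OF poly_DERIV])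
  then have "poly P \<in> C01 (m - 2)"
    unfolding C01_iff_chain by (intro exI[of _ "\<lambda>j. poly ((pderiv ^^ j) P)"]) (auto intro!: continuous_intros)
  then show ?thesis using assms unfolding splines_iff piecewise_poly_def by auto
qed

lemma splines_sum:
  assumes "\<And>i. i \<in> A \<Longrightarrow> S i \<in> splines m n"
  shows "(\<lambda>x. \<Sum>i\<in>A. c i * S i x) \<in> splines m n"
  using assms
proof (induction A rule: infinite_finite_induct)
  case (insert i A)
  then have "(\<lambda>x. (\<Sum>i\<in>A. c i * S i x) + c i * S i x) \<in> splines m n"
    by (intro splines_add_scaled) auto
  with insert show ?case by (simp add: add.commute)
qed (use poly_in_splines[of 0 m n] in \<open>simp_all add: poly_0[abs_def]\<close>)

lemma poly_antiderivative:
  fixes P :: "real poly"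
  assumes "degree P \<le> d"
  obtains Q where "degree Q \<le> Suc d" "pderiv Q = P"
proof
  let ?Q = "\<Sum>i\<le>d. monom (coeff P i / real (Suc i)) (Suc i)"
  show "degree ?Q \<le> Suc d"
    by (intro degree_sum_le) (auto intro!: order_trans[OF degree_monom_le])
  have "pderiv ?Q = (\<Sum>i\<le>d. pderiv (monom (coeff P i / real (Suc i)) (Suc i)))"
    using higher_pderiv_sum[of 1] by simp
  also have "\<dots> = (\<Sum>i\<le>d. monom (coeff P i) i)"
    by (intro sum.cong) (simp_all add: pderiv_monom del: of_nat_Suc)
  also have "\<dots> = P" by (rule poly_as_sum_of_monoms'[OF assms])
  finally show "pderiv ?Q = P" .
qed

lemma spline_antiderivative:
  assumes m: "1 \<le> m" and n: "0 < n" and S: "S \<in> splines m n"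
    and T: "\<And>x. x \<in> {0..1} \<Longrightarrow> T x = c + integral {0..x} S"
  shows "T \<in> splines (Suc m) n"
proof -
  have pw: "piecewise_poly (m - 1) n S" using S by (simp add: splines_iff)
  have int: "S integrable_on {0..1}"
    by (rule set_lebesgue_integral_eq_integral piecewise_poly_integrable[OF pw n])+
  have "continuous_on {0..1} (\<lambda>x. c + integral {0..x} S)"
    by (intro continuous_intros indefinite_integral_continuous_1 int)
  then have contT: "continuous_on {0..1} T" by (rule continuous_on_eq) (simp add: T)
  have "T \<in> C01 (m - 1)"
  proof (cases "m = 1")
    case True
    then show ?thesis unfolding C01_iff_chain using contT
      by (intro exI[of _ "\<lambda>_. T"]) (simp add: deriv_chain_def)
  next
    case False
    with m have m2: "m \<ge> 2" "m - 1 = Suc (m - 2)" by auto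
    with S have SC: "S \<in> C01 (m - 2)" by (simp add: splines_iff)
    then obtain D where D: "deriv_chain (m - 2) D" "\<forall>x\<in>{0..1}. S x = D 0 x" "continuous_on {0..1} (D (m - 2))"
      unfolding C01_iff_chain by blast
    define E where "E j = (case j of 0 \<Rightarrow> T | Suc i \<Rightarrow> D i)" for j
    have "deriv_chain (Suc (m - 2)) E"
      unfolding deriv_chain_def
    proof (intro allI impI ballI)
      fix j and x :: real assume j: "j < Suc (m - 2)" and x: "x \<in> {0..1}"
      show "(E j has_vector_derivative E (Suc j) x) (at x within {0..1})"
      proof (cases j)
        case 0
        have "((\<lambda>u. c + integral {0..u} S) has_vector_derivative 0 + S x) (at x within {0..1})"
          by (intro has_vector_derivative_add has_vector_derivative_const
              integral_has_vector_derivative C01_continuous[OF SC] x)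
        then have "((\<lambda>u. c + integral {0..u} S) has_vector_derivative S x) (at x within {0..1})" by simp
        then have "(T has_vector_derivative S x) (at x within {0..1})"
          by (rule has_vector_derivative_transform[rotated 2]) (use x T in auto)
        with 0 x D(2) show ?thesis by (simp add: E_def)
      next
        case (Suc i)
        with D(1) j x show ?thesis by (simp add: E_def deriv_chain_def)
      qed
    qed
    with D(3) show ?thesis unfolding C01_iff_chain m2(2) by (intro exI[of _ E]) (auto simp: E_def)
  qed
  moreover have "piecewise_poly m n T"
    unfolding piecewise_poly_def
  proof safe
    fix j assume j: "j < n"
    let ?a = "real j / real n" and ?b = "real (Suc j) / real n"
    from pw j obtain P where P: "degree P \<le> m - 1" "\<And>x. x \<in> {?a<..<?b} \<Longrightarrow> S x = poly P x"
      unfolding piecewise_poly_def by metis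
    obtain Q where Q: "degree Q \<le> Suc (m - 1)" "pderiv Q = P" using poly_antiderivative[OF P(1)] .
    have sub: "{?a..?b} \<subseteq> {0..1}" using cell_subset[OF j] by (simp add: cell_def)
    have "T x = poly (Q + [: T ?a - poly Q ?a :]) x" if x: "x \<in> {?a<..<?b}" for x
    proof -
      have "?a \<in> {?a..?b}" "x \<in> {?a..?b}" using x by auto
      then have "?a \<in> {0..1}" "x \<in> {0..1}" using sub by blast+
      then have x01: "0 \<le> ?a" "?a \<le> x" "x \<in> {0..1}" "?a \<in> {0..1}" using x by auto
      have "(poly P has_integral (poly Q x - poly Q ?a)) {?a..x}"
        using x01 unfolding Q(2)[symmetric]
        by (intro fundamental_theorem_of_calculus)
          (auto simp flip: has_real_derivative_iff_has_vector_derivative intro!: DERIV_subset[OF poly_DERIV])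
      moreover have "integral {?a..x} S = integral {?a..x} (poly P)"
        by (rule integral_cong_Ioo) (use P(2) x in auto)
      ultimately have "integral {?a..x} S = poly Q x - poly Q ?a" by (simp add: integral_unique)
      moreover have "integral {0..?a} S + integral {?a..x} S = integral {0..x} S"
        using x01 by (intro Henstock_Kurzweil_Integration.integral_combine integrable_on_subinterval[OF int]) auto
      ultimately show ?thesis using T x01 by simp
    qed
    moreover have "degree (Q + [: T ?a - poly Q ?a :]) \<le> m"
      using Q(1) m by (intro degree_add_le) auto
    ultimately show "\<exists>P. degree P \<le> m \<and> (\<forall>x\<in>{?a<..<?b}. T x = poly P x)" by blast
  qed
  ultimately show ?thesis by (simp add: splines_iff numeral_2_eq_2)
qed

lemma poly_of_deriv_chain:
  assumes "deriv_chain d G" "\<And>x. x \<in> {0..1} \<Longrightarrow> G d x = c"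
  obtains P where "degree P \<le> d" "\<And>x. x \<in> {0..1} \<Longrightarrow> G 0 x = poly P x"
  using assms
proof (induction d arbitrary: G thesis)
  case 0
  show ?case by (rule "0.prems"(1)[of "[:c:]"]) (use "0.prems"(3) in auto)
next
  case (Suc d)
  have "deriv_chain d (\<lambda>j. G (Suc j))" using Suc.prems(2) by (auto simp: deriv_chain_def)
  then obtain P where P: "degree P \<le> d" "\<And>x. x \<in> {0..1} \<Longrightarrow> G (Suc 0) x = poly P x"
    using Suc.IH[of "\<lambda>j. G (Suc j)"] Suc.prems(3) by blast
  obtain Q where Q: "degree Q \<le> Suc d" "pderiv Q = P" using poly_antiderivative[OF P(1)] .
  have "((\<lambda>x. G 0 x - poly Q x) has_derivative (\<lambda>h. 0)) (at x within {0..1})" if x: "x \<in> {0..1}" for x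
  proof -
    have "(G 0 has_vector_derivative poly P x) (at x within {0..1})"
      using Suc.prems(2) x unfolding deriv_chain_def P(2)[OF x, symmetric] by blast
    moreover have "(poly Q has_vector_derivative poly P x) (at x within {0..1})"
      unfolding Q(2)[symmetric]
      by (auto simp flip: has_real_derivative_iff_has_vector_derivative intro!: DERIV_subset[OF poly_DERIV])
    ultimately have "((\<lambda>x. G 0 x - poly Q x) has_vector_derivative poly P x - poly P x) (at x within {0..1})"
      by (rule has_vector_derivative_diff)
    then show ?thesis by (simp add: has_vector_derivative_def)
  qed
  then have "\<exists>e. \<forall>x\<in>{0..1}. G 0 x - poly Q x = e"
    by (intro has_derivative_zero_constant) auto
  then obtain e where e: "\<And>x. x \<in> {0..1} \<Longrightarrow> G 0 x - poly Q x = e" by blast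
  have "G 0 x = poly (Q + [:e:]) x" if "x \<in> {0..1}" for x using e[OF that] by simp
  moreover have "degree (Q + [:e:]) \<le> Suc d" using Q(1) by (intro degree_add_le) auto
  ultimately show ?case using Suc.prems(1) by blast
qed

section \<open>Truncated powers and iterated integrals\<close>

text \<open>
  The case distinction, instead of a power of \<open>max 0 (x - t)\<close>, is made for the exponent \<open>0\<close>: it gives the
  indicator function of \<open>t < x\<close> although \<open>0\<^sup>0 = 1\<close>.
\<close>

definition tpow :: "nat \<Rightarrow> real \<Rightarrow> real \<Rightarrow> real" where
  "tpow d t x = (if t < x then (x - t) ^ d else 0)"

lemma tpow_eq_max: "0 < d \<Longrightarrow> tpow d t x = (max 0 (x - t)) ^ d"
  by (auto simp: tpow_def max_def)

lemma tpow_continuous: "0 < d \<Longrightarrow> continuous_on S (tpow d t)"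
  by (simp add: tpow_eq_max continuous_intros cong: continuous_on_cong)

lemma tpow_has_derivative_off_knot:
  assumes "x \<noteq> t"
  shows "(tpow (Suc d) t has_real_derivative real (Suc d) * tpow d t x) (at x)"
proof (cases "t < x")
  case True
  have "((\<lambda>y. (y - t) ^ Suc d) has_real_derivative real (Suc d) * (x - t) ^ d * 1) (at x)"
    by (auto intro!: derivative_eq_intros simp del: power_Suc)
  then have "(tpow (Suc d) t has_real_derivative real (Suc d) * (x - t) ^ d * 1) (at x)"
    by (rule DERIV_cong_ev[THEN iffD1, OF refl _ refl, rotated])
      (use eventually_nhds_in_open[of "{t<..}" x] True in \<open>auto elim!: eventually_mono simp: tpow_def\<close>)
  with True show ?thesis by (simp add: tpow_def)
next
  case False
  with assms have "x < t" by simp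
  have "((\<lambda>y. 0) has_real_derivative 0) (at x)" by simp
  then have "(tpow (Suc d) t has_real_derivative 0) (at x)"
    by (rule DERIV_cong_ev[THEN iffD1, OF refl _ refl, rotated])
      (use eventually_nhds_in_open[of "{..<t}" x] \<open>x < t\<close> in \<open>auto elim!: eventually_mono simp: tpow_def\<close>)
  with False show ?thesis by (simp add: tpow_def)
qed

lemma tpow_has_derivative:
  assumes "0 < d"
  shows "(tpow (Suc d) t has_real_derivative real (Suc d) * tpow d t x) (at x)"
proof (cases "x = t")
  case True
  have "((\<lambda>y. (tpow (Suc d) t y - tpow (Suc d) t t) / (y - t)) \<longlongrightarrow> 0) (at t)"
  proof (rule Lim_null_comparison)
    show "((\<lambda>y. \<bar>y - t\<bar> ^ d) \<longlongrightarrow> 0) (at t)"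
      using assms by (auto intro!: tendsto_eq_intros)
    show "\<forall>\<^sub>F y in at t. norm ((tpow (Suc d) t y - tpow (Suc d) t t) / (y - t)) \<le> \<bar>y - t\<bar> ^ d"
      by (rule always_eventually) (auto simp: tpow_def)
  qed
  then show ?thesis using True assms by (simp add: has_field_derivative_iff tpow_def)
qed (rule tpow_has_derivative_off_knot)

lemma tpow_in_splines:
  assumes M: "1 \<le> M" and n: "0 < n"
  shows "tpow M (real i / real n) \<in> splines (Suc M) n"
proof -
  let ?t = "real i / real n"
  define D where "D j x = (fact M / fact (M - j)) * tpow (M - j) ?t x" for j x
  have "deriv_chain (M - 1) D"
    unfolding deriv_chain_def
  proof (intro allI impI ballI)
    fix j and x :: real assume j: "j < M - 1"
    then have e: "M - j = Suc (M - Suc j)" "0 < M - Suc j" by auto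
    have "((\<lambda>x. (fact M / fact (M - j)) * tpow (M - j) ?t x) has_real_derivative
      (fact M / fact (M - j)) * (real (Suc (M - Suc j)) * tpow (M - Suc j) ?t x)) (at x within {0..1})"
      unfolding e(1) by (intro DERIV_cmult DERIV_subset[OF tpow_has_derivative[OF e(2)]]) auto
    also have "(fact M / fact (M - j)) * (real (Suc (M - Suc j)) * tpow (M - Suc j) ?t x) = D (Suc j) x"
      unfolding D_def e(1) by (simp add: fact_Suc del: of_nat_Suc)
    finally show "(D j has_vector_derivative D (Suc j) x) (at x within {0..1})"
      unfolding D_def[abs_def] by (simp add: has_real_derivative_iff_has_vector_derivative)
  qed
  moreover have "continuous_on {0..1} (D (M - 1))"
    using M unfolding D_def[abs_def] by (intro continuous_intros tpow_continuous) auto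
  ultimately have "tpow M ?t \<in> C01 (M - 1)"
    unfolding C01_iff_chain by (intro exI[of _ D]) (auto simp: D_def)
  moreover have "piecewise_poly M n (tpow M ?t)"
    unfolding piecewise_poly_def
  proof safe
    fix j assume "j < n"
    let ?I = "open_cell n j"
    show "\<exists>P. degree P \<le> M \<and> (\<forall>x\<in>?I. tpow M ?t x = poly P x)"
    proof (cases "i \<le> j")
      case True
      then have "?t \<le> real j / real n" by (simp add: divide_right_mono)
      then have "\<forall>x\<in>?I. tpow M ?t x = poly ([:- ?t, 1:] ^ M) x" by (auto simp: tpow_def)
      moreover have "degree ([:- ?t, 1:] ^ M) \<le> M" using degree_power_le[of "[:- ?t, 1:]" M] by simp
      ultimately show ?thesis by blast
    next
      case False
      then have "real (Suc j) / real n \<le> ?t" by (intro divide_right_mono) auto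
      then have "\<forall>x\<in>?I. tpow M ?t x = poly 0 x" by (auto simp: tpow_def)
      then show ?thesis by (intro exI[of _ 0]) auto
    qed
  qed
  ultimately show ?thesis using M by (simp add: splines_iff numeral_2_eq_2 Suc_diff_Suc)
qed

lemma absolutely_integrable_times_bounded_borel:
  fixes h \<phi> :: "real \<Rightarrow> real"
  assumes h: "h absolutely_integrable_on {a..b}" and m: "\<phi> \<in> borel_measurable borel"
    and b: "\<And>t. t \<in> {a..b} \<Longrightarrow> \<bar>\<phi> t\<bar> \<le> K"
  shows "(\<lambda>t. h t * \<phi> t) absolutely_integrable_on {a..b}"
proof -
  have "(\<lambda>t. \<phi> t * h t) absolutely_integrable_on {a..b}"
  proof (rule absolutely_integrable_bounded_measurable_product_real[OF _ _ _ h])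
    show "\<phi> \<in> borel_measurable (lebesgue_on {a..b})"
      using m by (intro measurable_restrict_space1 measurable_completion) (simp add: measurable_lborel1)
    show "bounded (\<phi> ` {a..b})" unfolding bounded_iff by (intro exI[of _ K]) (use b in auto)
  qed auto
  then show ?thesis by (simp add: mult.commute)
qed

lemma tpow_measurable: "(\<lambda>t. tpow d t x) \<in> borel_measurable borel"
  unfolding tpow_def by measurable

lemma tpow_abs_le_one: "x \<in> {0..1} \<Longrightarrow> t \<in> {0..1} \<Longrightarrow> \<bar>tpow d t x\<bar> \<le> 1"
  by (auto simp: tpow_def power_le_one)

text \<open>
  The \<open>(d + 1)\<close>-fold integral of \<open>h\<close> from \<open>0\<close>, by Cauchy's formula for repeated integration.
\<close>

definition iterated_integral :: "nat \<Rightarrow> (real \<Rightarrow> real) \<Rightarrow> real \<Rightarrow> real" where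
  "iterated_integral d h x = integral {0..1} (\<lambda>t. h t * tpow d t x) / fact d"

lemma iterated_integral_integrable:
  assumes "h absolutely_integrable_on {0..1}" "x \<in> {0..1}"
  shows "(\<lambda>t. h t * tpow d t x) absolutely_integrable_on {0..1}"
  by (rule absolutely_integrable_times_bounded_borel[OF assms(1) tpow_measurable, of _ _ 1])
    (use assms tpow_abs_le_one in auto)

lemma iterated_integral_0:
  assumes h: "h absolutely_integrable_on {0..1}" and x: "x \<in> {0..1}"
  shows "iterated_integral 0 h x = integral {0..x} h"
proof -
  have i: "(\<lambda>t. h t * tpow 0 t x) integrable_on {0..1}"
    by (intro set_lebesgue_integral_eq_integral iterated_integral_integrable assms)
  have "integral {0..1} (\<lambda>t. h t * tpow 0 t x) = integral {0..x} (\<lambda>t. h t * tpow 0 t x) + integral {x..1} (\<lambda>t. h t * tpow 0 t x)"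
    using x by (intro Henstock_Kurzweil_Integration.integral_combine[symmetric] i) auto
  also have "integral {0..x} (\<lambda>t. h t * tpow 0 t x) = integral {0..x} h"
    by (rule integral_cong_Ioo) (simp add: tpow_def)
  also have "integral {x..1} (\<lambda>t. h t * tpow 0 t x) = integral {x..1} (\<lambda>t. 0)"
    by (rule integral_cong_Ioo) (simp add: tpow_def)
  finally show ?thesis by (simp add: iterated_integral_def)
qed

text \<open>
  Dominated convergence of the difference quotients: the kernel is Lipschitz in \<open>x\<close> uniformly in \<open>t\<close>, and
  it is differentiable at \<open>x\<close> for all \<open>t \<noteq> x\<close>.
\<close>

lemma iterated_integral_has_derivative:
  assumes h: "h absolutely_integrable_on {0..1}" and x: "x \<in> {0..1}"
  shows "(iterated_integral (Suc d) h has_vector_derivative iterated_integral d h x) (at x within {0..1})"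
proof -
  \<comment> \<open>At \<open>t = x\<close> the difference quotients of the kernel need not converge when \<open>d = 0\<close>, so \<open>h\<close> is set to \<open>0\<close> there.\<close>
  define h' where "h' t = (if t = x then 0 else h t)" for t
  have h': "h' absolutely_integrable_on {0..1}"
    by (rule absolutely_integrable_spike[OF h, of "{x}"]) (auto simp: h'_def)
  have same: "integral {0..1} (\<lambda>t. h t * tpow e t y) = integral {0..1} (\<lambda>t. h' t * tpow e t y)" for e y
    by (rule integral_spike[of "{x}"]) (auto simp: h'_def)
  have "((\<lambda>y. (iterated_integral (Suc d) h y - iterated_integral (Suc d) h x) / (y - x)) \<longlongrightarrow> iterated_integral d h x) (at x within {0..1})"
    unfolding tendsto_at_iff_sequentially
  proof (intro allI impI)
    fix X assume X: "\<forall>i. X i \<in> {0..1} - {x}" and lim: "X \<longlonglongrightarrow> x"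
    define q where "q i t = h' t * ((tpow (Suc d) t (X i) - tpow (Suc d) t x) / (X i - x))" for i t
    have qint: "q i integrable_on {0..1}" "integral {0..1} (q i) / fact (Suc d)
       = (iterated_integral (Suc d) h (X i) - iterated_integral (Suc d) h x) / (X i - x)" for i
    proof -
      have Xi: "X i \<in> {0..1}" "X i \<noteq> x" using X by auto
      have i: "(\<lambda>t. h' t * tpow (Suc d) t y) integrable_on {0..1}" if "y \<in> {0..1}" for y
        by (intro set_lebesgue_integral_eq_integral iterated_integral_integrable h' that)
      have q: "q i = (\<lambda>t. (1 / (X i - x)) * (h' t * tpow (Suc d) t (X i) - h' t * tpow (Suc d) t x))"
        by (rule ext) (simp add: q_def right_diff_distrib diff_divide_distrib)
      show "q i integrable_on {0..1}" unfolding q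
        using integrable_cmul[OF integrable_diff[OF i[OF Xi(1)] i[OF x]], of "1 / (X i - x)"] by simp
      have "integral {0..1} (q i) = (1 / (X i - x)) * (integral {0..1} (\<lambda>t. h' t * tpow (Suc d) t (X i)) - integral {0..1} (\<lambda>t. h' t * tpow (Suc d) t x))"
        unfolding q integral_mult_right
        by (subst Henstock_Kurzweil_Integration.integral_diff[OF i[OF Xi(1)] i[OF x]]) simp
      then show "integral {0..1} (q i) / fact (Suc d)
        = (iterated_integral (Suc d) h (X i) - iterated_integral (Suc d) h x) / (X i - x)"
        by (simp add: iterated_integral_def same diff_divide_distrib mult.commute[of "X i - x"] del: fact_Suc)
    qed
    have conv: "(\<lambda>i. q i t) \<longlonglongrightarrow> h' t * (real (Suc d) * tpow d t x)" for t
    proof (cases "t = x")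
      case True
      then show ?thesis by (simp add: q_def h'_def)
    next
      case False
      then have "((\<lambda>y. (tpow (Suc d) t y - tpow (Suc d) t x) / (y - x)) \<longlongrightarrow> real (Suc d) * tpow d t x) (at x within UNIV)"
        using tpow_has_derivative_off_knot[of x t d] by (simp add: has_field_derivative_iff)
      then have "((\<lambda>y. (tpow (Suc d) t y - tpow (Suc d) t x) / (y - x)) \<circ> X) \<longlonglongrightarrow> real (Suc d) * tpow d t x"
        unfolding tendsto_at_iff_sequentially using X lim by auto
      then show ?thesis unfolding q_def by (intro tendsto_mult_left) (simp add: o_def)
    qed
    have bound: "norm (q i t) \<le> real (Suc d) * \<bar>h' t\<bar>" if t: "t \<in> {0..1}" for i t
    proof -
      have Xi: "X i \<in> {0..1}" "X i \<noteq> x" using X by auto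
      have "norm (max 0 (X i - t) ^ Suc d - max 0 (x - t) ^ Suc d) \<le> real (Suc d) * norm (max 0 (X i - t) - max 0 (x - t))"
        by (rule norm_power_diff) (use Xi x t in auto)
      also have "\<dots> \<le> real (Suc d) * \<bar>X i - x\<bar>" by (intro mult_left_mono) auto
      finally have "\<bar>tpow (Suc d) t (X i) - tpow (Suc d) t x\<bar> / \<bar>X i - x\<bar> \<le> real (Suc d)"
        using Xi by (simp add: tpow_eq_max divide_le_eq)
      from mult_left_mono[OF this, of "\<bar>h' t\<bar>"] show ?thesis by (simp add: q_def abs_mult mult.commute)
    qed
    have "(\<lambda>i. integral {0..1} (q i)) \<longlonglongrightarrow> integral {0..1} (\<lambda>t. h' t * (real (Suc d) * tpow d t x))"
    proof (rule dominated_convergence(2)[OF qint(1) _ bound conv])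
      have "(\<lambda>t. \<bar>h' t\<bar>) integrable_on {0..1}"
        using set_lebesgue_integral_eq_integral(1)[OF set_integrable_norm[OF h']] by simp
      from integrable_cmul[OF this, of "real (Suc d)"]
      show "(\<lambda>t. real (Suc d) * \<bar>h' t\<bar>) integrable_on {0..1}" by simp
    qed
    also have "integral {0..1} (\<lambda>t. h' t * (real (Suc d) * tpow d t x)) = real (Suc d) * integral {0..1} (\<lambda>t. h' t * tpow d t x)"
      by (simp only: mult.left_commute[of _ "real (Suc d)"] integral_mult_right)
    finally have "(\<lambda>i. integral {0..1} (q i) / fact (Suc d)) \<longlonglongrightarrow> real (Suc d) * integral {0..1} (\<lambda>t. h' t * tpow d t x) / fact (Suc d)"
      by (intro tendsto_intros) auto
    also have "real (Suc d) * integral {0..1} (\<lambda>t. h' t * tpow d t x) / fact (Suc d) = iterated_integral d h x"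
      by (simp add: iterated_integral_def same del: of_nat_Suc)
    finally show "((\<lambda>y. (iterated_integral (Suc d) h y - iterated_integral (Suc d) h x) / (y - x)) \<circ> X) \<longlonglongrightarrow> iterated_integral d h x"
      by (simp only: qint(2) o_def)
  qed
  then show ?thesis by (simp add: has_field_derivative_iff flip: has_real_derivative_iff_has_vector_derivative)
qed

lemma iterated_integral_chain:
  assumes "h absolutely_integrable_on {0..1}"
  shows "deriv_chain d (\<lambda>j. iterated_integral (d - j) h)"
  unfolding deriv_chain_def using iterated_integral_has_derivative[OF assms]
  by (metis Suc_diff_Suc)

text \<open>
  Subtracting the iterated integrals from the derivatives leaves a chain whose top member is constant,
  hence a chain of polynomials.
\<close>

lemma taylor_iterated_integral:
  assumes g: "g absolutely_integrable_on {0..1}" and D: "deriv_chain d D"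
    and top: "\<And>x. x \<in> {0..1} \<Longrightarrow> D d x = D d 0 + integral {0..x} g"
  obtains P where "degree P \<le> d" "\<And>x. x \<in> {0..1} \<Longrightarrow> D 0 x = poly P x + iterated_integral d g x"
proof -
  define G where "G j x = D j x - iterated_integral (d - j) g x" for j x
  have "deriv_chain d G"
    using D iterated_integral_chain[OF g, of d] unfolding deriv_chain_def G_def[abs_def]
    by (blast intro: has_vector_derivative_diff)
  moreover have "G d x = D d 0" if "x \<in> {0..1}" for x
    using top[OF that] iterated_integral_0[OF g that] by (simp add: G_def)
  ultimately obtain P where "degree P \<le> d" "\<And>x. x \<in> {0..1} \<Longrightarrow> G 0 x = poly P x"
    using poly_of_deriv_chain by blast
  with that show thesis by (simp add: G_def algebra_simps)
qed

lemma iterated_integral_in_splines: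
  assumes m: "1 \<le> m" and n: "0 < n" and S: "S \<in> splines m n"
  shows "iterated_integral d S \<in> splines (m + Suc d) n"
proof (induction d)
  have int: "S absolutely_integrable_on {0..1}"
    by (rule piecewise_poly_integrable[OF _ n]) (use S in \<open>auto simp: splines_iff\<close>)
  {
    case 0
    show ?case using spline_antiderivative[OF m n S, of "iterated_integral 0 S" 0] iterated_integral_0[OF int] by simp
  next
    case (Suc d)
    have "iterated_integral (Suc d) S x = iterated_integral (Suc d) S 0 + integral {0..x} (iterated_integral d S)"
      if x: "x \<in> {0..1}" for x
    proof -
      have "(iterated_integral d S has_integral (iterated_integral (Suc d) S x - iterated_integral (Suc d) S 0)) {0..x}"
        using x by (intro fundamental_theorem_of_calculus
            has_vector_derivative_within_subset[OF iterated_integral_has_derivative[OF int]]) auto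
      then show ?thesis by (simp add: integral_unique)
    qed
    from spline_antiderivative[OF _ n Suc.IH this] show ?case by simp
  }
qed

section \<open>Spline approximation of iterated integrals\<close>

lemma polys_bounded_on_unit_interval:
  fixes c :: "nat \<Rightarrow> real poly"
  obtains B where "B \<ge> 0" "\<And>l s. l \<le> M \<Longrightarrow> s \<in> {0..1} \<Longrightarrow> \<bar>poly (c l) s\<bar> \<le> B"
proof -
  have "\<exists>b. \<forall>s\<in>{0..1}. \<bar>poly (c l) s\<bar> \<le> b" for l
  proof -
    have "compact (poly (c l) ` {0..1})" by (intro compact_continuous_image continuous_intros) simp
    then have "bounded (poly (c l) ` {0..1})" by (rule compact_imp_bounded)
    then show ?thesis by (auto simp: bounded_iff)
  qed
  then obtain b where b: "\<And>l s. s \<in> {0..1} \<Longrightarrow> \<bar>poly (c l) s\<bar> \<le> b l" by metis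
  show thesis
  proof (rule that[of "\<Sum>l\<le>M. \<bar>b l\<bar>"])
    fix l s assume l: "l \<le> M" and s: "s \<in> {0..1::real}"
    have "\<bar>poly (c l) s\<bar> \<le> \<bar>b l\<bar>" using b[OF s, of l] by linarith
    also have "\<dots> \<le> (\<Sum>l\<le>M. \<bar>b l\<bar>)" using l by (intro member_le_sum) auto
    finally show "\<bar>poly (c l) s\<bar> \<le> (\<Sum>l\<le>M. \<bar>b l\<bar>)" .
  qed (simp add: sum_nonneg)
qed

text \<open>
  For \<open>t\<close> in the cell \<open>j\<close>, a multiple of this spline in \<open>x\<close> replaces the truncated power at \<open>t\<close>.
\<close>

abbreviation kernel_sum :: "nat \<Rightarrow> (nat \<Rightarrow> real poly) \<Rightarrow> nat \<Rightarrow> nat \<Rightarrow> real \<Rightarrow> real \<Rightarrow> real" where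
  "kernel_sum M c n j t x \<equiv> \<Sum>l\<le>M. poly (c l) (real n * t - real j) * tpow M (real (j + l) / real n) x"

text \<open>
  Far to the right of the cell of \<open>t\<close> all truncations are inactive, and the identity of
  \<open>shifted_powers_span\<close>, rescaled to mesh \<open>1/n\<close>, makes the difference vanish; to the left everything is
  zero. In between, all terms have the size \<open>n\<^sup>-\<^sup>d\<close> of a \<open>d\<close>-th power of the mesh.
\<close>

lemma truncated_power_spline_kernel:
  assumes dM: "d \<le> M" and M: "1 \<le> M"
  obtains C and c :: "nat \<Rightarrow> real poly" where "C > 0"
    "\<And>n i j x t. \<lbrakk>0 < n; x \<in> cell n i; t \<in> cell n j\<rbrakk> \<Longrightarrow>
      \<bar>tpow d t x - real n ^ M / real n ^ d * kernel_sum M c n j t x\<bar>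
        \<le> (if j \<in> {i - M..i} then C / real n ^ d else 0)"
proof -
  obtain c where c: "\<And>s y. (\<Sum>l\<le>M. poly (c l) s * (y - real l) ^ M) = (y - s) ^ d"
    using shifted_powers_span[OF dM] by metis
  obtain B where B: "B \<ge> 0" "\<And>l s. l \<le> M \<Longrightarrow> s \<in> {0..1} \<Longrightarrow> \<bar>poly (c l) s\<bar> \<le> B"
    using polys_bounded_on_unit_interval[of M c] by metis
  define R where "R = real (Suc M)"
  define C where "C = R ^ d + real (Suc M) * (B * R ^ M)"
  have C: "C > 0" using B by (simp add: C_def R_def add_pos_nonneg)
  show thesis
  proof (rule that[OF C])
    fix n i j :: nat and x t :: real
    assume n: "0 < n" and x: "x \<in> cell n i" and t: "t \<in> cell n j"
    let ?K = "tpow d t x - real n ^ M / real n ^ d * kernel_sum M c n j t x"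
    have n0: "real n > 0" using n by simp
    have le: "real a / real n \<le> real b / real n" if "a \<le> b" for a b using that by (simp add: divide_right_mono)
    have lt: "real a / real n < real b / real n" if "a < b" for a b using that n by (simp add: divide_strict_right_mono)
    have x': "real i / real n \<le> x" "x \<le> real (Suc i) / real n" and t': "real j / real n \<le> t" "t \<le> real (Suc j) / real n"
      using x t by (simp_all only: cell_def atLeastAtMost_iff)
    have s01: "real n * t - real j \<in> {0..1}"
      using t' n0 by (simp add: divide_le_eq le_divide_eq mult.commute)
    consider "i < j" | "j + M < i" | "j \<in> {i - M..i}" by fastforce
    then show "\<bar>?K\<bar> \<le> (if j \<in> {i - M..i} then C / real n ^ d else 0)"
    proof cases
      case 1
      have "x \<le> real (j + l) / real n" for l using x'(2) le[of "Suc i" "j + l"] 1 by linarith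
      then have "tpow M (real (j + l) / real n) x = 0" for l by (simp add: tpow_def not_less)
      moreover have "tpow d t x = 0" using x'(2) t'(1) le[of "Suc i" j] 1 by (simp add: tpow_def)
      ultimately show ?thesis using 1 by simp
    next
      case 2
      have "t < x" using x'(1) t'(2) le[of "j + M + 1" i] lt[of "Suc j" "j + M + 1"] M 2 by simp
      have "real (j + l) / real n < x" if "l \<le> M" for l using x'(1) lt[of "j + l" i] that 2 by linarith
      then have "kernel_sum M c n j t x
        = (\<Sum>l\<le>M. poly (c l) (real n * t - real j) * (((real n * x - real j) - real l) / real n) ^ M)"
        using n0 by (intro sum.cong refl) (simp add: tpow_def diff_divide_distrib add_divide_distrib diff_diff_eq)
      also have "\<dots> = (\<Sum>l\<le>M. poly (c l) (real n * t - real j) * ((real n * x - real j) - real l) ^ M) / real n ^ M"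
        by (simp add: power_divide sum_divide_distrib)
      also have "\<dots> = (real n * (x - t)) ^ d / real n ^ M" by (simp add: c right_diff_distrib)
      finally have sum: "kernel_sum M c n j t x
        = (real n * (x - t)) ^ d / real n ^ M" .
      have "?K = 0" unfolding sum using n0 \<open>t < x\<close> by (simp add: tpow_def power_mult_distrib)
      then show ?thesis using 2 by simp
    next
      case 3
      then have ij: "j \<le> i" "i \<le> j + M" by auto
      have dist: "x - real j / real n \<le> R / real n"
      proof -
        have "real (j + Suc M) / real n = real j / real n + R / real n" by (simp add: R_def add_divide_distrib)
        with x'(2) le[of "Suc i" "j + Suc M"] ij show ?thesis by linarith
      qed
      have tp: "\<bar>tpow e u x\<bar> \<le> (R / real n) ^ e" if "real j / real n \<le> u" for e u
        using dist that by (auto simp: tpow_def R_def intro!: power_mono)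
      have "\<bar>kernel_sum M c n j t x\<bar> \<le> (\<Sum>l\<le>M. B * (R / real n) ^ M)"
      proof (rule order_trans[OF sum_abs], rule sum_mono)
        fix l assume "l \<in> {..M}"
        then show "\<bar>poly (c l) (real n * t - real j) * tpow M (real (j + l) / real n) x\<bar> \<le> B * (R / real n) ^ M"
          unfolding abs_mult using s01 by (intro mult_mono B tp le) auto
      qed
      also have "\<dots> = real (Suc M) * (B * R ^ M) / real n ^ M" by (simp add: power_divide)
      finally have sum: "\<bar>kernel_sum M c n j t x\<bar>
        \<le> real (Suc M) * (B * R ^ M) / real n ^ M" .
      have "\<bar>?K\<bar> \<le> \<bar>tpow d t x\<bar> + real n ^ M / real n ^ d * \<bar>kernel_sum M c n j t x\<bar>"
        by (rule order_trans[OF abs_triangle_ineq4]) (simp add: abs_mult)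
      also have "\<dots> \<le> (R / real n) ^ d + real n ^ M / real n ^ d * (real (Suc M) * (B * R ^ M) / real n ^ M)"
        using t'(1) by (intro add_mono tp mult_left_mono sum) auto
      also have "\<dots> = C / real n ^ d" using n0 by (simp add: C_def power_divide add_divide_distrib del: of_nat_Suc)
      finally show ?thesis using 3 by simp
    qed
  qed
qed

text \<open>
  The kernel \<open>(x - t)\<^sub>+\<^sup>d\<close> is replaced, cell by cell in \<open>t\<close>, by the spline in \<open>x\<close> of the preceding
  lemma. Its coefficients depend on \<open>t\<close>; integrating them against \<open>h\<close> gives the coefficients of \<open>S\<close>. The error
  kernel vanishes for \<open>t\<close> outside the \<open>M + 1\<close> cells that end with the cell of \<open>x\<close>.
\<close>

theorem iterated_integral_spline_approx:
  assumes dM: "d \<le> M" and M: "1 \<le> M"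
  obtains C where "C > 0" "\<And>n h. \<lbrakk>0 < n; h absolutely_integrable_on {0..1}\<rbrakk> \<Longrightarrow>
    \<exists>S\<in>splines (Suc M) n. \<forall>i<n. \<forall>x\<in>cell n i.
      \<bar>iterated_integral d h x - S x\<bar> \<le> C / real n ^ d * (\<Sum>j\<in>{i - M..i}. integral (cell n j) (\<lambda>t. \<bar>h t\<bar>))"
proof -
  obtain C c where C: "C > 0" and ker: "\<And>n i j x t. \<lbrakk>0 < n; x \<in> cell n i; t \<in> cell n j\<rbrakk> \<Longrightarrow>
      \<bar>tpow d t x - real n ^ M / real n ^ d * kernel_sum M c n j t x\<bar>
        \<le> (if j \<in> {i - M..i} then C / real n ^ d else 0)"
  proof (rule truncated_power_spline_kernel[OF dM M], goal_cases)
    case (1 C c)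
    show ?case by (rule 1(1), rule 1(2), rule 1(3))
  qed
  show thesis
  proof (rule that[OF C])
    fix n :: nat and h :: "real \<Rightarrow> real" assume n: "0 < n" and h: "h absolutely_integrable_on {0..1}"
    define \<kappa> where "\<kappa> = real n ^ M / real n ^ d"
    define w where "w j l = \<kappa> * integral (cell n j) (\<lambda>t. h t * poly (c l) (real n * t - real j)) / fact d" for j l
    define S where "S x = (\<Sum>q\<in>{..<n} \<times> {..M}. w (fst q) (snd q) * tpow M (real (fst q + snd q) / real n) x)" for x
    have S: "S \<in> splines (Suc M) n" unfolding S_def[abs_def] by (intro splines_sum tpow_in_splines M n)
    have hc: "h absolutely_integrable_on cell n j" if "j < n" for j
      using absolutely_integrable_on_subinterval[OF h] cell_subset[OF that] by (simp add: cell_def)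
    have "\<bar>iterated_integral d h x - S x\<bar> \<le> C / real n ^ d * (\<Sum>j\<in>{i - M..i}. integral (cell n j) (\<lambda>t. \<bar>h t\<bar>))"
      if i: "i < n" and x: "x \<in> cell n i" for i x
    proof -
      have x01: "x \<in> {0..1}" using x cell_subset[OF i] by blast
      define K where "K j t = tpow d t x - \<kappa> * kernel_sum M c n j t x" for j t
      have ht: "(\<lambda>t. h t * tpow d t x) integrable_on {0..1}"
        by (intro set_lebesgue_integral_eq_integral iterated_integral_integrable h x01)
      have htj: "(\<lambda>t. h t * tpow d t x) integrable_on cell n j" if "j < n" for j
        using integrable_on_subinterval[OF ht] cell_subset[OF that] by (simp add: cell_def)
      have hp: "(\<lambda>t. h t * poly (c l) (real n * t - real j)) integrable_on cell n j" if j: "j < n" for j l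
      proof -
        have "compact ((\<lambda>t. poly (c l) (real n * t - real j)) ` cell n j)"
          unfolding cell_def by (intro compact_continuous_image continuous_intros) simp
        then obtain K where "\<And>t. t \<in> cell n j \<Longrightarrow> \<bar>poly (c l) (real n * t - real j)\<bar> \<le> K"
          using compact_imp_bounded by (force simp: bounded_iff)
        then show ?thesis
          using hc[OF j] unfolding cell_def
          by (intro set_lebesgue_integral_eq_integral absolutely_integrable_times_bounded_borel borel_measurable_continuous_onI)
            (auto intro!: continuous_intros)
      qed
      have cellwise: "integral (cell n j) (\<lambda>t. h t * tpow d t x) / fact d - (\<Sum>l\<le>M. w j l * tpow M (real (j + l) / real n) x)
          = integral (cell n j) (\<lambda>t. h t * K j t) / fact d"
        and Kint: "(\<lambda>t. h t * K j t) integrable_on cell n j" if j: "j < n" for j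
      proof -
        have eq: "(\<lambda>t. h t * K j t) = (\<lambda>t. h t * tpow d t x - (\<Sum>l\<le>M. (\<kappa> * tpow M (real (j + l) / real n) x) * (h t * poly (c l) (real n * t - real j))))"
          by (rule ext) (simp add: K_def right_diff_distrib sum_distrib_left mult_ac)
        have hp': "(\<lambda>t. (\<kappa> * tpow M (real (j + l) / real n) x) * (h t * poly (c l) (real n * t - real j))) integrable_on cell n j" for l
          using integrable_cmul[OF hp[OF j, of l], of "\<kappa> * tpow M (real (j + l) / real n) x"] by simp
        show "(\<lambda>t. h t * K j t) integrable_on cell n j" unfolding eq
          by (intro integrable_diff integrable_sum htj j hp') auto
        have "integral (cell n j) (\<lambda>t. h t * K j t) = integral (cell n j) (\<lambda>t. h t * tpow d t x)
            - (\<Sum>l\<le>M. (\<kappa> * tpow M (real (j + l) / real n) x) * integral (cell n j) (\<lambda>t. h t * poly (c l) (real n * t - real j)))"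
          unfolding eq integral_mult_right[symmetric]
          by (subst Henstock_Kurzweil_Integration.integral_diff[OF htj[OF j] integrable_sum[OF finite_atMost hp']],
              subst Henstock_Kurzweil_Integration.integral_sum[OF finite_atMost hp']) (rule refl)
        then show "integral (cell n j) (\<lambda>t. h t * tpow d t x) / fact d - (\<Sum>l\<le>M. w j l * tpow M (real (j + l) / real n) x)
          = integral (cell n j) (\<lambda>t. h t * K j t) / fact d"
          by (simp add: w_def diff_divide_distrib sum_divide_distrib mult_ac)
      qed
      have "iterated_integral d h x = (\<Sum>j<n. integral (cell n j) (\<lambda>t. h t * tpow d t x) / fact d)"
        unfolding iterated_integral_def by (subst integral_cells[OF n ht]) (simp add: sum_divide_distrib)
      moreover have "S x = (\<Sum>j<n. \<Sum>l\<le>M. w j l * tpow M (real (j + l) / real n) x)"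
        unfolding S_def by (simp add: sum.cartesian_product case_prod_unfold)
      ultimately have "iterated_integral d h x - S x = (\<Sum>j<n. integral (cell n j) (\<lambda>t. h t * K j t) / fact d)"
        by (simp only: sum_subtractf[symmetric]) (intro sum.cong refl cellwise, simp)
      also have "\<bar>\<dots>\<bar> \<le> (\<Sum>j<n. if j \<in> {i - M..i} then C / real n ^ d * integral (cell n j) (\<lambda>t. \<bar>h t\<bar>) else 0)"
      proof (rule order_trans[OF sum_abs], rule sum_mono)
        fix j assume "j \<in> {..<n}"
        then have j: "j < n" by simp
        have hj: "(\<lambda>t. \<bar>h t\<bar>) integrable_on cell n j"
          using set_lebesgue_integral_eq_integral(1)[OF set_integrable_norm[OF hc[OF j]]] by simp
        let ?c = "if j \<in> {i - M..i} then C / real n ^ d else 0"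
        have "\<bar>integral (cell n j) (\<lambda>t. h t * K j t)\<bar> \<le> integral (cell n j) (\<lambda>t. ?c * \<bar>h t\<bar>)"
        proof (rule Henstock_Kurzweil_Integration.integral_norm_bound_integral[OF Kint[OF j], unfolded real_norm_def])
          show "(\<lambda>t. ?c * \<bar>h t\<bar>) integrable_on cell n j" using integrable_cmul[OF hj, of ?c] by simp
          fix t assume "t \<in> cell n j"
          then have "\<bar>K j t\<bar> \<le> ?c" using ker[OF n x] unfolding K_def \<kappa>_def by blast
          from mult_right_mono[OF this, of "\<bar>h t\<bar>"] show "\<bar>h t * K j t\<bar> \<le> ?c * \<bar>h t\<bar>"
            by (simp add: abs_mult mult.commute)
        qed
        also have "\<dots> = ?c * integral (cell n j) (\<lambda>t. \<bar>h t\<bar>)" by simp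
        finally have "\<bar>integral (cell n j) (\<lambda>t. h t * K j t)\<bar> \<le> ?c * integral (cell n j) (\<lambda>t. \<bar>h t\<bar>)" .
        moreover have "\<bar>integral (cell n j) (\<lambda>t. h t * K j t) / fact d\<bar> \<le> \<bar>integral (cell n j) (\<lambda>t. h t * K j t)\<bar>"
          using fact_ge_1[of d, where ?'a = real] by (simp add: divide_le_eq mult_le_cancel_left1)
        ultimately show "\<bar>integral (cell n j) (\<lambda>t. h t * K j t) / fact d\<bar>
          \<le> (if j \<in> {i - M..i} then C / real n ^ d * integral (cell n j) (\<lambda>t. \<bar>h t\<bar>) else 0)"
          by (auto split: if_splits)
      qed
      also have "\<dots> = (\<Sum>j\<in>{..<n} \<inter> {i - M..i}. C / real n ^ d * integral (cell n j) (\<lambda>t. \<bar>h t\<bar>))"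
        by (rule sum.inter_restrict[symmetric]) simp
      also have "{..<n} \<inter> {i - M..i} = {i - M..i}" using i by auto
      finally show ?thesis by (simp add: sum_distrib_left)
    qed
    with S show "\<exists>S\<in>splines (Suc M) n. \<forall>i<n. \<forall>x\<in>cell n i.
      \<bar>iterated_integral d h x - S x\<bar> \<le> C / real n ^ d * (\<Sum>j\<in>{i - M..i}. integral (cell n j) (\<lambda>t. \<bar>h t\<bar>))"
      by blast
  qed
qed

section \<open>Absolutely continuous functions are integrals of their derivatives\<close>

text \<open>
  Intervals are represented by the pairs of their end points. They need not cover \<open>[a, b]\<close>, which makes
  subfamilies and unions available without completing them to partitions.
\<close>

definition nonoverlapping :: "real \<Rightarrow> real \<Rightarrow> (real \<times> real) set \<Rightarrow> bool" where
  "nonoverlapping a b A \<longleftrightarrow> finite A \<and> (\<forall>q\<in>A. a \<le> fst q \<and> fst q < snd q \<and> snd q \<le> b) \<and>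
    (\<forall>q\<in>A. \<forall>q'\<in>A. q \<noteq> q' \<longrightarrow> snd q \<le> fst q' \<or> snd q' \<le> fst q)"

definition total_change :: "(real \<Rightarrow> real) \<Rightarrow> (real \<times> real) set \<Rightarrow> real" where
  "total_change F A = (\<Sum>q\<in>A. \<bar>F (snd q) - F (fst q)\<bar>)"

definition total_length :: "(real \<times> real) set \<Rightarrow> real" where
  "total_length A = (\<Sum>q\<in>A. snd q - fst q)"

definition abs_cont :: "(real \<Rightarrow> real) \<Rightarrow> bool" where
  "abs_cont F \<longleftrightarrow> (\<forall>\<epsilon>>0. \<exists>\<delta>>0. \<forall>A. nonoverlapping 0 1 A \<longrightarrow> total_length A < \<delta> \<longrightarrow> total_change F A < \<epsilon>)"

lemma abs_cont_AC01:
  assumes "F \<in> AC01"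
  shows "abs_cont F"
  unfolding abs_cont_def
proof (intro allI impI)
  fix \<epsilon> :: real assume "\<epsilon> > 0"
  with assms obtain \<delta> where d: "\<delta> > 0" "\<And>\<D>. \<lbrakk>\<D> division_of \<Union>\<D>; \<Union>\<D> \<subseteq> {0..1}; (\<Sum>K\<in>\<D>. Sup K - Inf K) < \<delta>\<rbrakk>
      \<Longrightarrow> (\<Sum>K\<in>\<D>. \<bar>F (Sup K) - F (Inf K)\<bar>) < \<epsilon>"
    unfolding AC01_def by blast
  have "total_change F A < \<epsilon>" if A: "nonoverlapping 0 1 A" and len: "total_length A < \<delta>" for A
  proof -
    define I where "I q = {fst q..snd q}" for q :: "real \<times> real"
    have fin: "finite A" and lt: "\<And>q. q \<in> A \<Longrightarrow> 0 \<le> fst q \<and> fst q < snd q \<and> snd q \<le> 1"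
      and dis: "\<And>q q'. q \<in> A \<Longrightarrow> q' \<in> A \<Longrightarrow> q \<noteq> q' \<Longrightarrow> snd q \<le> fst q' \<or> snd q' \<le> fst q"
      using A unfolding nonoverlapping_def by blast+
    have inj: "inj_on I A"
    proof (rule inj_onI)
      fix q q' assume q: "q \<in> A" "q' \<in> A" "I q = I q'"
      have "fst q \<le> snd q" using lt[OF q(1)] by simp
      with q(3) have "fst q = fst q' \<and> snd q = snd q'" unfolding I_def by (simp add: Icc_eq_Icc)
      then show "q = q'" by (simp add: prod_eq_iff)
    qed
    have "(I ` A) division_of \<Union>(I ` A)"
    proof (rule division_ofI)
      fix K assume "K \<in> I ` A"
      then obtain q where q: "q \<in> A" "K = I q" by blast
      show "K \<subseteq> \<Union>(I ` A)" using q by blast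
      show "K \<noteq> {}" using lt[OF q(1)] q(2) by (simp add: I_def)
      show "\<exists>a b. K = cbox a b" using q(2) by (auto simp: I_def)
      fix L assume "L \<in> I ` A" "K \<noteq> L"
      then obtain q' where q': "q' \<in> A" "L = I q'" "q \<noteq> q'" using q by blast
      show "interior K \<inter> interior L = {}"
        using dis[OF q(1) q'(1,3)] by (auto simp: I_def q q')
    qed (use fin in auto)
    moreover have "\<Union>(I ` A) \<subseteq> {0..1}" using lt by (fastforce simp: I_def)
    moreover have "(\<Sum>K\<in>I ` A. Sup K - Inf K) = total_length A"
      unfolding total_length_def sum.reindex[OF inj]
      by (intro sum.cong refl) (use lt in \<open>simp add: I_def less_imp_le\<close>)
    moreover have "(\<Sum>K\<in>I ` A. \<bar>F (Sup K) - F (Inf K)\<bar>) = total_change F A"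
      unfolding total_change_def sum.reindex[OF inj]
      by (intro sum.cong refl) (use lt in \<open>simp add: I_def less_imp_le\<close>)
    ultimately show ?thesis using d(2)[of "I ` A"] len by simp
  qed
  with d(1) show "\<exists>\<delta>>0. \<forall>A. nonoverlapping 0 1 A \<longrightarrow> total_length A < \<delta> \<longrightarrow> total_change F A < \<epsilon>" by blast
qed


lemma nonoverlapping_mono:
  "nonoverlapping a b A \<Longrightarrow> a' \<le> a \<Longrightarrow> b \<le> b' \<Longrightarrow> nonoverlapping a' b' A"
  unfolding nonoverlapping_def by force

lemma nonoverlapping_empty: "nonoverlapping a b {}"
  by (simp add: nonoverlapping_def)

lemma nonoverlapping_Un:
  assumes A: "nonoverlapping a b A" and B: "nonoverlapping b c B" and "a \<le> b" "b \<le> c"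
  shows "nonoverlapping a c (A \<union> B)" "A \<inter> B = {}"
proof -
  have AB: "snd q \<le> fst q'" if "q \<in> A" "q' \<in> B" for q q'
    using A B that unfolding nonoverlapping_def by (meson order_trans)
  show "A \<inter> B = {}"
    using AB A unfolding nonoverlapping_def by (metis disjoint_iff not_le)
  have "finite (A \<union> B)" using A B by (simp add: nonoverlapping_def)
  moreover have "a \<le> fst q \<and> fst q < snd q \<and> snd q \<le> c" if "q \<in> A \<union> B" for q
    using that A B assms(3,4) unfolding nonoverlapping_def by (meson UnE order_trans)
  moreover have "snd q \<le> fst q' \<or> snd q' \<le> fst q" if "q \<in> A \<union> B" "q' \<in> A \<union> B" "q \<noteq> q'" for q q'
    using that A B AB unfolding nonoverlapping_def by blast
  ultimately show "nonoverlapping a c (A \<union> B)" unfolding nonoverlapping_def by blast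
qed

lemma nonoverlapping_UN:
  assumes A: "nonoverlapping a b A" and f: "\<And>q. q \<in> A \<Longrightarrow> nonoverlapping (fst q) (snd q) (f q)"
  shows "nonoverlapping a b (\<Union>q\<in>A. f q)"
    and "\<And>h :: real \<times> real \<Rightarrow> real. sum h (\<Union>q\<in>A. f q) = (\<Sum>q\<in>A. sum h (f q))"
proof -
  have fin: "finite A" and finf: "\<And>q. q \<in> A \<Longrightarrow> finite (f q)"
    using A f by (auto simp: nonoverlapping_def)
  have in_f: "fst q \<le> fst r \<and> fst r < snd r \<and> snd r \<le> snd q" if "q \<in> A" "r \<in> f q" for q r
    using f[OF that(1)] that(2) by (simp add: nonoverlapping_def)
  have in_A: "a \<le> fst q \<and> fst q < snd q \<and> snd q \<le> b" if "q \<in> A" for q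
    using A that by (simp add: nonoverlapping_def)
  have sep: "snd r \<le> fst r' \<or> snd r' \<le> fst r" if "q \<in> A" "q' \<in> A" "q \<noteq> q'" "r \<in> f q" "r' \<in> f q'" for q q' r r'
  proof -
    have "snd q \<le> fst q' \<or> snd q' \<le> fst q" using A that(1-3) by (simp add: nonoverlapping_def)
    with in_f[OF that(1,4)] in_f[OF that(2,5)] show ?thesis by linarith
  qed
  have "snd r \<le> fst r' \<or> snd r' \<le> fst r" if r: "r \<in> f q" "r' \<in> f q'" "q \<in> A" "q' \<in> A" "r \<noteq> r'" for q q' r r'
  proof (cases "q = q'")
    case True
    then show ?thesis using f[OF r(3)] r by (simp add: nonoverlapping_def)
  qed (use sep r in blast)
  moreover have "a \<le> fst r \<and> fst r < snd r \<and> snd r \<le> b" if "r \<in> f q" "q \<in> A" for q r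
    using in_f[OF that(2,1)] in_A[OF that(2)] by linarith
  ultimately show "nonoverlapping a b (\<Union>q\<in>A. f q)"
    unfolding nonoverlapping_def using fin finf by blast
  have "f q \<inter> f q' = {}" if "q \<in> A" "q' \<in> A" "q \<noteq> q'" for q q'
  proof (rule ccontr)
    assume "f q \<inter> f q' \<noteq> {}"
    then obtain r where r: "r \<in> f q" "r \<in> f q'" by blast
    from sep[OF that r] in_f[OF that(1) r(1)] show False by linarith
  qed
  then show "sum h (\<Union>q\<in>A. f q) = (\<Sum>q\<in>A. sum h (f q))" for h :: "real \<times> real \<Rightarrow> real"
    by (intro sum.UNION_disjoint fin) (use finf in auto)
qed

text \<open>
  Intervals that do not meet the interior of \<open>[b, c]\<close> degenerate under clipping and are dropped.
\<close>

lemma nonoverlapping_clip: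
  fixes b c :: real
  assumes A: "nonoverlapping a e A"
  defines "r \<equiv> \<lambda>q. (max (fst q) b, min (snd q) c)"
  obtains B where "nonoverlapping b c B"
    "total_change F B = (\<Sum>q\<in>A. if fst (r q) < snd (r q) then \<bar>F (snd (r q)) - F (fst (r q))\<bar> else 0)"
proof
  define R where "R = {q\<in>A. fst (r q) < snd (r q)}"
  have fin: "finite A" using A by (simp add: nonoverlapping_def)
  have dis: "snd (r q) \<le> fst (r q') \<or> snd (r q') \<le> fst (r q)" if "q \<in> A" "q' \<in> A" "q \<noteq> q'" for q q'
  proof -
    have "snd q \<le> fst q' \<or> snd q' \<le> fst q" using A that unfolding nonoverlapping_def by blast
    then show ?thesis by (auto simp: r_def)
  qed
  have inj: "inj_on r R"
  proof (rule inj_onI, rule ccontr)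
    fix q q' assume "q \<in> R" "q' \<in> R" "r q = r q'" "q \<noteq> q'"
    with dis[of q q'] show False by (auto simp: R_def)
  qed
  show "nonoverlapping b c (r ` R)"
    unfolding nonoverlapping_def using fin dis by (auto simp: R_def) (auto simp: r_def)
  show "total_change F (r ` R) = (\<Sum>q\<in>A. if fst (r q) < snd (r q) then \<bar>F (snd (r q)) - F (fst (r q))\<bar> else 0)"
    unfolding total_change_def sum.reindex[OF inj] using fin by (simp add: R_def sum.inter_filter)
qed

text \<open>
  Cutting at \<open>b\<close> affects at most one interval, and there the triangle inequality applies.
\<close>

lemma nonoverlapping_split:
  assumes A: "nonoverlapping a c A"
  obtains A1 A2 where "nonoverlapping a b A1" "nonoverlapping b c A2"
    "total_change F A \<le> total_change F A1 + total_change F A2"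
proof -
  define l r where "l q = (max (fst q) a, min (snd q) b)" and "r q = (max (fst q) b, min (snd q) c)" for q :: "real \<times> real"
  obtain A1 where A1: "nonoverlapping a b A1"
    "total_change F A1 = (\<Sum>q\<in>A. if fst (l q) < snd (l q) then \<bar>F (snd (l q)) - F (fst (l q))\<bar> else 0)"
    using nonoverlapping_clip[OF A, of a b F] unfolding l_def by blast
  obtain A2 where A2: "nonoverlapping b c A2"
    "total_change F A2 = (\<Sum>q\<in>A. if fst (r q) < snd (r q) then \<bar>F (snd (r q)) - F (fst (r q))\<bar> else 0)"
    using nonoverlapping_clip[OF A, of b c F] unfolding r_def by blast
  have "total_change F A \<le> total_change F A1 + total_change F A2"
    unfolding A1(2) A2(2) sum.distrib[symmetric] unfolding total_change_def
  proof (rule sum_mono)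
    fix q assume "q \<in> A"
    then have "a \<le> fst q" "fst q < snd q" "snd q \<le> c" using A by (auto simp: nonoverlapping_def)
    then show "\<bar>F (snd q) - F (fst q)\<bar> \<le> (if fst (l q) < snd (l q) then \<bar>F (snd (l q)) - F (fst (l q))\<bar> else 0)
      + (if fst (r q) < snd (r q) then \<bar>F (snd (r q)) - F (fst (r q))\<bar> else 0)"
      by (auto simp: l_def r_def min_def max_def)
  qed
  with A1(1) A2(1) show thesis by (rule that)
qed

lemma total_length_le:
  "nonoverlapping a b A \<Longrightarrow> a \<le> b \<Longrightarrow> total_length A \<le> b - a"
proof (induction "card A" arbitrary: A b)
  case 0
  then show ?case by (simp add: nonoverlapping_def total_length_def)
next
  case (Suc n)
  have fin: "finite A" and ne: "A \<noteq> {}" using Suc by (auto simp: nonoverlapping_def)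
  define q where "q = arg_min_on (\<lambda>q. - fst q) A"
  have q: "q \<in> A" "\<And>q'. q' \<in> A \<Longrightarrow> fst q' \<le> fst q"
    using arg_min_if_finite(1)[OF fin ne, of "\<lambda>q. - fst q"] arg_min_least[OF fin ne, of _ "\<lambda>q. - fst q"]
    by (auto simp: q_def)
  have qb: "a \<le> fst q" "fst q < snd q" "snd q \<le> b" using Suc.prems(1) q(1) by (auto simp: nonoverlapping_def)
  have "snd q' \<le> fst q" if "q' \<in> A - {q}" for q'
  proof -
    have "snd q' \<le> fst q \<or> snd q \<le> fst q'" using Suc.prems(1) q(1) that by (auto simp: nonoverlapping_def)
    with q(2)[of q'] qb that show ?thesis by auto
  qed
  then have "nonoverlapping a (fst q) (A - {q})"
    using Suc.prems(1) unfolding nonoverlapping_def by auto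
  then have "total_length (A - {q}) \<le> fst q - a"
    using Suc.hyps(1)[of "A - {q}" "fst q"] Suc.hyps(2) q(1) qb fin by simp
  moreover have "total_length A = (snd q - fst q) + total_length (A - {q})"
    unfolding total_length_def by (rule sum.remove[OF fin q(1)])
  ultimately show ?case using qb by simp
qed

definition variation :: "(real \<Rightarrow> real) \<Rightarrow> real \<Rightarrow> real \<Rightarrow> real" where
  "variation F a b = (SUP A\<in>{A. nonoverlapping a b A}. total_change F A)"

text \<open>
  Absolute continuity bounds the variation by \<open>1\<close> on intervals shorter than \<open>\<delta>\<close>, and finitely many of
  these cover \<open>[0,1]\<close>.
\<close>

lemma abs_cont_bounded_variation:
  assumes F: "abs_cont F"
  obtains K where "\<And>a b A. \<lbrakk>0 \<le> a; b \<le> 1; nonoverlapping a b A\<rbrakk> \<Longrightarrow> total_change F A \<le> K"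
proof -
  obtain \<delta> where d: "\<delta> > 0" "\<And>A. nonoverlapping 0 1 A \<Longrightarrow> total_length A < \<delta> \<Longrightarrow> total_change F A < 1"
    using F unfolding abs_cont_def by (metis zero_less_one)
  have k: "total_change F A \<le> real k" if "0 \<le> a" "a \<le> b" "b \<le> 1" "b - a \<le> real k * (\<delta> / 2)" "nonoverlapping a b A" for k a b A
    using that
  proof (induction k arbitrary: a A)
    case 0
    then have "a = b" by simp
    with 0 have "A = {}" unfolding nonoverlapping_def by force
    then show ?case by (simp add: total_change_def)
  next
    case (Suc k)
    define c where "c = min b (a + \<delta> / 2)"
    have c: "a \<le> c" "c \<le> b" using Suc.prems d(1) by (auto simp: c_def)
    obtain A1 A2 where A: "nonoverlapping a c A1" "nonoverlapping c b A2"
      "total_change F A \<le> total_change F A1 + total_change F A2"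
      using nonoverlapping_split[OF Suc.prems(5)] .
    have "total_length A1 \<le> c - a" by (rule total_length_le[OF A(1) c(1)])
    also have "\<dots> < \<delta>" using d(1) by (auto simp: c_def)
    finally have "total_change F A1 < 1"
      by (intro d nonoverlapping_mono[OF A(1)]) (use c Suc.prems in auto)
    moreover have "b - c \<le> real k * (\<delta> / 2)"
      using Suc.prems(4) d(1) by (auto simp: c_def min_def algebra_simps)
    then have "total_change F A2 \<le> real k" using Suc.prems c A(2) by (intro Suc.IH[of c]) auto
    ultimately show ?case using A(3) by simp
  qed
  obtain k :: nat where "1 / (\<delta> / 2) \<le> real k" using real_arch_simple by blast
  then have k1: "1 \<le> real k * (\<delta> / 2)" using d(1) by (simp add: divide_le_eq)
  show thesis
  proof (rule that[of "real k"])
    fix a b A assume ab: "0 \<le> a" "b \<le> 1" and A: "nonoverlapping a b A"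
    have "nonoverlapping 0 1 A" by (rule nonoverlapping_mono[OF A ab])
    then show "total_change F A \<le> real k" by (rule k[rotated 4]) (use k1 in auto)
  qed
qed

context
  fixes F assumes F: "abs_cont F"
begin

lemma total_change_le_variation:
  assumes "0 \<le> a" "b \<le> 1" "nonoverlapping a b A"
  shows "total_change F A \<le> variation F a b"
proof -
  obtain K where "\<And>a b A. \<lbrakk>0 \<le> a; b \<le> 1; nonoverlapping a b A\<rbrakk> \<Longrightarrow> total_change F A \<le> K"
    using abs_cont_bounded_variation[OF F] by blast
  then have "bdd_above (total_change F ` {A. nonoverlapping a b A})"
    using assms(1,2) by (intro bdd_aboveI[of _ K]) auto
  then show ?thesis unfolding variation_def using assms(3) by (intro cSUP_upper) auto
qed

lemma variation_le:
  assumes "\<And>A. nonoverlapping a b A \<Longrightarrow> total_change F A \<le> K"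
  shows "variation F a b \<le> K"
  unfolding variation_def using assms nonoverlapping_empty by (intro cSUP_least) auto

lemma variation_approx:
  assumes "\<eta> > 0"
  obtains A where "nonoverlapping a b A" "variation F a b < total_change F A + \<eta>"
proof (rule ccontr)
  assume neg: "\<not> thesis"
  have "variation F a b \<le> variation F a b - \<eta>"
  proof (rule variation_le)
    fix A assume "nonoverlapping a b A"
    with neg that have "\<not> variation F a b < total_change F A + \<eta>" by blast
    then show "total_change F A \<le> variation F a b - \<eta>" by simp
  qed
  with assms show False by simp
qed

lemma variation_add:
  assumes "0 \<le> a" "a \<le> b" "b \<le> c" "c \<le> 1"
  shows "variation F a c = variation F a b + variation F b c"
proof (rule antisym)
  show "variation F a c \<le> variation F a b + variation F b c"
  proof (rule variation_le)
    fix A assume "nonoverlapping a c A"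
    then obtain A1 A2 where A: "nonoverlapping a b A1" "nonoverlapping b c A2"
      "total_change F A \<le> total_change F A1 + total_change F A2"
      using nonoverlapping_split by metis
    with total_change_le_variation[OF _ _ A(1)] total_change_le_variation[OF _ _ A(2)] assms
    show "total_change F A \<le> variation F a b + variation F b c" by simp
  qed
  show "variation F a b + variation F b c \<le> variation F a c"
  proof (rule field_le_epsilon)
    fix e :: real assume e: "0 < e"
    obtain A B where A: "nonoverlapping a b A" "variation F a b < total_change F A + e / 2"
      and B: "nonoverlapping b c B" "variation F b c < total_change F B + e / 2"
      using variation_approx[of "e / 2"] e by (metis half_gt_zero)
    note AB = nonoverlapping_Un[OF A(1) B(1) assms(2,3)]
    have "total_change F A + total_change F B = total_change F (A \<union> B)"
      unfolding total_change_def using A(1) B(1) AB(2)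
      by (intro sum.union_disjoint[symmetric]) (auto simp: nonoverlapping_def)
    also have "\<dots> \<le> variation F a c" using AB(1) assms by (intro total_change_le_variation) auto
    finally show "variation F a b + variation F b c \<le> variation F a c + e" using A B by simp
  qed
qed

lemma abs_diff_le_variation:
  assumes "0 \<le> a" "a \<le> b" "b \<le> 1"
  shows "\<bar>F b - F a\<bar> \<le> variation F a b"
proof (cases "a = b")
  case True
  then show ?thesis using total_change_le_variation[OF assms(1,3) nonoverlapping_empty] by (simp add: total_change_def)
next
  case False
  then have "nonoverlapping a b {(a, b)}" using assms by (simp add: nonoverlapping_def)
  from total_change_le_variation[OF assms(1,3) this] show ?thesis by (simp add: total_change_def)
qed

text \<open>
  Inside every interval of a short family insert subintervals that almost attain the variation; the
  refined family is just as short, so absolute continuity of \<open>F\<close> applies to it.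
\<close>

lemma abs_cont_variation: "abs_cont (variation F 0)"
  unfolding abs_cont_def
proof (intro allI impI)
  fix \<epsilon> :: real assume e: "\<epsilon> > 0"
  then have "\<epsilon> / 2 > 0" by simp
  with F obtain \<delta> where d: "\<delta> > 0" "\<And>A. nonoverlapping 0 1 A \<Longrightarrow> total_length A < \<delta> \<Longrightarrow> total_change F A < \<epsilon> / 2"
    unfolding abs_cont_def by blast
  have "total_change (variation F 0) A < \<epsilon>" if A: "nonoverlapping 0 1 A" "total_length A < \<delta>" for A
  proof -
    \<comment> \<open>The errors \<open>\<eta>\<close> of all intervals together stay below \<open>\<epsilon> / 2\<close>; the \<open>1\<close> covers empty \<open>A\<close>.\<close>
    define \<eta> where "\<eta> = \<epsilon> / 2 / (real (card A) + 1)"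
    have eta: "\<eta> > 0" using e by (simp add: \<eta>_def)
    have q01: "0 \<le> fst q" "fst q < snd q" "snd q \<le> 1" if "q \<in> A" for q
      using A(1) that by (auto simp: nonoverlapping_def)
    have "\<exists>B. nonoverlapping (fst q) (snd q) B \<and> variation F (fst q) (snd q) < total_change F B + \<eta>" for q
      using variation_approx[OF eta] by metis
    then obtain f where f: "\<And>q. nonoverlapping (fst q) (snd q) (f q)"
      "\<And>q. variation F (fst q) (snd q) < total_change F (f q) + \<eta>" by metis
    note U = nonoverlapping_UN[OF A(1) f(1)]
    have "total_length (\<Union>q\<in>A. f q) = (\<Sum>q\<in>A. total_length (f q))" by (simp add: total_length_def U(2))
    also have "\<dots> \<le> (\<Sum>q\<in>A. snd q - fst q)"
      using q01 by (intro sum_mono total_length_le f) (simp add: less_imp_le)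
    also have "\<dots> < \<delta>" using A(2) by (simp add: total_length_def)
    finally have "total_change F (\<Union>q\<in>A. f q) < \<epsilon> / 2" by (rule d(2)[OF U(1)])
    moreover have "total_change F (\<Union>q\<in>A. f q) = (\<Sum>q\<in>A. total_change F (f q))" by (simp add: total_change_def U(2))
    moreover have "total_change (variation F 0) A \<le> (\<Sum>q\<in>A. total_change F (f q) + \<eta>)"
      unfolding total_change_def[of "variation F 0"]
    proof (rule sum_mono)
      fix q assume q: "q \<in> A"
      have "variation F 0 (snd q) - variation F 0 (fst q) = variation F (fst q) (snd q)"
        using variation_add[of 0 "fst q" "snd q"] q01[OF q] by simp
      moreover have "0 \<le> variation F (fst q) (snd q)"
        using abs_diff_le_variation[of "fst q" "snd q"] q01[OF q] by linarith
      ultimately show "\<bar>variation F 0 (snd q) - variation F 0 (fst q)\<bar> \<le> total_change F (f q) + \<eta>"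
        using f(2)[of q] by simp
    qed
    moreover have "real (card A) * \<eta> < \<epsilon> / 2"
      using e by (simp add: \<eta>_def field_simps)
    ultimately show ?thesis by (simp add: sum.distrib)
  qed
  with d(1) show "\<exists>\<delta>>0. \<forall>A. nonoverlapping 0 1 A \<longrightarrow> total_length A < \<delta> \<longrightarrow> total_change (variation F 0) A < \<epsilon>"
    by blast
qed

end

lemma abs_cont_diff:
  assumes "abs_cont F" "abs_cont G"
  shows "abs_cont (\<lambda>x. F x - G x)"
  unfolding abs_cont_def
proof (intro allI impI)
  fix \<epsilon> :: real assume "\<epsilon> > 0"
  then have e: "\<epsilon> / 2 > 0" by simp
  obtain d1 where d1: "d1 > 0" "\<And>A. nonoverlapping 0 1 A \<Longrightarrow> total_length A < d1 \<Longrightarrow> total_change F A < \<epsilon> / 2"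
    using assms(1) e unfolding abs_cont_def by blast
  obtain d2 where d2: "d2 > 0" "\<And>A. nonoverlapping 0 1 A \<Longrightarrow> total_length A < d2 \<Longrightarrow> total_change G A < \<epsilon> / 2"
    using assms(2) e unfolding abs_cont_def by blast
  have "total_change (\<lambda>x. F x - G x) A < \<epsilon>" if "nonoverlapping 0 1 A" "total_length A < min d1 d2" for A
  proof -
    have "total_change (\<lambda>x. F x - G x) A \<le> total_change F A + total_change G A"
      unfolding total_change_def sum.distrib[symmetric] by (rule sum_mono) linarith
    with d1(2)[OF that(1)] d2(2)[OF that(1)] that(2) show ?thesis by simp
  qed
  with d1(1) d2(1) show "\<exists>\<delta>>0. \<forall>A. nonoverlapping 0 1 A \<longrightarrow> total_length A < \<delta> \<longrightarrow> total_change (\<lambda>x. F x - G x) A < \<epsilon>"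
    by (intro exI[of _ "min d1 d2"]) auto
qed

text \<open>
  The increments of the variation \<open>V\<close> dominate those of \<open>F\<close>, so \<open>V\<close> and \<open>V - F\<close> are monotone.
\<close>

lemma abs_cont_jordan_decomposition:
  assumes "abs_cont F"
  obtains P N where "abs_cont P" "abs_cont N" "mono_on {0..1} P" "mono_on {0..1} N" "\<And>x. F x = P x - N x"
proof
  let ?V = "variation F 0"
  show "abs_cont ?V" by (rule abs_cont_variation[OF assms])
  then show "abs_cont (\<lambda>x. ?V x - F x)" using assms by (rule abs_cont_diff)
  have *: "\<bar>F y - F x\<bar> \<le> ?V y - ?V x" if "x \<in> {0..1}" "y \<in> {0..1}" "x \<le> y" for x y
    using abs_diff_le_variation[OF assms, of x y] variation_add[OF assms, of 0 x y] that by simp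
  show "mono_on {0..1} ?V" using * by (intro mono_onI) force
  show "mono_on {0..1} (\<lambda>x. ?V x - F x)" using * by (intro mono_onI) force
  show "F x = ?V x - (?V x - F x)" for x by simp
qed

lemma abs_cont_imp_continuous:
  assumes F: "abs_cont F" and "e > 0"
  obtains d where "d > 0" "\<And>x y. \<lbrakk>x \<in> {0..1}; y \<in> {0..1}; \<bar>x - y\<bar> < d\<rbrakk> \<Longrightarrow> \<bar>F x - F y\<bar> < e"
proof -
  obtain d where d: "d > 0" "\<And>A. nonoverlapping 0 1 A \<Longrightarrow> total_length A < d \<Longrightarrow> total_change F A < e"
    using assms unfolding abs_cont_def by blast
  have *: "\<bar>F y - F x\<bar> < e" if "x \<in> {0..1}" "y \<in> {0..1}" "\<bar>x - y\<bar> < d" "x < y" for x y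
    using d(2)[of "{(x, y)}"] that by (simp add: nonoverlapping_def total_length_def total_change_def)
  have "\<bar>F x - F y\<bar> < e" if "x \<in> {0..1}" "y \<in> {0..1}" "\<bar>x - y\<bar> < d" for x y
    using *[of x y] *[of y x] that assms(2) by (cases x y rule: linorder_cases) (auto simp: abs_minus_commute)
  with d(1) that show thesis by blast
qed

text \<open>
  Exhausting open sets by finite unions of disjoint half-open intervals makes absolute continuity, a
  statement on finite families, applicable to open sets.
\<close>

lemma open_eq_Union_dyadic:
  fixes U :: "real set"
  assumes U: "open U"
  defines "I \<equiv> (\<lambda>n k. {real k / 2 ^ n<..real (Suc k) / 2 ^ n})"
  shows "U \<inter> {0<..1} = (\<Union>n. \<Union>k\<in>{k. k < 2 ^ n \<and> I n k \<subseteq> U}. I n k)"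
    and "incseq (\<lambda>n. \<Union>k\<in>{k. k < 2 ^ n \<and> I n k \<subseteq> U}. I n k)"
proof -
  have cover: "\<exists>k<2 ^ n. x \<in> I n k" if x: "x \<in> {0<..1}" for x n
  proof -
    define k where "k = nat (\<lceil>x * 2 ^ n\<rceil> - 1)"
    have "0 < x * 2 ^ n" "x * 2 ^ n \<le> 1 * 2 ^ n" using x by (auto intro: mult_right_mono)
    then have k: "real k < x * 2 ^ n" "x * 2 ^ n \<le> real (Suc k)" "real k < 2 ^ n" unfolding k_def by linarith+
    then have "x \<in> I n k" by (simp add: I_def divide_less_eq le_divide_eq)
    moreover have "k < 2 ^ n" using k(3) by (metis of_nat_less_iff of_nat_numeral of_nat_power)
    ultimately show ?thesis by blast
  qed
  have sub01: "I n k \<subseteq> {0<..1}" if "k < 2 ^ n" for n k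
  proof -
    have "Suc k \<le> 2 ^ n" using that by simp
    then have "real (Suc k) \<le> 2 ^ n" by (metis of_nat_le_iff of_nat_numeral of_nat_power)
    then have "real (Suc k) / 2 ^ n \<le> 1" by (simp add: divide_le_eq)
    then have "x \<le> 1" if "x \<le> real (Suc k) / 2 ^ n" for x using that by (rule order_trans[rotated])
    moreover have "0 < x" if "real k / 2 ^ n < x" for x using that by (rule le_less_trans[rotated]) simp
    ultimately show ?thesis unfolding I_def by (simp only: subset_iff greaterThanAtMost_iff) blast
  qed
  show "U \<inter> {0<..1} = (\<Union>n. \<Union>k\<in>{k. k < 2 ^ n \<and> I n k \<subseteq> U}. I n k)"
  proof
    show "U \<inter> {0<..1} \<subseteq> (\<Union>n. \<Union>k\<in>{k. k < 2 ^ n \<and> I n k \<subseteq> U}. I n k)"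
    proof
      fix x assume x: "x \<in> U \<inter> {0<..1}"
      then obtain e where e: "e > 0" "\<And>y. \<bar>y - x\<bar> < e \<Longrightarrow> y \<in> U"
        using U unfolding open_dist dist_real_def by blast
      obtain n where n: "(1 / 2) ^ n < e" using real_arch_pow_inv[OF e(1), of "1 / 2"] by auto
      obtain k where k: "k < 2 ^ n" "x \<in> I n k" using cover x by blast
      have "I n k \<subseteq> U"
      proof
        fix y assume y: "y \<in> I n k"
        have "real (Suc k) / 2 ^ n = real k / 2 ^ n + (1 / 2) ^ n" by (simp add: add_divide_distrib power_divide)
        then have "\<bar>y - x\<bar> < e" using y k(2) n by (auto simp: I_def)
        then show "y \<in> U" by (rule e(2))
      qed
      with k show "x \<in> (\<Union>n. \<Union>k\<in>{k. k < 2 ^ n \<and> I n k \<subseteq> U}. I n k)" by blast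
    qed
    show "(\<Union>n. \<Union>k\<in>{k. k < 2 ^ n \<and> I n k \<subseteq> U}. I n k) \<subseteq> U \<inter> {0<..1}"
      using sub01 by blast
  qed
  show "incseq (\<lambda>n. \<Union>k\<in>{k. k < 2 ^ n \<and> I n k \<subseteq> U}. I n k)"
  proof (rule incseq_SucI, rule subsetI)
    fix n x assume "x \<in> (\<Union>k\<in>{k. k < 2 ^ n \<and> I n k \<subseteq> U}. I n k)"
    then obtain k where k: "k < 2 ^ n" "I n k \<subseteq> U" "x \<in> I n k" by blast
    with sub01 obtain l where l: "l < 2 ^ Suc n" "x \<in> I (Suc n) l" using cover[of x "Suc n"] by blast
    have p: "(2::real) ^ n > 0" by simp
    have "real l / 2 < real (Suc k)" "real k < real (Suc l) / 2"
      using k(3) l(2) p unfolding I_def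
      by (auto simp: divide_less_eq less_divide_eq divide_le_eq le_divide_eq mult_ac)
    then have "real l < real (2 * Suc k)" "real (2 * k) < real (Suc l)" by simp_all
    then have "l \<le> Suc (2 * k)" "2 * k \<le> l" unfolding of_nat_less_iff by simp_all
    then have "I (Suc n) l \<subseteq> I n k"
      unfolding I_def by (auto simp: field_simps)
    with k l show "x \<in> (\<Union>k\<in>{k. k < 2 ^ Suc n \<and> I (Suc n) k \<subseteq> U}. I (Suc n) k)" by blast
  qed
qed

text \<open>
  The Stieltjes measure of \<open>G\<close> is absolutely continuous with respect to Lebesgue measure: a null set
  has open neighbourhoods of arbitrarily small length, and on these the measure is small by absolute
  continuity of \<open>G\<close>. The density is given by the Radon-Nikodym theorem.
\<close>

lemma monotone_abs_cont_density:
  assumes G: "abs_cont G" and mono: "mono_on {0..1} G"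
  obtains g where "g absolutely_integrable_on {0..1}" "\<And>x. x \<in> {0..1} \<Longrightarrow> G x = G 0 + integral {0..x} g"
proof -
  define clip where "clip x = max 0 (min 1 x)" for x :: real
  define H where "H x = G (clip x)" for x
  have clip01: "clip x \<in> {0..1}" for x by (auto simp: clip_def)
  have Hmono: "H x \<le> H y" if "x \<le> y" for x y
    unfolding H_def by (rule mono_onD[OF mono clip01 clip01]) (use that in \<open>auto simp: clip_def\<close>)
  have Hcont: "continuous (at_right a) H" for a
    unfolding continuous_within
  proof (rule tendstoI)
    fix e :: real assume "0 < e"
    then obtain d where d: "d > 0" "\<And>x y. \<lbrakk>x \<in> {0..1}; y \<in> {0..1}; \<bar>x - y\<bar> < d\<rbrakk> \<Longrightarrow> \<bar>G x - G y\<bar> < e"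
      using abs_cont_imp_continuous[OF G] by metis
    have "eventually (\<lambda>x. dist x a < d) (at_right a)" using d(1) by (auto simp: eventually_at)
    then show "eventually (\<lambda>x. dist (H x) (H a) < e) (at_right a)"
    proof eventually_elim
      case (elim x)
      have "\<bar>clip x - clip a\<bar> < d" using elim by (auto simp: clip_def dist_real_def)
      then show ?case unfolding H_def dist_real_def by (rule d(2)[OF clip01 clip01])
    qed
  qed
  define N where "N = interval_measure H"
  have setsN: "sets N = sets borel" by (simp add: N_def)
  have NIoc: "emeasure N {a<..b} = ennreal (H b - H a)" if "a \<le> b" for a b
    unfolding N_def by (rule emeasure_interval_measure_Ioc[OF that Hmono Hcont])
  have outside: "emeasure N (- {0<..1}) = 0"
  proof -
    have "emeasure N (\<Union>n. {- real n<..0} \<union> {1<..real n + 1}) = 0"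
    proof (rule emeasure_UN_eq_0)
      fix n
      have "emeasure N {- real n<..0} = 0" "emeasure N {1<..real n + 1} = 0"
        by (simp_all add: NIoc H_def clip_def)
      then show "emeasure N ({- real n<..0} \<union> {1<..real n + 1}) = 0"
        using emeasure_subadditive[of "{- real n<..0}" N "{1<..real n + 1}"] setsN by simp
    qed (auto simp: setsN)
    also have "(\<Union>n. {- real n<..0} \<union> {1<..real n + 1}) = - {0<..1}"
    proof (intro subset_antisym subsetI)
      fix x :: real assume x: "x \<in> - {0<..1}"
      obtain n where "\<bar>x\<bar> < real n" using reals_Archimedean2 by blast
      with x show "x \<in> (\<Union>n. {- real n<..0} \<union> {1<..real n + 1})" by (intro UN_I[of n]) auto
    qed auto
    finally show ?thesis .
  qed
  have "absolutely_continuous lborel N"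
    unfolding absolutely_continuous_def
  proof
    fix S :: "real set" assume S: "S \<in> null_sets lborel"
    then have Sb: "S \<in> sets borel" and S0: "emeasure lborel S = 0" by auto
    have "emeasure N (S \<inter> {0<..1}) \<le> ennreal e" if e: "0 < e" for e
    proof -
      obtain \<delta> where d: "\<delta> > 0" "\<And>A. nonoverlapping 0 1 A \<Longrightarrow> total_length A < \<delta> \<Longrightarrow> total_change G A < e"
        using G e unfolding abs_cont_def by blast
      obtain U where U: "open U" "S \<subseteq> U" "emeasure lborel (U - S) < ennreal \<delta>"
        using outer_regular_lborel[OF Sb d(1)] by auto
      have "emeasure lborel U = emeasure lborel (U - S)"
        using S U(1) by (intro emeasure_Diff_null_set[symmetric]) auto
      with U(3) have Ud: "emeasure lborel U < ennreal \<delta>" by simp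
      define I where "I = (\<lambda>n k. {real k / 2 ^ n<..real (Suc k) / 2 ^ n})"
      define J where "J n = {k. k < 2 ^ n \<and> I n k \<subseteq> U}" for n :: nat
      have dy: "U \<inter> {0<..1} = (\<Union>n. \<Union>k\<in>J n. I n k)" "incseq (\<lambda>n. \<Union>k\<in>J n. I n k)"
        unfolding J_def I_def by (rule open_eq_Union_dyadic[OF U(1)])+
      have finJ: "finite (J n)" for n by (simp add: J_def)
      have bound: "emeasure N (\<Union>k\<in>J n. I n k) \<le> ennreal e" for n
      proof -
        define pt where "pt k = (real k / 2 ^ n, real (Suc k) / 2 ^ n)" for k
        have inj: "inj_on pt (J n)" by (auto simp: inj_on_def pt_def)
        have lt: "real k / 2 ^ n < real (Suc k) / 2 ^ n" for k by (simp add: divide_strict_right_mono)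
        have le1: "real (Suc k) / 2 ^ n \<le> 1" if "k \<in> J n" for k
        proof -
          have "Suc k \<le> 2 ^ n" using that by (simp add: J_def)
          then have "real (Suc k) \<le> 2 ^ n" by (metis of_nat_le_iff of_nat_numeral of_nat_power)
          then show ?thesis by (simp add: divide_le_eq)
        qed
        have order: "real (Suc k) / 2 ^ n \<le> real l / 2 ^ n" if "k < l" for k l
          using that by (intro divide_right_mono) auto
        have no: "nonoverlapping 0 1 (pt ` J n)"
          unfolding nonoverlapping_def
        proof (intro conjI ballI impI)
          fix q q' assume "q \<in> pt ` J n" "q' \<in> pt ` J n" "q \<noteq> q'"
          then obtain k l where "q = pt k" "q' = pt l" "k \<noteq> l" by auto
          then show "snd q \<le> fst q' \<or> snd q' \<le> fst q"
            using order[of k l] order[of l k] by (auto simp: pt_def neq_iff)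
        qed (use finJ lt le1 in \<open>auto simp: pt_def\<close>)
        have disj: "disjoint_family_on (I n) (J n)"
          unfolding disjoint_family_on_def
        proof (intro ballI impI)
          fix k l :: nat assume "k \<noteq> l"
          then show "I n k \<inter> I n l = {}" using order[of k l] order[of l k] by (fastforce simp: I_def neq_iff)
        qed
        have "ennreal (total_length (pt ` J n)) = (\<Sum>k\<in>J n. emeasure lborel (I n k))"
          unfolding total_length_def sum.reindex[OF inj]
          using lt by (subst sum_ennreal[symmetric]) (auto simp: pt_def I_def less_imp_le intro!: sum.cong)
        also have "\<dots> = emeasure lborel (\<Union>k\<in>J n. I n k)"
          by (rule sum_emeasure[OF _ disj finJ]) (auto simp: I_def)
        also have "\<dots> \<le> emeasure lborel U"
          using U(1) by (intro emeasure_mono) (auto simp: J_def)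
        also have "\<dots> < ennreal \<delta>" by (rule Ud)
        finally have "total_length (pt ` J n) < \<delta>"
        proof (subst (asm) ennreal_less_iff)
          show "0 \<le> total_length (pt ` J n)"
            unfolding total_length_def sum.reindex[OF inj]
            by (intro sum_nonneg) (use lt in \<open>auto simp: pt_def less_imp_le\<close>)
        qed
        then have "total_change G (pt ` J n) < e" by (rule d(2)[OF no])
        have "emeasure N (\<Union>k\<in>J n. I n k) = (\<Sum>k\<in>J n. emeasure N (I n k))"
          by (rule sum_emeasure[OF _ disj finJ, symmetric]) (auto simp: I_def setsN)
        also have "\<dots> = (\<Sum>k\<in>J n. ennreal \<bar>G (real (Suc k) / 2 ^ n) - G (real k / 2 ^ n)\<bar>)"
        proof (rule sum.cong[OF refl])
          fix k assume k: "k \<in> J n"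
          have "0 \<le> real k / 2 ^ n" by simp
          then have c: "clip (real k / 2 ^ n) = real k / 2 ^ n" "clip (real (Suc k) / 2 ^ n) = real (Suc k) / 2 ^ n"
            using le1[OF k] lt[of k] unfolding clip_def by linarith+
          have "emeasure N (I n k) = ennreal (H (real (Suc k) / 2 ^ n) - H (real k / 2 ^ n))"
            unfolding I_def by (rule NIoc) (use lt[of k] in simp)
          moreover have "0 \<le> H (real (Suc k) / 2 ^ n) - H (real k / 2 ^ n)"
            using Hmono[OF less_imp_le[OF lt[of k]]] by simp
          ultimately show "emeasure N (I n k) = ennreal \<bar>G (real (Suc k) / 2 ^ n) - G (real k / 2 ^ n)\<bar>"
            unfolding H_def c by simp
        qed
        also have "\<dots> = ennreal (total_change G (pt ` J n))"
          unfolding total_change_def sum.reindex[OF inj] by (subst sum_ennreal) (auto simp: pt_def)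
        also have "\<dots> \<le> ennreal e" using \<open>total_change G (pt ` J n) < e\<close> by (intro ennreal_leI) simp
        finally show ?thesis .
      qed
      have "emeasure N (S \<inter> {0<..1}) \<le> emeasure N (U \<inter> {0<..1})"
        using U setsN by (intro emeasure_mono) auto
      also have "\<dots> = (SUP n. emeasure N (\<Union>k\<in>J n. I n k))"
        unfolding dy(1) by (rule SUP_emeasure_incseq[symmetric])
          (use dy(2) setsN finJ in \<open>auto simp: I_def intro!: sets.finite_UN\<close>)
      also have "\<dots> \<le> ennreal e" by (rule SUP_least[OF bound])
      finally show ?thesis .
    qed
    then have small: "emeasure N (S \<inter> {0<..1}) \<le> 0 + ennreal e" if "0 < e" for e using that by simp
    have "emeasure N (S \<inter> {0<..1}) \<le> 0" by (rule ennreal_le_epsilon) (rule small)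
    moreover have "emeasure N S \<le> emeasure N (S \<inter> {0<..1}) + emeasure N (- {0<..1})"
      using Sb setsN by (intro order_trans[OF emeasure_mono emeasure_subadditive]) auto
    ultimately have "emeasure N S = 0" using outside by simp
    then show "S \<in> null_sets N" using Sb setsN by auto
  qed
  then obtain f where f: "f \<in> borel_measurable lborel" and fN: "density lborel f = N"
    using sigma_finite_measure.Radon_Nikodym[OF sigma_finite_lborel, of N] setsN by auto
  have fI: "(\<integral>\<^sup>+t. f t * indicator {0<..x} t \<partial>lborel) = ennreal (G x - G 0)" if x: "x \<in> {0..1}" for x
  proof -
    have "(\<integral>\<^sup>+t. f t * indicator {0<..x} t \<partial>lborel) = emeasure N {0<..x}"
      unfolding fN[symmetric] using f by (subst emeasure_density) auto
    also have "\<dots> = ennreal (G x - G 0)" using x by (subst NIoc) (auto simp: H_def clip_def)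
    finally show ?thesis .
  qed
  have "AE t in lborel. f t * indicator {0<..1} t \<noteq> \<infinity>"
    by (rule nn_integral_PInf_AE) (use f fI[of 1] in auto)
  then have fin: "AE t in lborel. t \<in> {0<..1} \<longrightarrow> f t \<noteq> \<infinity>"
    by eventually_elim (auto simp: indicator_def)
  define g where "g t = enn2real (f t)" for t
  have gm: "g \<in> borel_measurable borel" using f unfolding g_def by simp
  have gi: "((\<lambda>t. g t * indicator {0<..x} t) has_integral (G x - G 0)) UNIV" if x: "x \<in> {0..1}" for x
  proof (rule nn_integral_has_integral)
    show "(\<lambda>t. g t * indicator {0<..x} t) \<in> borel_measurable borel" using gm by simp
    show "0 \<le> g t * indicator {0<..x} t" for t by (simp add: g_def)
    show "0 \<le> G x - G 0" using mono_onD[OF mono, of 0 x] x by simp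
    have "(\<integral>\<^sup>+t. ennreal (g t * indicator {0<..x} t) \<partial>lborel) = (\<integral>\<^sup>+t. f t * indicator {0<..x} t \<partial>lborel)"
      by (rule nn_integral_cong_AE, use fin in eventually_elim)
        (use x in \<open>auto simp: g_def indicator_def less_top\<close>)
    then show "(\<integral>\<^sup>+t. ennreal (g t * indicator {0<..x} t) \<partial>lborel) = ennreal (G x - G 0)" by (simp add: fI[OF x])
  qed
  have gx: "(g has_integral (G x - G 0)) {0..x}" if x: "x \<in> {0..1}" for x
  proof -
    have "((\<lambda>t. if t \<in> {0<..x} then g t else 0) has_integral (G x - G 0)) UNIV"
      using gi[OF x] by (rule has_integral_eq[rotated]) (auto simp: indicator_def)
    then have "(g has_integral (G x - G 0)) {0<..x}" by (simp only: has_integral_restrict_UNIV)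
    moreover have "negligible {t \<in> {0<..x} - {0..x}. g t \<noteq> 0}" "negligible {t \<in> {0..x} - {0<..x}. g t \<noteq> 0}"
      by (rule negligible_subset[of "{0}"]; force)+
    ultimately show ?thesis using has_integral_spike_set_eq by blast
  qed
  show thesis
  proof (rule that)
    show "g absolutely_integrable_on {0..1}"
      using gx[of 1] by (intro nonnegative_absolutely_integrable_1) (auto simp: g_def integrable_on_def)
    fix x :: real assume "x \<in> {0..1}"
    from integral_unique[OF gx[OF this]] show "G x = G 0 + integral {0..x} g" by simp
  qed
qed

lemma AE_right_derivative_of_integral:
  fixes g :: "real \<Rightarrow> real"
  assumes "\<And>a b. g integrable_on {a..b}"
  shows "\<exists>N. negligible N \<and> (\<forall>x. x \<notin> N \<longrightarrow> ((\<lambda>h. integral {x..x + h} g / h) \<longlongrightarrow> g x) (at_right 0))"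
proof -
  obtain N where N: "negligible N" "\<And>x e. \<lbrakk>x \<notin> N; 0 < e\<rbrakk> \<Longrightarrow>
      \<exists>d>0. \<forall>h. 0 < h \<and> h < d \<longrightarrow> norm (integral (cbox x (x + h *\<^sub>R One)) g /\<^sub>R h ^ DIM(real) - g x) < e"
    using integrable_ccontinuous_explicit[of g] assms by auto
  show ?thesis
  proof (intro exI[of _ N] conjI allI impI N(1))
    fix x assume x: "x \<notin> N"
    show "((\<lambda>h. integral {x..x + h} g / h) \<longlongrightarrow> g x) (at_right 0)"
    proof (rule tendstoI)
      fix e :: real assume "0 < e"
      from N(2)[OF x this] obtain d where "d > 0"
        "\<And>h. 0 < h \<Longrightarrow> h < d \<Longrightarrow> \<bar>integral {x..x + h} g / h - g x\<bar> < e"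
        by (auto simp: divide_inverse mult.commute)
      then show "eventually (\<lambda>h. dist (integral {x..x + h} g / h) (g x) < e) (at_right 0)"
        unfolding eventually_at_right_field dist_real_def by blast
    qed
  qed
qed

text \<open>
  Lebesgue's differentiation theorem for intervals to the right of a point gives the right derivative; the
  left derivative comes from the reflected function.
\<close>

lemma AE_derivative_of_integral:
  fixes g :: "real \<Rightarrow> real"
  assumes g: "g absolutely_integrable_on {0..1}"
  obtains N where "negligible N" "\<And>x. x \<in> {0..1} - N \<Longrightarrow>
    ((\<lambda>y. integral {0..y} g) has_vector_derivative g x) (at x within {0..1})"
proof -
  define k where "k t = (if t \<in> {0..1} then g t else 0)" for t
  have "k integrable_on UNIV"
    using set_lebesgue_integral_eq_integral(1)[OF g] unfolding k_def integrable_restrict_UNIV .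
  then have kint: "k integrable_on {a..b}" for a b by (rule integrable_on_subinterval) simp
  have kint': "(\<lambda>t. k (- t)) integrable_on {a..b}" for a b
    using kint[of "- b" "- a"] Henstock_Kurzweil_Integration.integrable_reflect_real[where f = k and a = "- b" and b = "- a"] by simp
  obtain N1 where N1: "negligible N1"
    "\<And>x. x \<notin> N1 \<Longrightarrow> ((\<lambda>h. integral {x..x + h} k / h) \<longlongrightarrow> k x) (at_right 0)"
    using AE_right_derivative_of_integral[OF kint] by blast
  obtain N2 where N2: "negligible N2"
    "\<And>x. x \<notin> N2 \<Longrightarrow> ((\<lambda>h. integral {x..x + h} (\<lambda>t. k (- t)) / h) \<longlongrightarrow> k (- x)) (at_right 0)"
    using AE_right_derivative_of_integral[OF kint'] by blast
  define N where "N = N1 \<union> uminus ` N2 \<union> {0, 1}"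
  have "negligible (uminus ` N2)"
    by (rule negligible_differentiable_image_negligible[OF order_refl N2(1)])
      (auto simp: differentiable_on_def intro!: derivative_intros)
  then have "negligible N" using N1(1) unfolding N_def by (intro negligible_Un) auto
  moreover have "((\<lambda>y. integral {0..y} g) has_vector_derivative g x) (at x within {0..1})" if x: "x \<in> {0..1} - N" for x
  proof -
    have x01: "0 < x" "x < 1" and n1: "x \<notin> N1" and n2: "- x \<notin> N2"
      using x by (auto simp: N_def image_iff)
    define \<Phi> where "\<Phi> y = integral {0..y} k" for y
    have diff: "integral {a..b} k = \<Phi> b - \<Phi> a" if "0 \<le> a" "a \<le> b" for a b
      using Henstock_Kurzweil_Integration.integral_combine[OF that kint] by (simp add: \<Phi>_def)
    have "((\<lambda>y. (\<Phi> y - \<Phi> x) / (y - x)) \<longlongrightarrow> k x) (at_right x)"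
    proof -
      have "((\<lambda>h. integral {x..x + h} k / h) \<longlongrightarrow> k x) (at_right 0)" by (rule N1(2)[OF n1])
      moreover have "eventually (\<lambda>h. integral {x..x + h} k / h = (\<Phi> (x + h) - \<Phi> x) / (x + h - x)) (at_right 0)"
        using eventually_at_right_less by eventually_elim (use x01 in \<open>simp add: diff\<close>)
      ultimately have "((\<lambda>h. (\<Phi> (x + h) - \<Phi> x) / (x + h - x)) \<longlongrightarrow> k x) (at_right 0)"
        by (rule Lim_transform_eventually)
      then show ?thesis by (simp add: filterlim_at_right_to_0[of _ _ x] add.commute)
    qed
    moreover have "((\<lambda>y. (\<Phi> y - \<Phi> x) / (y - x)) \<longlongrightarrow> k x) (at_left x)"
    proof -
      have "((\<lambda>h. integral {- x..- x + h} (\<lambda>t. k (- t)) / h) \<longlongrightarrow> k x) (at_right 0)" using N2(2)[OF n2] by simp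
      moreover have "eventually (\<lambda>h. integral {- x..- x + h} (\<lambda>t. k (- t)) / h = (\<Phi> (x - h) - \<Phi> x) / (x - h - x)) (at_right 0)"
      proof -
        have "eventually (\<lambda>h. h \<in> {0<..<x}) (at_right 0)" using x01(1) by (rule eventually_at_right_real)
        then show ?thesis
        proof eventually_elim
          case (elim h)
          have "integral {- x..- x + h} (\<lambda>t. k (- t)) = integral {x - h..x} k"
            using Henstock_Kurzweil_Integration.integral_reflect_real[where f = k and a = "x - h" and b = x] by simp
          also have "\<dots> = \<Phi> x - \<Phi> (x - h)" using elim by (intro diff) auto
          finally show ?case using elim by (simp add: divide_simps)
        qed
      qed
      ultimately have "((\<lambda>h. (\<Phi> (x - h) - \<Phi> x) / (x - h - x)) \<longlongrightarrow> k x) (at_right 0)"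
        by (rule Lim_transform_eventually)
      then show ?thesis
        by (simp add: filterlim_at_left_to_right[of _ _ x] filterlim_at_right_to_0[of _ _ "- x"])
    qed
    ultimately have "((\<lambda>y. (\<Phi> y - \<Phi> x) / (y - x)) \<longlongrightarrow> k x) (at x)" by (simp add: filterlim_split_at)
    then have "(\<Phi> has_vector_derivative k x) (at x)"
      by (simp add: has_field_derivative_iff flip: has_real_derivative_iff_has_vector_derivative)
    then have "(\<Phi> has_vector_derivative g x) (at x within {0..1})"
      using x01 by (auto simp: k_def intro: has_vector_derivative_at_within)
    moreover have "integral {0..y} g = \<Phi> y" if "y \<in> {0..1}" for y
      unfolding \<Phi>_def by (rule integral_cong) (use that in \<open>auto simp: k_def\<close>)
    ultimately show ?thesis
      by (intro has_vector_derivative_transform[of x "{0..1}" "\<lambda>y. integral {0..y} g" \<Phi>]) (use x in simp_all)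
  qed
  ultimately show thesis by (rule that)
qed

text \<open>
  Both parts of the Jordan decomposition are monotone and absolutely continuous, hence have densities.
  The difference of the densities is then the derivative almost everywhere, by Lebesgue's theorem.
\<close>

theorem AC01_fundamental_theorem:
  assumes "F \<in> AC01"
  obtains g N where "g absolutely_integrable_on {0..1}" "\<And>x. x \<in> {0..1} \<Longrightarrow> F x = F 0 + integral {0..x} g"
    "negligible N" "\<And>x. x \<in> {0..1} - N \<Longrightarrow> vector_derivative F (at x within {0..1}) = g x"
proof -
  obtain P M where PM: "abs_cont P" "abs_cont M" "mono_on {0..1} P" "mono_on {0..1} M" "\<And>x. F x = P x - M x"
    using abs_cont_jordan_decomposition[OF abs_cont_AC01[OF assms]] by metis
  obtain p where p: "p absolutely_integrable_on {0..1}" "\<And>x. x \<in> {0..1} \<Longrightarrow> P x = P 0 + integral {0..x} p"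
    using monotone_abs_cont_density[OF PM(1,3)] by metis
  obtain q where q: "q absolutely_integrable_on {0..1}" "\<And>x. x \<in> {0..1} \<Longrightarrow> M x = M 0 + integral {0..x} q"
    using monotone_abs_cont_density[OF PM(2,4)] by metis
  define g where "g x = p x - q x" for x
  have g: "g absolutely_integrable_on {0..1}" unfolding g_def using p(1) q(1) by (rule set_integral_diff)
  have F: "F x = F 0 + integral {0..x} g" if x: "x \<in> {0..1}" for x
  proof -
    have "p integrable_on {0..x}" "q integrable_on {0..x}"
      using set_lebesgue_integral_eq_integral(1)[OF p(1)] set_lebesgue_integral_eq_integral(1)[OF q(1)] x
      by (auto intro: integrable_on_subinterval)
    then have "integral {0..x} g = integral {0..x} p - integral {0..x} q"
      unfolding g_def by (rule Henstock_Kurzweil_Integration.integral_diff)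
    with p(2)[OF x] q(2)[OF x] show ?thesis by (simp add: PM(5))
  qed
  obtain N where N: "negligible N" "\<And>x. x \<in> {0..1} - N \<Longrightarrow>
    ((\<lambda>y. integral {0..y} g) has_vector_derivative g x) (at x within {0..1})"
    using AE_derivative_of_integral[OF g] by metis
  have "vector_derivative F (at x within {0..1}) = g x" if x: "x \<in> {0..1} - N" for x
  proof (rule vector_derivative_within_closed_interval)
    have "((\<lambda>y. F 0 + integral {0..y} g) has_vector_derivative 0 + g x) (at x within {0..1})"
      by (intro has_vector_derivative_add has_vector_derivative_const N(2) x)
    then have "((\<lambda>y. F 0 + integral {0..y} g) has_vector_derivative g x) (at x within {0..1})" by simp
    then show "(F has_vector_derivative g x) (at x within {0..1})"
      by (rule has_vector_derivative_transform[rotated 2]) (use x in blast, rule F)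
  qed (use x in auto)
  with g F N(1) show thesis by (rule that)
qed

section \<open>Spline approximation of a function and of its derivative\<close>

lemma iterated_integral_continuous:
  assumes "h absolutely_integrable_on {0..1}"
  shows "continuous_on {0..1} (iterated_integral d h)"
proof (cases d)
  case 0
  have "continuous_on {0..1} (\<lambda>x. integral {0..x} h)"
    by (intro indefinite_integral_continuous_1 set_lebesgue_integral_eq_integral assms)
  then show ?thesis unfolding 0
    by (rule continuous_on_eq) (rule iterated_integral_0[OF assms, symmetric])
next
  case (Suc e)
  then show ?thesis
    using continuous_on_vector_derivative[OF iterated_integral_has_derivative[OF assms]] by blast
qed

lemma Lp_norm_eq_integral:
  assumes "0 < p" "p \<le> 1" "f absolutely_integrable_on {0..1}"
  shows "Lp_norm p f = (integral {0..1} (\<lambda>x. \<bar>f x\<bar> powr p)) powr (1 / p)"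
  unfolding Lp_norm_def
  by (subst set_lebesgue_integral_eq_integral(2)[OF absolutely_integrable_abs_powr[OF assms]]) (rule refl)

lemma Lp_norm_powr:
  assumes "0 < p" "p \<le> 1" "f absolutely_integrable_on {0..1}"
  shows "Lp_norm p f powr p = integral {0..1} (\<lambda>x. \<bar>f x\<bar> powr p)"
  using assms integral_nonneg_pointwise[of "{0..1}" "\<lambda>x. \<bar>f x\<bar> powr p"]
  by (simp add: Lp_norm_eq_integral powr_powr)

lemma spline_integrable:
  assumes "S \<in> splines m n" "0 < n"
  shows "S absolutely_integrable_on {0..1}"
  using assms piecewise_poly_integrable by (auto simp: splines_iff)

lemma spline_err_nonneg: "0 \<le> spline_err m n p f"
  unfolding spline_err_def using poly_in_splines[of 0 m n]
  by (intro cINF_greatest) (auto simp: Lp_norm_def)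

lemma spline_err_powr_le:
  assumes p: "0 < p" "p \<le> 1" and f: "f absolutely_integrable_on {0..1}" and n: "0 < n" and S: "S \<in> splines m n"
  shows "spline_err m n p f powr p \<le> pow_dist p f S"
proof -
  have "bdd_below ((\<lambda>S. Lp_norm p (\<lambda>x. f x - S x)) ` splines m n)"
    by (rule bdd_belowI[of _ 0]) (auto simp: Lp_norm_def)
  then have "spline_err m n p f \<le> Lp_norm p (\<lambda>x. f x - S x)"
    unfolding spline_err_def using S by (rule cINF_lower)
  then have "spline_err m n p f powr p \<le> Lp_norm p (\<lambda>x. f x - S x) powr p"
    using p spline_err_nonneg by (intro powr_mono2) auto
  also have "\<dots> = pow_dist p f S"
    by (intro Lp_norm_powr p set_integral_diff f spline_integrable[OF S n])
  finally show ?thesis .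
qed

text \<open>
  As \<open>x\<^sup>p\<close> is continuous and increasing, the infimum can be approached in terms of \<open>p\<close>-th powers as well.
\<close>

lemma near_best_spline:
  assumes p: "0 < p" "p \<le> 1" and f: "f absolutely_integrable_on {0..1}" and n: "0 < n" and e: "0 < \<epsilon>"
  obtains S where "S \<in> splines m n" "pow_dist p f S \<le> spline_err m n p f powr p + \<epsilon>"
proof -
  define E where "E = spline_err m n p f"
  have E0: "0 \<le> E" unfolding E_def by (rule spline_err_nonneg)
  have "E = (E powr p) powr (1 / p)" using E0 p by (simp add: powr_powr)
  also have "\<dots> < (E powr p + \<epsilon>) powr (1 / p)" using p e by (intro powr_less_mono2) auto
  finally have "\<exists>S\<in>splines m n. Lp_norm p (\<lambda>x. f x - S x) < (E powr p + \<epsilon>) powr (1 / p)"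
    unfolding E_def spline_err_def using poly_in_splines[of 0 m n]
    by (subst (asm) cINF_less_iff) (auto intro!: bdd_belowI[of _ 0] simp: Lp_norm_def)
  then obtain S where S: "S \<in> splines m n" "Lp_norm p (\<lambda>x. f x - S x) < (E powr p + \<epsilon>) powr (1 / p)" by blast
  have "pow_dist p f S = Lp_norm p (\<lambda>x. f x - S x) powr p"
    by (intro Lp_norm_powr[symmetric] p set_integral_diff f spline_integrable[OF S(1) n])
  also have "\<dots> \<le> ((E powr p + \<epsilon>) powr (1 / p)) powr p"
    using p S(2) by (intro powr_mono2) (auto simp: Lp_norm_def)
  also have "\<dots> = E powr p + \<epsilon>" using p e by (simp add: powr_powr)
  finally show thesis using that S(1) by (simp add: E_def)
qed

text \<open>
  At points where \<open>deriv01 d f\<close> is not differentiable the value of \<open>deriv01 (Suc d) f\<close> is arbitrary, but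
  these points form a null set, so \<open>deriv01 (Suc d) f\<close> itself serves as the density.
\<close>

lemma derivative_representation:
  assumes diff: "differentiable01 d f" and AC: "deriv01 d f \<in> AC01"
  obtains P where "deriv01 (Suc d) f absolutely_integrable_on {0..1}" "degree P \<le> d"
    "\<And>x. x \<in> {0..1} \<Longrightarrow> f x = poly P x + iterated_integral d (deriv01 (Suc d) f) x"
proof -
  obtain g N where g: "g absolutely_integrable_on {0..1}"
    "\<And>x. x \<in> {0..1} \<Longrightarrow> deriv01 d f x = deriv01 d f 0 + integral {0..x} g"
    and N: "negligible N" "\<And>x. x \<in> {0..1} - N \<Longrightarrow> vector_derivative (deriv01 d f) (at x within {0..1}) = g x"
    using AC01_fundamental_theorem[OF AC] by metis
  define G where "G = deriv01 (Suc d) f"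
  have GN: "G x = g x" if "x \<in> {0..1} - N" for x using N(2)[OF that] by (simp add: G_def)
  have G: "G absolutely_integrable_on {0..1}" by (rule absolutely_integrable_spike[OF g(1) N(1) GN])
  have top: "deriv01 d f x = deriv01 d f 0 + integral {0..x} G" if x: "x \<in> {0..1}" for x
  proof -
    have "integral {0..x} G = integral {0..x} g" by (rule integral_spike[OF N(1)]) (use x GN in auto)
    with g(2)[OF x] show ?thesis by simp
  qed
  obtain P where "degree P \<le> d" "\<And>x. x \<in> {0..1} \<Longrightarrow> deriv01 0 f x = poly P x + iterated_integral d G x"
    using taylor_iterated_integral[OF G deriv_chain_deriv01[OF diff] top] by blast
  with G show thesis using that by (simp add: G_def)
qed

lemma sum_windows_le:
  fixes L :: "nat \<Rightarrow> real"
  assumes "\<And>j. 0 \<le> L j"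
  shows "(\<Sum>i<n. \<Sum>j\<in>{i - M..i}. L j) \<le> real (Suc M) * (\<Sum>j<n. L j)"
proof -
  have "(\<Sum>i<n. \<Sum>j\<in>{i - M..i}. L j) = (\<Sum>i<n. \<Sum>j<n. if j \<in> {i - M..i} then L j else 0)"
  proof (rule sum.cong[OF refl])
    fix i assume "i \<in> {..<n}"
    then have "{i - M..i} = {..<n} \<inter> {i - M..i}" by auto
    then show "(\<Sum>j\<in>{i - M..i}. L j) = (\<Sum>j<n. if j \<in> {i - M..i} then L j else 0)"
      using sum.inter_restrict[of "{..<n}" L "{i - M..i}"] by simp
  qed
  also have "\<dots> = (\<Sum>j<n. \<Sum>i<n. if j \<in> {i - M..i} then L j else 0)" by (rule sum.swap)
  also have "\<dots> \<le> (\<Sum>j<n. real (Suc M) * L j)"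
  proof (rule sum_mono)
    fix j
    have "(\<Sum>i<n. if j \<in> {i - M..i} then L j else 0) = (\<Sum>i\<in>{i\<in>{..<n}. j \<in> {i - M..i}}. L j)"
      by (rule sum.inter_filter[symmetric]) simp
    also have "\<dots> = real (card {i\<in>{..<n}. j \<in> {i - M..i}}) * L j" by simp
    also have "\<dots> \<le> real (Suc M) * L j"
    proof (intro mult_right_mono assms of_nat_mono)
      have "card {i\<in>{..<n}. j \<in> {i - M..i}} \<le> card {j..j + M}" by (rule card_mono) auto
      then show "card {i\<in>{..<n}. j \<in> {i - M..i}} \<le> Suc M" by simp
    qed
    finally show "(\<Sum>i<n. if j \<in> {i - M..i} then L j else 0) \<le> real (Suc M) * L j" .
  qed
  also have "\<dots> = real (Suc M) * (\<Sum>j<n. L j)" by (simp add: sum_distrib_left)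
  finally show ?thesis .
qed

lemma iterated_integral_diff:
  assumes "g absolutely_integrable_on {0..1}" "s absolutely_integrable_on {0..1}" "x \<in> {0..1}"
  shows "iterated_integral d (\<lambda>t. g t - s t) x = iterated_integral d g x - iterated_integral d s x"
proof -
  have "integral {0..1} (\<lambda>t. g t * tpow d t x - s t * tpow d t x)
      = integral {0..1} (\<lambda>t. g t * tpow d t x) - integral {0..1} (\<lambda>t. s t * tpow d t x)"
    by (intro Henstock_Kurzweil_Integration.integral_diff set_lebesgue_integral_eq_integral iterated_integral_integrable assms)
  then show ?thesis by (simp add: iterated_integral_def left_diff_distrib diff_divide_distrib)
qed

text \<open>
  The competitor for \<open>f\<close> is the Taylor polynomial, plus the iterated integral of \<open>s n\<close>, plus the spline
  that approximates the iterated integral of \<open>deriv01 (Suc d) f - s n\<close>.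
\<close>

lemma spline_err_le_derivative_approximants:
  fixes p :: real and m d :: nat
  assumes p: "0 < p" "p < 1" and dm: "Suc d < m"
  obtains K where "K > 0"
    "\<And>f n s B. \<lbrakk>differentiable01 d f; deriv01 d f \<in> AC01; 1 \<le> n;
      \<And>\<nu>. n \<le> \<nu> \<Longrightarrow> s \<nu> \<in> splines (m - Suc d) \<nu>;
      \<And>N. (\<Sum>\<nu>\<in>{n<..N}. real \<nu> powr (- p) * pow_dist p (deriv01 (Suc d) f) (s \<nu>)) \<le> B\<rbrakk> \<Longrightarrow>
    spline_err m n p f powr p \<le> K * real n powr (- (real (Suc d) * p)) *
      (pow_dist p (deriv01 (Suc d) f) (s n) + real n powr (p - 1) * B)"
proof -
  define M where "M = m - 1"
  define k where "k = m - Suc d"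
  have Mk: "d \<le> M" "1 \<le> M" "Suc M = m" "1 \<le> k" "k + Suc d = m" using dm by (auto simp: M_def k_def)
  have p1: "p \<le> 1" using p by simp
  obtain C1 where C1: "C1 > 0" and localL1: "\<And>g n s B. \<lbrakk>1 \<le> n; g absolutely_integrable_on {0..1};
      \<And>\<nu>. n \<le> \<nu> \<Longrightarrow> piecewise_poly (k - 1) \<nu> (s \<nu>);
      \<And>N. (\<Sum>\<nu>\<in>{n<..N}. real \<nu> powr (- p) * pow_dist p g (s \<nu>)) \<le> B\<rbrakk> \<Longrightarrow>
    (\<Sum>j<n. (integral (cell n j) (\<lambda>x. \<bar>g x - s n x\<bar>)) powr p)
      \<le> C1 * (real n powr (1 - p) * pow_dist p g (s n) + B)"
  proof (rule sum_local_L1_powr_le[OF p, of "k - 1"], goal_cases)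
    case (1 C)
    show ?case by (rule 1(1), rule 1(2), rule 1(3))
  qed
  obtain C2 where C2: "C2 > 0" and approx: "\<And>n h. \<lbrakk>0 < n; h absolutely_integrable_on {0..1}\<rbrakk> \<Longrightarrow>
    \<exists>S\<in>splines (Suc M) n. \<forall>i<n. \<forall>x\<in>cell n i.
      \<bar>iterated_integral d h x - S x\<bar> \<le> C2 / real n ^ d * (\<Sum>j\<in>{i - M..i}. integral (cell n j) (\<lambda>t. \<bar>h t\<bar>))"
    using iterated_integral_spline_approx[OF Mk(1,2)] by blast
  define K where "K = C2 powr p * real (Suc M) * C1"
  show thesis
  proof (rule that[of K])
    show "K > 0" using C1 C2 by (simp add: K_def)
    fix f n s B
    assume f: "differentiable01 d f" "deriv01 d f \<in> AC01" and n: "1 \<le> n"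
      and s: "\<And>\<nu>. n \<le> \<nu> \<Longrightarrow> s \<nu> \<in> splines (m - Suc d) \<nu>"
      and B: "\<And>N. (\<Sum>\<nu>\<in>{n<..N}. real \<nu> powr (- p) * pow_dist p (deriv01 (Suc d) f) (s \<nu>)) \<le> B"
    define g where "g = deriv01 (Suc d) f"
    obtain P where g: "g absolutely_integrable_on {0..1}" and P: "degree P \<le> d"
      "\<And>x. x \<in> {0..1} \<Longrightarrow> f x = poly P x + iterated_integral d g x"
      using derivative_representation[OF f] unfolding g_def by blast
    have n0: "0 < n" "0 < real n" using n by auto
    have sn: "s n \<in> splines k n" using s[of n] by (simp add: k_def)
    have snint: "s n absolutely_integrable_on {0..1}" by (rule spline_integrable[OF sn n0(1)])
    define h where "h t = g t - s n t" for t
    have h: "h absolutely_integrable_on {0..1}" unfolding h_def by (rule set_integral_diff(1)[OF g snint])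
    define L where "L j = integral (cell n j) (\<lambda>t. \<bar>h t\<bar>)" for j
    have L0: "0 \<le> L j" for j unfolding L_def by (rule integral_nonneg_pointwise) simp
    define a where "a = pow_dist p g (s n)"
    have sumL: "(\<Sum>j<n. L j powr p) \<le> C1 * (real n powr (1 - p) * a + B)"
      unfolding L_def h_def a_def
      by (rule localL1[OF n g]) (use s B in \<open>auto simp: g_def splines_iff k_def\<close>)
    obtain T where T: "T \<in> splines (Suc M) n" "\<And>i x. i < n \<Longrightarrow> x \<in> cell n i \<Longrightarrow>
      \<bar>iterated_integral d h x - T x\<bar> \<le> C2 / real n ^ d * (\<Sum>j\<in>{i - M..i}. L j)"
      using approx[OF n0(1) h] unfolding L_def by blast
    define S where "S x = (poly P x + 1 * iterated_integral d (s n) x) + 1 * T x" for x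
    have S: "S \<in> splines m n"
      unfolding S_def[abs_def]
    proof (intro splines_add_scaled poly_in_splines)
      show "degree P \<le> m - 1" using P(1) Mk by simp
      show "iterated_integral d (s n) \<in> splines m n"
        using iterated_integral_in_splines[OF Mk(4) n0(1) sn, of d] Mk(5) by simp
      show "T \<in> splines m n" using T(1) Mk(3) by simp
    qed
    have fS: "f x - S x = iterated_integral d h x - T x" if "x \<in> {0..1}" for x
      using P(2)[OF that] iterated_integral_diff[OF g snint that] by (simp add: S_def h_def[abs_def])
    have fint: "f absolutely_integrable_on {0..1}"
    proof (rule absolutely_integrable_continuous_real)
      have "continuous_on {0..1} (\<lambda>x. poly P x + iterated_integral d g x)"
        by (intro continuous_intros iterated_integral_continuous g)
      then show "continuous_on {0..1} f" by (rule continuous_on_eq) (simp add: P(2))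
    qed
    have fSint: "(\<lambda>x. \<bar>f x - S x\<bar> powr p) integrable_on {0..1}"
      by (intro set_lebesgue_integral_eq_integral absolutely_integrable_abs_powr p p1 set_integral_diff fint
          spline_integrable[OF S n0(1)])
    define c where "c = (C2 / real n ^ d) powr p"
    have cellwise: "integral (cell n i) (\<lambda>x. \<bar>f x - S x\<bar> powr p) \<le> 1 / real n * (c * (\<Sum>j\<in>{i - M..i}. L j powr p))"
      if i: "i < n" for i
    proof -
      have sub: "cell n i \<subseteq> {0..1}" by (rule cell_subset[OF i])
      have "integral (cell n i) (\<lambda>x. \<bar>f x - S x\<bar> powr p) \<le> integral (cell n i) (\<lambda>x. c * (\<Sum>j\<in>{i - M..i}. L j powr p))"
      proof (rule integral_le)
        show "(\<lambda>x. \<bar>f x - S x\<bar> powr p) integrable_on cell n i"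
          using integrable_on_subinterval[OF fSint] sub unfolding cell_def by blast
        show "(\<lambda>x. c * (\<Sum>j\<in>{i - M..i}. L j powr p)) integrable_on cell n i"
          unfolding cell_def by (rule integrable_const_ivl)
        fix x assume x: "x \<in> cell n i"
        then have "\<bar>f x - S x\<bar> \<le> C2 / real n ^ d * (\<Sum>j\<in>{i - M..i}. L j)" using T(2)[OF i x] fS sub by auto
        then have "\<bar>f x - S x\<bar> powr p \<le> (C2 / real n ^ d * (\<Sum>j\<in>{i - M..i}. L j)) powr p"
          using p by (intro powr_mono2) auto
        also have "\<dots> = c * (\<Sum>j\<in>{i - M..i}. L j) powr p"
          unfolding c_def by (rule powr_mult)
        also have "\<dots> \<le> c * (\<Sum>j\<in>{i - M..i}. L j powr p)"
          using L0 p p1 by (intro mult_left_mono powr_sum_le_sum_powr) (auto simp: c_def)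
        finally show "\<bar>f x - S x\<bar> powr p \<le> c * (\<Sum>j\<in>{i - M..i}. L j powr p)" .
      qed
      also have "\<dots> = 1 / real n * (c * (\<Sum>j\<in>{i - M..i}. L j powr p))"
        by (simp add: cell_def divide_right_mono diff_divide_distrib[symmetric])
      finally show ?thesis .
    qed
    have cn: "1 / real n * c * real n powr (1 - p) = C2 powr p * real n powr (- (real (Suc d) * p))"
    proof -
      have "c = C2 powr p * real n powr (- (real d * p))"
      proof -
        have "(real n ^ d) powr p = real n powr (real d * p)" using n0 by (simp add: powr_realpow[symmetric] powr_powr)
        then show ?thesis by (simp add: c_def powr_divide powr_minus_divide)
      qed
      moreover have "1 / real n = real n powr (- 1)" using n0 by (simp add: powr_minus divide_inverse)
      ultimately have "1 / real n * c * real n powr (1 - p)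
        = C2 powr p * (real n powr (- 1) * real n powr (- (real d * p)) * real n powr (1 - p))" by (simp add: mult_ac)
      also have "real n powr (- 1) * real n powr (- (real d * p)) * real n powr (1 - p) = real n powr (- (real (Suc d) * p))"
        unfolding powr_add[symmetric]
        by (rule arg_cong[where f = "\<lambda>y. real n powr y"]) (simp add: algebra_simps)
      finally show ?thesis .
    qed
    have "spline_err m n p f powr p \<le> pow_dist p f S"
      by (rule spline_err_powr_le[OF p(1) p1 fint n0(1) S])
    also have "\<dots> = (\<Sum>i<n. integral (cell n i) (\<lambda>x. \<bar>f x - S x\<bar> powr p))" by (rule integral_cells[OF n0(1) fSint])
    also have "\<dots> \<le> (\<Sum>i<n. 1 / real n * (c * (\<Sum>j\<in>{i - M..i}. L j powr p)))"
      by (intro sum_mono cellwise) simp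
    also have "\<dots> = 1 / real n * c * (\<Sum>i<n. \<Sum>j\<in>{i - M..i}. L j powr p)" by (simp add: sum_distrib_left mult_ac)
    also have "\<dots> \<le> 1 / real n * c * (real (Suc M) * (\<Sum>j<n. L j powr p))"
      by (intro mult_left_mono sum_windows_le) (auto simp: c_def)
    also have "\<dots> \<le> 1 / real n * c * (real (Suc M) * (C1 * (real n powr (1 - p) * a + B)))"
      by (intro mult_left_mono sumL) (auto simp: c_def)
    also have "B = real n powr (1 - p) * (real n powr (p - 1) * B)"
      using n0 by (simp add: mult.assoc[symmetric] powr_add[symmetric])
    also have "1 / real n * c * (real (Suc M) * (C1 * (real n powr (1 - p) * a + real n powr (1 - p) * (real n powr (p - 1) * B))))
      = (1 / real n * c * real n powr (1 - p)) * (real (Suc M) * C1 * (a + real n powr (p - 1) * B))"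
      by (simp add: algebra_simps)
    also have "\<dots> = K * real n powr (- (real (Suc d) * p)) * (a + real n powr (p - 1) * B)"
      unfolding cn by (simp add: K_def mult_ac)
    finally show "spline_err m n p f powr p \<le> K * real n powr (- (real (Suc d) * p)) *
      (pow_dist p (deriv01 (Suc d) f) (s n) + real n powr (p - 1) * B)"
      by (simp add: a_def g_def)
  qed
qed

lemma powr_inverse_add_le:
  fixes u v p :: real
  assumes "0 < p" "0 \<le> u" "0 \<le> v"
  shows "(u + v) powr (1 / p) \<le> 2 powr (1 / p) * (u powr (1 / p) + v powr (1 / p))"
proof -
  have "(u + v) powr (1 / p) \<le> (2 * max u v) powr (1 / p)" using assms by (intro powr_mono2) auto
  also have "\<dots> = 2 powr (1 / p) * max u v powr (1 / p)" using assms by (simp add: powr_mult)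
  also have "\<dots> \<le> 2 powr (1 / p) * (u powr (1 / p) + v powr (1 / p))" by (intro mult_left_mono) (auto simp: max_def)
  finally show ?thesis .
qed

theorem theorem3p1:
  fixes p :: real and m r :: nat
  assumes "0 < p" "p < 1" and "1 \<le> r" "r < m"
  shows "\<exists>C::real. \<forall>f::real \<Rightarrow> real.
    differentiable01 (r - 1) f \<longrightarrow>
    deriv01 (r - 1) f \<in> AC01 \<longrightarrow>
    (\<lambda>\<nu>. real \<nu> powr (- p) * spline_err (m - r) \<nu> p (deriv01 r f) powr p) summable_on {1..} \<longrightarrow>
    (\<forall>n\<ge>1. spline_err m n p f \<le> C / real n ^ r *
       (spline_err (m - r) n p (deriv01 r f) +
        real n powr (1 - 1 / p) *
          (\<Sum>\<^sub>\<infinity>\<nu>\<in>{n + 1..}. real \<nu> powr (- p) * spline_err (m - r) \<nu> p (deriv01 r f) powr p)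
            powr (1 / p)))"
proof -
  define d where "d = r - 1"
  have r: "r = Suc d" using assms(3) by (simp add: d_def)
  have p: "0 < p" "p < 1" "p \<le> 1" using assms by auto
  have dm: "Suc d < m" using assms(4) r by simp
  obtain K where K: "K > 0" and main: "\<And>f n s B. \<lbrakk>differentiable01 d f; deriv01 d f \<in> AC01; 1 \<le> n;
      \<And>\<nu>. n \<le> \<nu> \<Longrightarrow> s \<nu> \<in> splines (m - Suc d) \<nu>;
      \<And>N. (\<Sum>\<nu>\<in>{n<..N}. real \<nu> powr (- p) * pow_dist p (deriv01 (Suc d) f) (s \<nu>)) \<le> B\<rbrakk> \<Longrightarrow>
    spline_err m n p f powr p \<le> K * real n powr (- (real (Suc d) * p)) *
      (pow_dist p (deriv01 (Suc d) f) (s n) + real n powr (p - 1) * B)"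
  proof (rule spline_err_le_derivative_approximants[OF p(1,2) dm], goal_cases)
    case (1 K)
    show ?case by (rule 1(1), rule 1(2), rule 1(3))
  qed
  have "spline_err m n p f \<le> (2 * K) powr (1 / p) / real n ^ r *
       (spline_err (m - r) n p (deriv01 r f) +
        real n powr (1 - 1 / p) *
          (\<Sum>\<^sub>\<infinity>\<nu>\<in>{n + 1..}. real \<nu> powr (- p) * spline_err (m - r) \<nu> p (deriv01 r f) powr p)
            powr (1 / p))"
    if diff: "differentiable01 (r - 1) f" and AC: "deriv01 (r - 1) f \<in> AC01"
      and sm: "(\<lambda>\<nu>. real \<nu> powr (- p) * spline_err (m - r) \<nu> p (deriv01 r f) powr p) summable_on {1..}"
      and n: "1 \<le> n" for f n
  proof -
    define g where "g = deriv01 r f"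
    define e where "e \<nu> = spline_err (m - r) \<nu> p g" for \<nu>
    define t where "t \<nu> = real \<nu> powr (- p) * e \<nu> powr p" for \<nu>
    define A where "A = (\<Sum>\<^sub>\<infinity>\<nu>\<in>{n + 1..}. t \<nu>)"
    have e0: "0 \<le> e \<nu>" for \<nu> unfolding e_def by (rule spline_err_nonneg)
    have t0: "0 \<le> t \<nu>" for \<nu> by (simp add: t_def)
    have tsum: "t summable_on {n + 1..}"
      using sm unfolding t_def e_def g_def by (rule summable_on_subset_banach) auto
    have A0: "0 \<le> A" unfolding A_def by (intro infsum_nonneg t0)
    have n0: "0 < real n" using n by simp
    have gint: "g absolutely_integrable_on {0..1}"
      using derivative_representation[of d f] diff AC unfolding g_def r by simp blast
    define X where "X = K * real n powr (- (real r * p)) * (e n powr p + real n powr (p - 1) * A)"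
    define c where "c = K * real n powr (- (real r * p)) * (1 + real n powr (p - 1))"
    have c: "c > 0" using K n0 by (simp add: c_def add_pos_pos)
    have eps: "spline_err m n p f powr p \<le> X + c * \<epsilon>" if eps: "\<epsilon> > 0" for \<epsilon>
    proof -
      \<comment> \<open>The slack decreases like \<open>2\<^sup>-\<^sup>\<nu>\<close>, so that over all \<open>\<nu>\<close> it adds up to at most \<open>\<epsilon>\<close>.\<close>
      have "\<exists>S. S \<in> splines (m - r) \<nu> \<and> pow_dist p g S \<le> e \<nu> powr p + \<epsilon> / 2 ^ \<nu>"
        if "n \<le> \<nu>" for \<nu>
      proof -
        have "0 < \<nu>" "0 < \<epsilon> / 2 ^ \<nu>" using that n eps by auto
        from near_best_spline[OF p(1,3) gint this] show ?thesis unfolding e_def by blast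
      qed
      then obtain s where s: "\<And>\<nu>. n \<le> \<nu> \<Longrightarrow> s \<nu> \<in> splines (m - r) \<nu>"
        "\<And>\<nu>. n \<le> \<nu> \<Longrightarrow> pow_dist p g (s \<nu>) \<le> e \<nu> powr p + \<epsilon> / 2 ^ \<nu>"
        by metis
      have part: "(\<Sum>\<nu>\<in>{n<..N}. real \<nu> powr (- p) * pow_dist p g (s \<nu>)) \<le> A + \<epsilon>" for N
      proof -
        have "(\<Sum>\<nu>\<in>{n<..N}. real \<nu> powr (- p) * pow_dist p g (s \<nu>))
          \<le> (\<Sum>\<nu>\<in>{n<..N}. t \<nu> + \<epsilon> * (1 / 2) ^ \<nu>)"
        proof (rule sum_mono)
          fix \<nu> assume nu: "\<nu> \<in> {n<..N}"
          have one: "real \<nu> powr (- p) \<le> 1" using nu n p by (simp add: powr_minus divide_le_eq inverse_le_1_iff ge_one_powr_ge_zero)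
          have "real \<nu> powr (- p) * pow_dist p g (s \<nu>)
            \<le> real \<nu> powr (- p) * (e \<nu> powr p + \<epsilon> / 2 ^ \<nu>)"
            using nu by (intro mult_left_mono s) auto
          also have "\<dots> = t \<nu> + real \<nu> powr (- p) * (\<epsilon> / 2 ^ \<nu>)" by (simp add: t_def distrib_left)
          also have "\<dots> \<le> t \<nu> + 1 * (\<epsilon> / 2 ^ \<nu>)" using one eps by (intro add_mono mult_right_mono) auto
          finally show "real \<nu> powr (- p) * pow_dist p g (s \<nu>) \<le> t \<nu> + \<epsilon> * (1 / 2) ^ \<nu>"
            by (simp add: power_divide)
        qed
        also have "\<dots> = (\<Sum>\<nu>\<in>{n<..N}. t \<nu>) + \<epsilon> * (\<Sum>\<nu>\<in>{n<..N}. (1 / 2) ^ \<nu>)"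
          by (simp add: sum.distrib sum_distrib_left)
        also have "\<dots> \<le> A + \<epsilon> * 1"
        proof (intro add_mono mult_left_mono)
          show "(\<Sum>\<nu>\<in>{n<..N}. t \<nu>) \<le> A" unfolding A_def
            by (rule finite_sum_le_infsum[OF tsum]) (auto simp: t0)
          have "(\<Sum>\<nu>\<in>{n<..N}. (1 / 2 :: real) ^ \<nu>) \<le> (\<Sum>\<nu>. (1 / 2) ^ Suc \<nu>)"
          proof -
            have "(\<Sum>\<nu>\<in>{n<..N}. (1 / 2 :: real) ^ \<nu>) \<le> (\<Sum>\<nu>\<in>Suc ` {..<N}. (1 / 2) ^ \<nu>)"
            proof (rule sum_mono2)
              show "{n<..N} \<subseteq> Suc ` {..<N}"
              proof
                fix \<nu> assume "\<nu> \<in> {n<..N}"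
                then have "\<nu> = Suc (\<nu> - 1)" "\<nu> - 1 < N" by auto
                then show "\<nu> \<in> Suc ` {..<N}" by blast
              qed
            qed auto
            also have "\<dots> = (\<Sum>\<nu><N. (1 / 2) ^ Suc \<nu>)" by (simp add: sum.reindex)
            also have "\<dots> \<le> (\<Sum>\<nu>. (1 / 2) ^ Suc \<nu>)"
              using sums_summable[OF power_half_series] by (intro sum_le_suminf) auto
            finally show ?thesis .
          qed
          also have "\<dots> = 1" using sums_unique[OF power_half_series] by simp
          finally show "(\<Sum>\<nu>\<in>{n<..N}. (1 / 2 :: real) ^ \<nu>) \<le> 1" .
        qed (use eps in auto)
        finally show ?thesis by simp
      qed
      have "spline_err m n p f powr p \<le> K * real n powr (- (real r * p)) *
        (pow_dist p g (s n) + real n powr (p - 1) * (A + \<epsilon>))"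
        unfolding g_def r
        by (rule main) (use diff AC n s part in \<open>simp_all add: r g_def\<close>)
      also have "\<dots> \<le> K * real n powr (- (real r * p)) * ((e n powr p + \<epsilon>) + real n powr (p - 1) * (A + \<epsilon>))"
      proof (intro mult_left_mono add_right_mono)
        have "\<epsilon> / 2 ^ n \<le> \<epsilon>" using eps by (simp add: divide_le_eq)
        with s(2)[of n] show "pow_dist p g (s n) \<le> e n powr p + \<epsilon>" by simp
      qed (use K in auto)
      also have "\<dots> = X + c * \<epsilon>" by (simp add: X_def c_def algebra_simps)
      finally show ?thesis .
    qed
    have "spline_err m n p f powr p \<le> X"
    proof (rule field_le_epsilon)
      fix y :: real assume "0 < y"
      then have "0 < y / c" using c by simp
      from eps[OF this] show "spline_err m n p f powr p \<le> X + y" using c by simp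
    qed
    then have "(spline_err m n p f powr p) powr (1 / p) \<le> X powr (1 / p)" using p by (intro powr_mono2) auto
    then have "spline_err m n p f \<le> X powr (1 / p)" using p spline_err_nonneg by (simp add: powr_powr)
    also have "X powr (1 / p) = K powr (1 / p) * (real n powr (- (real r * p))) powr (1 / p) * (e n powr p + real n powr (p - 1) * A) powr (1 / p)"
      using K A0 e0 by (simp add: X_def powr_mult)
    also have "(real n powr (- (real r * p))) powr (1 / p) = 1 / real n ^ r"
    proof -
      have "(real n powr (- (real r * p))) powr (1 / p) = real n powr (- real r)" using p by (simp add: powr_powr)
      then show ?thesis using n0 by (simp add: powr_minus powr_realpow divide_inverse)
    qed
    also have "K powr (1 / p) * (1 / real n ^ r) * (e n powr p + real n powr (p - 1) * A) powr (1 / p)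
      \<le> K powr (1 / p) * (1 / real n ^ r) * (2 powr (1 / p) * ((e n powr p) powr (1 / p) + (real n powr (p - 1) * A) powr (1 / p)))"
      using A0 p by (intro mult_left_mono powr_inverse_add_le) auto
    also have "(e n powr p) powr (1 / p) = e n" using e0 p by (simp add: powr_powr)
    also have "(real n powr (p - 1) * A) powr (1 / p) = real n powr (1 - 1 / p) * A powr (1 / p)"
      using A0 p by (simp add: powr_mult powr_powr diff_divide_distrib)
    also have "K powr (1 / p) * (1 / real n ^ r) * (2 powr (1 / p) * (e n + real n powr (1 - 1 / p) * A powr (1 / p)))
      = (2 * K) powr (1 / p) / real n ^ r * (e n + real n powr (1 - 1 / p) * A powr (1 / p))"
      using K by (simp add: powr_mult)
    finally show ?thesis by (simp add: e_def A_def t_def g_def)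
  qed
  then show ?thesis by blast
qed

end
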